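(* Let $1<p<\infty$, $\alpha>0$ and $f\in L_p(\mathbb T)\cap\widehat{GM}$. Then for all $n\in\mathbb N$ $$\omega_\alpha(f,2^{-n})_{L_p(\mathbb T)}\asymp\Big(\sum_{k=n}^\infty2^{-p\alpha k}\|(S_{2^k}f)^{(\alpha)}\|_{L_p(\mathbb T)}^p\Big)^{1/p},$$ that is, each side is bounded by a constant times the other, with constants independent of $n$ and depending on $f$ only through the constant in the $GM$ condition for its Fourier coefficients.
   Context: $\mathbb T=[0,2\pi]$. A (complex) sequence $\{d_n\}_{n\ge1}$ is general monotone, $\{d_n\}\in GM$, if there is $C$ with $\sum_{k=n}^{2n}|d_k-d_{k+1}|\le C|d_n|$ for all $n$. $\widehat{GM}$ is the class of integrable functions $f(x)\sim\sum_{n=1}^\infty(a_n\cos nx+b_n\sin nx)$ with $\{a_n\},\{b_n\}\in GM$. $S_nf$ is the $n$-th partial sum of the Fourier series of $f$; $g^{(\alpha)}$ is the derivative of order $\alpha$ (fractional, in the Weyl sense, with Fourier multiplier $(ik)^\alpha$). The modulus of smoothness of order $\alpha>0$ is $$\omega_\alpha(f,\delta)_{L_p(\mathbb T)}=\sup_{|h|\le\delta}\Big\|\sum_{\nu=0}^\infty(-1)^\nu\binom\alpha\nu f(\cdot+(\alpha-\nu)h)\Big\|_{L_p(\mathbb T)},\quad \binom\alpha\nu=\frac{\alpha(\alpha-1)\cdots(\alpha-\nu+1)}{\nu!},\ \binom\alpha0=1.$$ *)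

theory Defs
  imports "HOL-Analysis.Analysis"
begin

text \<open>Functions on the torus are complex-valued functions on the real line of period
  \<open>2 * pi\<close>. Real-valued functions are included as a special case.\<close>

definition Lp :: "real \<Rightarrow> (real \<Rightarrow> complex) set" where
  "Lp p = {f. (\<forall>x. f (x + 2 * pi) = f x) \<and> f \<in> borel_measurable lebesgue \<and>
              set_integrable lebesgue {0..2 * pi} (\<lambda>x. norm (f x) powr p)}"

definition Lp_norm :: "real \<Rightarrow> (real \<Rightarrow> complex) \<Rightarrow> real" where
  "Lp_norm p f = (LINT x:{0..2 * pi}|lebesgue. norm (f x) powr p) powr (1 / p)"

definition fourier_cos :: "(real \<Rightarrow> complex) \<Rightarrow> nat \<Rightarrow> complex" where
  "fourier_cos f n = (LINT x:{0..2 * pi}|lebesgue. f x * of_real (cos (real n * x))) / of_real pi"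

definition fourier_sin :: "(real \<Rightarrow> complex) \<Rightarrow> nat \<Rightarrow> complex" where
  "fourier_sin f n = (LINT x:{0..2 * pi}|lebesgue. f x * of_real (sin (real n * x))) / of_real pi"

definition fourier_exp :: "(real \<Rightarrow> complex) \<Rightarrow> int \<Rightarrow> complex" where
  "fourier_exp f k = (LINT x:{0..2 * pi}|lebesgue. f x * cis (- (of_int k * x))) / of_real (2 * pi)"

definition fourier_sum :: "nat \<Rightarrow> (real \<Rightarrow> complex) \<Rightarrow> real \<Rightarrow> complex" where
  "fourier_sum n f x = fourier_cos f 0 / 2 +
     (\<Sum>k=1..n. fourier_cos f k * of_real (cos (real k * x)) + fourier_sin f k * of_real (sin (real k * x)))"

text \<open>The Weyl derivative, given by the Fourier multiplier \<open>(ik)\<^sup>\<alpha>\<close> with the principal branch,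
  i.e. \<open>\<bar>k\<bar>\<^sup>\<alpha> exp (i \<pi> \<alpha> sgn k / 2)\<close>; the term \<open>k = 0\<close> vanishes since \<open>0 powr z = 0\<close>.
  It is only applied to trigonometric polynomials, for which all but finitely many terms of the
  sum are zero.\<close>

definition weyl_deriv :: "real \<Rightarrow> (real \<Rightarrow> complex) \<Rightarrow> real \<Rightarrow> complex" where
  "weyl_deriv \<alpha> g x =
     (\<Sum>\<^sub>\<infinity>k::int. (\<i> * of_int k) powr of_real \<alpha> * fourier_exp g k * cis (of_int k * x))"

text \<open>For \<open>\<alpha> > 0\<close> the coefficients \<open>\<alpha> gchoose \<nu>\<close> are absolutely summable, so for \<open>f \<in> Lp p\<close> with
  \<open>p \<ge> 1\<close> the series converges absolutely for almost every \<open>x\<close>, and the norms over which the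
  supremum in \<open>modulus\<close> is taken are bounded.\<close>

definition frac_diff :: "real \<Rightarrow> real \<Rightarrow> (real \<Rightarrow> complex) \<Rightarrow> real \<Rightarrow> complex" where
  "frac_diff \<alpha> h f x = (\<Sum>\<nu>. of_real ((-1) ^ \<nu> * (\<alpha> gchoose \<nu>)) * f (x + (\<alpha> - real \<nu>) * h))"

definition modulus :: "real \<Rightarrow> real \<Rightarrow> (real \<Rightarrow> complex) \<Rightarrow> real \<Rightarrow> real" where
  "modulus p \<alpha> f \<delta> = (SUP h\<in>{h. \<bar>h\<bar> \<le> \<delta>}. Lp_norm p (frac_diff \<alpha> h f))"

text \<open>Sequences are indexed from 1; the value at 0 is irrelevant.\<close>

definition GM_with :: "real \<Rightarrow> (nat \<Rightarrow> complex) \<Rightarrow> bool" where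
  "GM_with C d \<longleftrightarrow> (\<forall>n\<ge>1. (\<Sum>k=n..2*n. norm (d k - d (Suc k))) \<le> C * norm (d n))"

definition GM :: "(nat \<Rightarrow> complex) set" where
  "GM = {d. \<exists>C. GM_with C d}"

text \<open>The Fourier series of a function in this class has no constant term.\<close>

definition GM_hat :: "(real \<Rightarrow> complex) set" where
  "GM_hat = {f \<in> Lp 1. fourier_cos f 0 = 0 \<and> fourier_cos f \<in> GM \<and> fourier_sin f \<in> GM}"

definition dyadic_term :: "real \<Rightarrow> real \<Rightarrow> (real \<Rightarrow> complex) \<Rightarrow> nat \<Rightarrow> real" where
  "dyadic_term p \<alpha> f k =
     2 powr (- p * \<alpha> * real k) * Lp_norm p (weyl_deriv \<alpha> (fourier_sum (2 ^ k) f)) powr p"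

end

theory Submission imports Defs begin

text \<open>
  With \<open>E j = \<bar>a (2 ^ j)\<bar> ^ p + \<bar>b (2 ^ j)\<bar> ^ p\<close>, both sides are comparable to
  \<open>2 ^ (- n \<alpha> p) * (\<Sum>j\<le>n. 2 ^ (j (\<alpha> p + p - 1)) * E j) + (\<Sum>j>n. 2 ^ (j (p - 1)) * E j)\<close>.

  Upper bounds: after summation by parts the \<open>j\<close>-th dyadic block of a series with general monotone
  coefficients is at most a constant times \<open>\<bar>a (2 ^ j)\<bar> * min (2 ^ j) (1 / \<bar>sin (x / 2)\<bar>)\<close>, also after multiplying the
  coefficients by a monotone weight, and a Hardy inequality sums the blocks in \<open>L\<^sub>p\<close>. Both multipliers occurring here are
  monotone weights up to a translation and a constant phase: \<open>k powr \<alpha>\<close> for the Weyl derivative, and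
  \<open>(2 sin (k h / 2)) powr \<alpha>\<close> for the difference of a polynomial of degree at most \<open>1 / h\<close>.

  Lower bounds: test against a sum of dyadic blocks with coefficients \<open>cnj (sgn (a k))\<close>, which have bounded variation
  on every block where \<open>\<bar>a\<bar>\<close> does not drop too much; the other blocks are absorbed geometrically. The test sum
  is controlled in \<open>L\<^sub>q\<close>, \<open>1/p + 1/q = 1\<close>, by the same Hardy inequality, so no Riesz or multiplier theorem is needed. For the
  frequencies above \<open>1 / h\<close> the difference is averaged over the step.
\<close>

text \<open>Everything is measured at the coefficients of index \<open>2 ^ j\<close>, and the GM
  condition controls these in one direction only: from \<open>n\<close> up to
  \<open>2 * n + 1\<close> a coefficient grows at most by the factor \<open>1 + C\<close>, but it
  may drop suddenly, even to 0. Hence upper bounds use the block that starts at \<open>2 ^ j\<close>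
  and lower bounds the block that ends there (\<open>dyblock\<close>); the latter must cope with a
  drop, across which the signs need not have bounded variation. A second obstacle: the tail of
  \<open>f\<close> is bounded through polynomials, so the Fourier series must be known to represent
  \<open>f\<close>. The lower bound, tested on \<open>f\<close> alone, yields decay of the
  coefficients, the decay yields convergence off the zeros of \<open>sin (x / 2)\<close>, and a
  uniqueness theorem identifies the limit. Finally, a few blocks just above the frequency
  \<open>2 ^ n\<close> are seen neither by a single difference of step
  \<open>2 powr (- real n)\<close> nor by the average over smaller steps; there the growth bound
  from block \<open>n\<close> is used. Their number depends only on \<open>\<alpha>\<close>.\<close>

section \<open>Summation by parts and the Dirichlet kernel\<close>

text \<open>Majorant of a Dirichlet sum with at most \<open>2 ^ j\<close> terms; the case distinction is there because \<open>1 / 0 = 0\<close>.\<close>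
definition dk :: "nat \<Rightarrow> real \<Rightarrow> real" where
  "dk j x = (if sin (x / 2) = 0 then 2 ^ j else min (2 ^ j) (1 / \<bar>sin (x / 2)\<bar>))"

lemma dk_nonneg: "0 \<le> dk j x"
  by (simp add: dk_def)

lemma dk_le: "dk j x \<le> 2 ^ j"
  by (simp add: dk_def)

lemma dk_measurable [measurable]: "dk j \<in> borel_measurable borel"
  unfolding dk_def by measurable

text \<open>Abel summation against the tails of \<open>e\<close>, so that beside the variation only
  the first value \<open>d s\<close> survives. \<open>GM_block_bound\<close> uses it twice, for the
  coefficients and then for the weight.\<close>

lemma sum_by_parts_bound:
  fixes d e :: "nat \<Rightarrow> 'a :: real_normed_field"
  assumes "s \<le> t" and "\<And>r. s \<le> r \<Longrightarrow> r \<le> t \<Longrightarrow> norm (\<Sum>k=r..t. e k) \<le> B"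
  shows "norm (\<Sum>k=s..t. d k * e k) \<le> B * (norm (d s) + (\<Sum>k=s..<t. norm (d k - d (Suc k))))"
proof -
  have B0: "0 \<le> B"
    using assms(2)[of s] assms(1) norm_ge_zero order_trans by blast
  have id: "(\<Sum>k=s..t. d k * e k)
      = d s * (\<Sum>k=s..t. e k) + (\<Sum>k=s..<t. (d (Suc k) - d k) * (\<Sum>i=Suc k..t. e i))"
    using assms(1)
  proof (induction s rule: inc_induct)
    case (step s)
    have "(\<Sum>k=s..t. d k * e k) = d s * e s + (\<Sum>k=Suc s..t. d k * e k)"
      using step.hyps by (simp add: sum.atLeast_Suc_atMost)
    moreover have "(\<Sum>k=s..t. e k) = e s + (\<Sum>k=Suc s..t. e k)"
      using step.hyps by (simp add: sum.atLeast_Suc_atMost)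
    moreover have "(\<Sum>k=s..<t. (d (Suc k) - d k) * (\<Sum>i=Suc k..t. e i))
       = (d (Suc s) - d s) * (\<Sum>i=Suc s..t. e i) + (\<Sum>k=Suc s..<t. (d (Suc k) - d k) * (\<Sum>i=Suc k..t. e i))"
      using step.hyps by (simp add: sum.atLeast_Suc_lessThan)
    ultimately show ?case
      using step.IH by (simp add: algebra_simps)
  qed auto
  have "norm (\<Sum>k=s..<t. (d (Suc k) - d k) * (\<Sum>i=Suc k..t. e i)) \<le> (\<Sum>k=s..<t. norm (d k - d (Suc k)) * B)"
    using assms(2) by (intro sum_norm_le) (auto simp: norm_mult norm_minus_commute intro!: mult_mono)
  moreover have "norm (d s * (\<Sum>k=s..t. e k)) \<le> norm (d s) * B"
    using assms by (auto simp: norm_mult intro!: mult_left_mono)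
  ultimately show ?thesis
    unfolding id using norm_triangle_le[of "d s * (\<Sum>k=s..t. e k)"]
    by (simp add: algebra_simps sum_distrib_left) (smt (verit) norm_triangle_ineq)
qed

text \<open>Multiplication by \<open>2 * sin (x / 2)\<close> makes the sum telescope. The free phase
  \<open>\<xi>\<close> covers sines as well as the phases produced by derivatives and
  differences.\<close>

lemma cos_sum_bound:
  fixes x \<xi> :: real
  assumes "t + 1 - r \<le> 2 ^ j"
  shows "\<bar>\<Sum>k=r..t. cos (real k * x + \<xi>)\<bar> \<le> dk j x"
proof -
  have 1: "\<bar>\<Sum>k=r..t. cos (real k * x + \<xi>)\<bar> \<le> 2 ^ j"
  proof -
    have "\<bar>\<Sum>k=r..t. cos (real k * x + \<xi>)\<bar> \<le> (\<Sum>k=r..t. 1)"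
      by (intro order_trans[OF sum_abs] sum_mono) auto
    also have "\<dots> = real (t + 1 - r)" by simp
    also have "\<dots> \<le> 2 ^ j" using assms by (metis of_nat_le_iff of_nat_numeral of_nat_power)
    finally show ?thesis .
  qed
  have 2: "\<bar>sin (x/2)\<bar> * \<bar>\<Sum>k=r..t. cos (real k * x + \<xi>)\<bar> \<le> 1"
  proof (cases "r \<le> t")
    case True
    have "2 * sin (x/2) * cos (real k * x + \<xi>)
        = sin ((real (Suc k) - 1/2) * x + \<xi>) - sin ((real k - 1/2) * x + \<xi>)" for k
      by (simp add: sin_diff_sin algebra_simps add_divide_distrib diff_divide_distrib)
    then have "2 * sin (x/2) * (\<Sum>k=r..t. cos (real k * x + \<xi>))
        = (\<Sum>k=r..t. sin ((real (Suc k) - 1/2) * x + \<xi>) - sin ((real k - 1/2) * x + \<xi>))"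
      by (simp add: sum_distrib_left)
    also have "\<dots> = sin ((real (Suc t) - 1/2) * x + \<xi>) - sin ((real r - 1/2) * x + \<xi>)"
      using True by (intro sum_Suc_diff) simp
    finally have "\<bar>2 * sin (x/2) * (\<Sum>k=r..t. cos (real k * x + \<xi>))\<bar> \<le> 1 + 1"
      by (smt (verit) sin_le_one sin_ge_minus_one)
    then show ?thesis by (simp add: abs_mult)
  qed auto
  show ?thesis
    using 1 2 by (auto simp: dk_def field_simps)
qed

section \<open>Integration over a period\<close>

abbreviation circM :: "real measure" where
  "circM \<equiv> lebesgue_on {0..2 * pi}"

lemma set_integrable_circM: "set_integrable lebesgue {0..2 * pi} f \<longleftrightarrow> integrable circM f"
  for f :: "real \<Rightarrow> 'a :: {banach, second_countable_topology}"
  by (simp add: set_integrable_def integrable_restrict_space)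

lemma set_integral_circM: "(LINT x:{0..2 * pi}|lebesgue. f x) = integral\<^sup>L circM f"
  for f :: "real \<Rightarrow> 'a :: {banach, second_countable_topology}"
  by (simp add: set_lebesgue_integral_def integral_restrict_space)

lemma finite_measure_circM: "finite_measure circM"
  by (rule finite_measure_lebesgue_on) auto

lemma integrable_circM_bounded:
  fixes f :: "real \<Rightarrow> 'a :: {banach, second_countable_topology}"
  assumes "f \<in> borel_measurable circM" "\<And>x. norm (f x) \<le> B"
  shows "integrable circM f"
  using finite_measure.integrable_const_bound[OF finite_measure_circM] assms by blast

text \<open>Discards the zeros of \<open>sin (x / 2)\<close> in the period, so that
  \<open>1 / \<bar>sin (x / 2)\<bar>\<close> can serve as a majorant almost everywhere.\<close>

lemma AE_circM_interior: "AE x in circM. 0 < x \<and> x < 2 * pi"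
proof -
  have "AE x in lebesgue. x \<noteq> 0 \<and> x \<noteq> 2 * pi"
    using AE_lborel_singleton[of "0::real"] AE_lborel_singleton[of "2*pi"] by (auto intro!: AE_completion)
  then show ?thesis
    by (subst AE_restrict_space_iff) auto
qed

section \<open>The Hardy inequality for sums of Dirichlet majorants\<close>

lemma sum_geometric_le:
  fixes r :: real
  assumes "0 < r" "r < 1" "finite (J :: nat set)"
  shows "(\<Sum>j\<in>J. r ^ j) \<le> 1 / (1 - r)"
proof -
  have "(\<Sum>j\<in>J. r ^ j) \<le> (\<Sum>j. r ^ j)"
    using assms by (intro sum_le_suminf) auto
  then show ?thesis using assms by (simp add: suminf_geometric)
qed

lemma sum_geometric_dist_le:
  fixes r :: real
  assumes "0 < r" "r < 1" "finite (J :: nat set)"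
  shows "(\<Sum>j\<in>J. r powr \<bar>real j - real m\<bar>) \<le> 2 / (1 - r)"
proof -
  have "(\<Sum>j\<in>J. r powr \<bar>real j - real m\<bar>) = (\<Sum>j\<in>J\<inter>{..m}. r powr \<bar>real j - real m\<bar>) + (\<Sum>j\<in>J-{..m}. r powr \<bar>real j - real m\<bar>)"
    using assms by (metis sum.Int_Diff)
  also have "(\<Sum>j\<in>J\<inter>{..m}. r powr \<bar>real j - real m\<bar>) = (\<Sum>i\<in>(\<lambda>j. m - j) ` (J\<inter>{..m}). r ^ i)"
    using assms by (subst sum.reindex) (auto simp: inj_on_def of_nat_diff powr_realpow[symmetric] intro!: sum.cong)
  also have "(\<Sum>j\<in>J-{..m}. r powr \<bar>real j - real m\<bar>) = (\<Sum>i\<in>(\<lambda>j. j - m) ` (J-{..m}). r ^ i)"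
    using assms by (subst sum.reindex) (auto simp: inj_on_def of_nat_diff powr_realpow[symmetric] intro!: sum.cong)
  finally show ?thesis
    using sum_geometric_le[OF assms(1,2), of "(\<lambda>j. m - j) ` (J\<inter>{..m})"]
      sum_geometric_le[OF assms(1,2), of "(\<lambda>j. j - m) ` (J-{..m})"] assms by simp
qed

lemma dyadic_between:
  fixes y :: real assumes "1 \<le> y"
  obtains m :: nat where "2 ^ m \<le> y" "y < 2 * 2 ^ m"
proof -
  define m where "m = nat \<lfloor>log 2 y\<rfloor>"
  have 0: "0 \<le> log 2 y" using assms by simp
  have "real m \<le> log 2 y" "log 2 y < real m + 1"
    unfolding m_def using 0 by linarith+
  then have "2 powr real m \<le> y" "y < 2 powr (real m + 1)"
    using assms by (simp_all add: le_log_iff log_less_iff)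
  then show ?thesis using that[of m] by (simp add: powr_realpow powr_add mult.commute)
qed

text \<open>The terms grow geometrically until \<open>2 ^ j\<close> passes \<open>y\<close> and
  decay geometrically afterwards, so the sum has the size of the term at the crossover. These are
  the row sums of the Schur test in \<open>dk_hardy\<close>.\<close>

lemma sum_min_dyadic_le:
  fixes \<gamma> :: real
  assumes "0 < \<gamma>" "\<gamma> < 1"
  obtains K where "K > 0"
    "\<And>J y. finite J \<Longrightarrow> 1 \<le> y \<Longrightarrow>
       (\<Sum>j\<in>J. min (2 ^ j) y * 2 powr (- \<gamma> * real j)) \<le> K * y powr (1 - \<gamma>)"
proof -
  \<comment> \<open>The slower of the two decays, with exponent \<open>1 - \<gamma>\<close> below
    the crossover and \<open>\<gamma>\<close> above it.\<close>
  define r where "r = 2 powr (- min \<gamma> (1 - \<gamma>))"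
  have r: "0 < r" "r < 1" using assms by (auto simp: r_def powr_less_one)
  have "(\<Sum>j\<in>J. min (2 ^ j) y * 2 powr (- \<gamma> * real j)) \<le> (4 / (1 - r)) * y powr (1 - \<gamma>)"
    if J: "finite J" and y: "1 \<le> y" for J :: "nat set" and y :: real
  proof -
    obtain m where m: "2 ^ m \<le> y" "y < 2 * 2 ^ m" using dyadic_between[OF y] by blast
    have tm: "min (2 ^ j) y * 2 powr (- \<gamma> * real j) \<le> 2 * 2 powr (real m * (1 - \<gamma>)) * r powr \<bar>real j - real m\<bar>" for j
    proof (cases "j \<le> m")
      case True
      have "min (2 ^ j) y * 2 powr (- \<gamma> * real j) \<le> 2 powr real j * 2 powr (- \<gamma> * real j)"
        by (intro mult_right_mono) (auto simp: powr_realpow)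
      also have "\<dots> = 2 powr (real m * (1 - \<gamma>)) * 2 powr (- (1 - \<gamma>) * (real m - real j))"
        by (simp add: powr_add[symmetric] algebra_simps)
      also have "\<dots> \<le> 2 powr (real m * (1 - \<gamma>)) * 2 powr (- min \<gamma> (1 - \<gamma>) * (real m - real j))"
        using True mult_right_mono[of "min \<gamma> (1 - \<gamma>)" "1 - \<gamma>" "real m - real j"]
        by (intro mult_left_mono powr_mono) (auto simp: algebra_simps)
      also have "2 powr (- min \<gamma> (1 - \<gamma>) * (real m - real j)) = r powr \<bar>real j - real m\<bar>"
        using True by (simp add: r_def powr_powr)
      also have "2 powr (real m * (1 - \<gamma>)) * r powr \<bar>real j - real m\<bar>
          \<le> 2 * 2 powr (real m * (1 - \<gamma>)) * r powr \<bar>real j - real m\<bar>"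
        by (intro mult_right_mono) auto
      finally show ?thesis .
    next
      case False
      have "min (2 ^ j) y * 2 powr (- \<gamma> * real j) \<le> 2 * 2 powr real m * 2 powr (- \<gamma> * real j)"
        using m by (intro mult_right_mono) (auto simp: powr_realpow)
      also have "\<dots> = 2 * 2 powr (real m * (1 - \<gamma>)) * 2 powr (- \<gamma> * (real j - real m))"
        by (simp add: powr_add[symmetric] algebra_simps)
      also have "\<dots> \<le> 2 * 2 powr (real m * (1 - \<gamma>)) * 2 powr (- min \<gamma> (1 - \<gamma>) * (real j - real m))"
        using False mult_right_mono[of "min \<gamma> (1 - \<gamma>)" \<gamma> "real j - real m"]
        by (intro mult_left_mono powr_mono) (auto simp: algebra_simps)
      also have "2 powr (- min \<gamma> (1 - \<gamma>) * (real j - real m)) = r powr \<bar>real j - real m\<bar>"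
        using False by (simp add: r_def powr_powr)
      finally show ?thesis .
    qed
    have "(\<Sum>j\<in>J. min (2 ^ j) y * 2 powr (- \<gamma> * real j)) \<le> (\<Sum>j\<in>J. 2 * 2 powr (real m * (1 - \<gamma>)) * r powr \<bar>real j - real m\<bar>)"
      by (intro sum_mono tm)
    also have "\<dots> = 2 * 2 powr (real m * (1 - \<gamma>)) * (\<Sum>j\<in>J. r powr \<bar>real j - real m\<bar>)"
      by (simp add: sum_distrib_left)
    also have "\<dots> \<le> 2 * 2 powr (real m * (1 - \<gamma>)) * (2 / (1 - r))"
      by (intro mult_left_mono sum_geometric_dist_le r J) auto
    also have "2 powr (real m * (1 - \<gamma>)) = (2 ^ m) powr (1 - \<gamma>)"
      by (simp add: powr_realpow[symmetric] powr_powr)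
    also have "2 * (2 ^ m) powr (1 - \<gamma>) * (2 / (1 - r)) \<le> 2 * y powr (1 - \<gamma>) * (2 / (1 - r))"
      using m r assms by (intro mult_right_mono mult_left_mono powr_mono2) auto
    finally show ?thesis by (simp add: mult_ac)
  qed
  then show ?thesis using that[of "4 / (1 - r)"] r by auto
qed

text \<open>The closed half-line matters: the values averaged in \<open>weighted_sum_powr_le\<close>
  may be 0.\<close>

lemma convex_on_powr: assumes "1 \<le> q" shows "convex_on {0..} (\<lambda>x::real. x powr q)"
proof (rule convex_onI)
  fix t x y :: real
  assume t: "0 < t" "t < 1" and xy: "x \<in> {0..}" "y \<in> {0..}"
  have le: "s powr q \<le> s" if "0 < s" "s < 1" for s :: real
    using powr_mono'[of 1 q s] that assms by simp
  consider "0 < x" "0 < y" | "x = 0" | "y = 0" using xy by force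
  then show "((1 - t) *\<^sub>R x + t *\<^sub>R y) powr q \<le> (1 - t) * x powr q + t * y powr q"
  proof cases
    case 1
    then show ?thesis using convex_onD[OF powr_convex[OF assms], of t x y] t by simp
  next
    case 2
    then show ?thesis using t xy le[of t] by (auto simp: powr_mult intro!: mult_right_mono)
  next
    case 3
    then show ?thesis using t xy le[of "1 - t"] by (auto simp: powr_mult intro!: mult_right_mono)
  qed
qed simp

text \<open>Jensen's inequality for the normalised weights \<open>w i / W\<close>. It stands in for
  Hoelder's inequality in the Schur test and for Minkowski's inequality in
  \<open>frac_diff_Lp\<close>.\<close>

lemma weighted_sum_powr_le:
  fixes w t :: "'i \<Rightarrow> real" and q :: real
  assumes "1 \<le> q" "finite I" "\<And>i. i \<in> I \<Longrightarrow> 0 \<le> w i" "\<And>i. i \<in> I \<Longrightarrow> 0 \<le> t i"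
  shows "(\<Sum>i\<in>I. w i * t i) powr q \<le> (\<Sum>i\<in>I. w i) powr (q - 1) * (\<Sum>i\<in>I. w i * t i powr q)"
proof (cases "(\<Sum>i\<in>I. w i) = 0")
  case True
  then have "w i = 0" if "i \<in> I" for i using that assms by (simp add: sum_nonneg_eq_0_iff)
  then show ?thesis using assms by simp
next
  case False
  define W where "W = (\<Sum>i\<in>I. w i)"
  have W: "W > 0" unfolding W_def using False assms by (metis less_eq_real_def sum_nonneg)
  have I: "I \<noteq> {}" using False by auto
  have "(\<Sum>i\<in>I. (w i / W) *\<^sub>R t i) powr q \<le> (\<Sum>i\<in>I. (w i / W) * t i powr q)"
    using assms I W
    by (intro convex_on_sum[OF _ _ convex_on_powr]) (auto simp: W_def sum_divide_distrib[symmetric])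
  moreover have "(\<Sum>i\<in>I. (w i / W) *\<^sub>R t i) = (\<Sum>i\<in>I. w i * t i) / W"
    by (simp add: sum_divide_distrib)
  moreover have "(\<Sum>i\<in>I. (w i / W) * t i powr q) = (\<Sum>i\<in>I. w i * t i powr q) / W"
    by (simp add: sum_divide_distrib)
  ultimately have "((\<Sum>i\<in>I. w i * t i) / W) powr q \<le> (\<Sum>i\<in>I. w i * t i powr q) / W" by simp
  moreover have "(\<Sum>i\<in>I. w i * t i) \<ge> 0" using assms by (intro sum_nonneg) auto
  ultimately have "(\<Sum>i\<in>I. w i * t i) powr q \<le> W powr q * ((\<Sum>i\<in>I. w i * t i powr q) / W)"
    using W by (simp add: powr_divide divide_le_eq mult.commute)
  also have "\<dots> = W powr (q - 1) * (\<Sum>i\<in>I. w i * t i powr q)"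
    using W by (simp add: powr_diff)
  finally show ?thesis by (simp add: W_def)
qed

lemma jordan_sin_ge:
  assumes "0 \<le> t" "t \<le> pi / 2"
  shows "2 * t / pi \<le> sin t"
proof -
  have "convex_on {0..pi} (\<lambda>x. - sin x)"
    by (rule f''_ge0_imp_convex[where f' = "\<lambda>x. - cos x" and f'' = sin])
       (auto intro!: derivative_eq_intros sin_ge_zero)
  from convex_onD[OF this, of "2 * t / pi" 0 "pi / 2"] show ?thesis
    using assms by (simp add: field_simps)
qed

text \<open>\<open>sin (x / 2)\<close> vanishes at both ends of the period; the nearer end decides
  which alternative is proved.\<close>

lemma inverse_sin_half_le:
  assumes "0 < x" "x < 2 * pi"
  shows "1 / \<bar>sin (x / 2)\<bar> \<le> pi / x \<or> 1 / \<bar>sin (x / 2)\<bar> \<le> pi / (2 * pi - x)"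
proof (cases "x \<le> pi")
  case True
  then have "x / pi \<le> sin (x / 2)" using jordan_sin_ge[of "x/2"] assms by simp
  moreover have "0 < sin (x / 2)" using assms by (simp add: sin_gt_zero)
  ultimately have "1 / sin (x / 2) \<le> 1 / (x / pi)" using assms by (intro divide_left_mono) auto
  then show ?thesis using \<open>0 < sin (x / 2)\<close> by simp
next
  case False
  have s: "sin ((2 * pi - x) / 2) = sin (x / 2)" by (simp add: diff_divide_distrib)
  have "u / pi \<le> sin (u / 2)" if "0 \<le> u" "u \<le> pi" for u
    using jordan_sin_ge[of "u/2"] that by simp
  from this[of "2 * pi - x"] have "(2 * pi - x) / pi \<le> sin (x / 2)"
    using False assms unfolding s by simp
  moreover have "0 < sin (x / 2)" using assms by (simp add: sin_gt_zero)
  ultimately have "1 / sin (x / 2) \<le> 1 / ((2 * pi - x) / pi)" using assms by (intro divide_left_mono) auto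
  then show ?thesis using \<open>0 < sin (x / 2)\<close> by simp
qed

lemma inverse_sin_half_ge_1:
  assumes "sin (x / 2) \<noteq> 0"
  shows "1 \<le> 1 / \<bar>sin (x / 2 :: real)\<bar>"
  using assms by (simp add: abs_le_iff)

text \<open>Model for \<open>dk j x * (1 / \<bar>sin (x / 2)\<bar>) powr \<theta>\<close> near 0,
  with \<open>a = 1 / 2 ^ j\<close>: to the left of \<open>a\<close> the minimum in
  \<open>dk\<close> is of size \<open>1 / a\<close>, to the right of size \<open>1 / x\<close>.
  Integrability at 0 needs \<open>\<theta> < 1\<close>, at infinity
  \<open>0 < \<theta>\<close>.\<close>

lemma powr_two_regimes_integral:
  fixes \<theta> a :: real
  assumes "0 < \<theta>" "\<theta> < 1" "0 < a"
  defines "g \<equiv> \<lambda>x. indicat_real {0..a} x * (x powr (- \<theta>) / a) + indicat_real {a..} x * x powr (- 1 - \<theta>)"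
  shows "integrable lebesgue g" "(LINT x|lebesgue. g x) = a powr (- \<theta>) * (1 / (1 - \<theta>) + 1 / \<theta>)"
proof -
  have 1: "((\<lambda>x. x powr (- \<theta>)) has_integral (a powr (1 - \<theta>) / (1 - \<theta>))) {0..a}"
    using has_integral_powr_from_0[of "- \<theta>" a] assms by simp
  have 2: "((\<lambda>x. x powr (- 1 - \<theta>)) has_integral (a powr (- \<theta>) / \<theta>)) {a..}"
    using has_integral_powr_to_inf[of "- 1 - \<theta>" a] assms by simp
  have i1: "set_integrable lebesgue {0..a} (\<lambda>x. x powr (- \<theta>))"
    using 1 by (intro nonnegative_absolutely_integrable_1) (auto simp: integrable_on_def)
  have i2: "set_integrable lebesgue {a..} (\<lambda>x. x powr (- 1 - \<theta>))"
    using 2 by (intro nonnegative_absolutely_integrable_1) (auto simp: integrable_on_def)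
  have v1: "(LINT x:{0..a}|lebesgue. x powr (- \<theta>)) = a powr (1 - \<theta>) / (1 - \<theta>)"
    using set_lebesgue_integral_eq_integral(2)[OF i1] 1 by (simp add: integral_unique)
  have v2: "(LINT x:{a..}|lebesgue. x powr (- 1 - \<theta>)) = a powr (- \<theta>) / \<theta>"
    using set_lebesgue_integral_eq_integral(2)[OF i2] 2 by (simp add: integral_unique)
  have g: "g = (\<lambda>x. (indicat_real {0..a} x * x powr (- \<theta>)) / a + indicat_real {a..} x * x powr (- 1 - \<theta>))"
    by (simp add: g_def)
  show "integrable lebesgue g"
    using i1 i2 unfolding g by (simp add: set_integrable_def)
  have "(LINT x|lebesgue. g x) = (LINT x|lebesgue. (indicat_real {0..a} x * x powr (- \<theta>)) / a)
      + (LINT x|lebesgue. indicat_real {a..} x * x powr (- 1 - \<theta>))"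
    using i1 i2 unfolding g by (intro Bochner_Integration.integral_add) (auto simp: set_integrable_def)
  also have "\<dots> = (a powr (1 - \<theta>) / (1 - \<theta>)) / a + a powr (- \<theta>) / \<theta>"
    using v1 v2 by (simp add: set_lebesgue_integral_def)
  also have "a powr (1 - \<theta>) = a * a powr (- \<theta>)" using assms by (simp add: powr_diff powr_minus field_simps)
  also have "a * a powr (- \<theta>) / (1 - \<theta>) / a + a powr (- \<theta>) / \<theta> = a powr (- \<theta>) * (1 / (1 - \<theta>) + 1 / \<theta>)"
    using assms(3) by (simp add: distrib_left)
  finally show "(LINT x|lebesgue. g x) = a powr (- \<theta>) * (1 / (1 - \<theta>) + 1 / \<theta>)" .
qed

lemma borel_measurable_circM: "f \<in> borel_measurable borel \<Longrightarrow> f \<in> borel_measurable circM"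
  by (intro measurable_restrict_space1) (simp add: measurable_completion)

text \<open>The column sums of the Schur test. The integrand is dominated by the two-regime model at
  the left end of the period plus its reflection at the right end.\<close>

lemma dk_powr_integral:
  fixes \<theta> :: real
  assumes "0 < \<theta>" "\<theta> < 1"
  shows "integrable circM (\<lambda>x. dk j x * (1 / \<bar>sin (x / 2)\<bar>) powr \<theta>)"
    and "(LINT x|circM. dk j x * (1 / \<bar>sin (x / 2)\<bar>) powr \<theta>)
           \<le> 2 * pi^2 * (1 / (1 - \<theta>) + 1 / \<theta>) * 2 powr (real j * \<theta>)"
proof -
  let ?y = "\<lambda>x::real. 1 / \<bar>sin (x / 2)\<bar>"
  define a :: real where "a = 1 / 2 ^ j"
  have a: "a > 0" by (simp add: a_def)
  define g where "g = (\<lambda>x. indicat_real {0..a} x * (x powr (- \<theta>) / a) + indicat_real {a..} x * x powr (- 1 - \<theta>))"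
  have g0: "0 \<le> g x" for x using a by (simp add: g_def)
  note gi = powr_two_regimes_integral[OF assms a, folded g_def]
  have gi': "integrable lebesgue (\<lambda>x. g (2 * pi - x))"
    using lebesgue_integrable_real_affine_iff[of "-1" g "2 * pi"] gi(1) by simp
  have gv': "(LINT x|lebesgue. g (2 * pi - x)) = (LINT x|lebesgue. g x)"
    using lebesgue_integral_real_affine[of "-1" g "2 * pi"] by simp
  have aux: "min (2 ^ j) y * y powr \<theta> \<le> pi^2 * g u" if u: "0 < u" "y \<le> pi / u" "1 \<le> y" for u y :: real
  proof -
    have p1: "pi powr \<theta> \<le> pi" using powr_mono[of \<theta> 1 pi] assms pi_gt3 by simp
    have "y powr \<theta> \<le> (pi / u) powr \<theta>" using u assms by (intro powr_mono2) auto
    also have "\<dots> = pi powr \<theta> * u powr (- \<theta>)" using u by (simp add: powr_divide powr_minus field_simps)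
    also have "\<dots> \<le> pi * u powr (- \<theta>)" using p1 by (intro mult_right_mono) auto
    finally have y: "y powr \<theta> \<le> pi * u powr (- \<theta>)" .
    show ?thesis
    proof (cases "u \<le> a")
      case True
      have "min (2 ^ j) y * y powr \<theta> \<le> 2 ^ j * (pi * u powr (- \<theta>))"
        using y u by (intro mult_mono) auto
      also have "\<dots> = pi * (u powr (- \<theta>) / a)" by (simp add: a_def)
      also have "\<dots> \<le> pi^2 * (u powr (- \<theta>) / a)"
        using pi_gt3 a by (intro mult_right_mono) (auto simp: power2_eq_square)
      also have "\<dots> \<le> pi^2 * g u" using u True by (intro mult_left_mono) (auto simp: g_def)
      finally show ?thesis .
    next
      case False
      have "min (2 ^ j) y * y powr \<theta> \<le> (pi / u) * (pi * u powr (- \<theta>))"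
        using y u by (intro mult_mono) auto
      also have "\<dots> = pi^2 * u powr (- 1 - \<theta>)"
        using u by (simp add: powr_diff powr_minus power2_eq_square field_simps)
      also have "\<dots> \<le> pi^2 * g u" using u False by (intro mult_left_mono) (auto simp: g_def)
      finally show ?thesis .
    qed
  qed
  have bnd: "AE x in circM. dk j x * ?y x powr \<theta> \<le> pi^2 * (g x + g (2 * pi - x))"
    using AE_circM_interior
  proof eventually_elim
    case (elim x)
    then have s: "sin (x / 2) \<noteq> 0" using sin_gt_zero[of "x/2"] by auto
    have d: "dk j x = min (2 ^ j) (?y x)" using s by (simp add: dk_def)
    have "dk j x * ?y x powr \<theta> \<le> pi^2 * g x \<or> dk j x * ?y x powr \<theta> \<le> pi^2 * g (2 * pi - x)"
      unfolding d using inverse_sin_half_le[of x] elim aux[of x "?y x"] aux[of "2 * pi - x" "?y x"]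
        inverse_sin_half_ge_1[OF s] by auto
    then show ?case using g0[of x] g0[of "2*pi-x"] by (auto simp: algebra_simps intro: order_trans)
  qed
  have ci: "integrable circM (\<lambda>x. pi^2 * (g x + g (2 * pi - x)))"
    unfolding set_integrable_circM[symmetric] set_integrable_def
    using gi(1) gi' by (intro integrable_mult_indicator) auto
  show i: "integrable circM (\<lambda>x. dk j x * ?y x powr \<theta>)"
  proof (rule Bochner_Integration.integrable_bound[OF ci])
    have "(\<lambda>x. dk j x * ?y x powr \<theta>) \<in> borel_measurable borel" by measurable
    then show "(\<lambda>x. dk j x * ?y x powr \<theta>) \<in> borel_measurable circM"
      by (rule borel_measurable_circM)
    show "AE x in circM. norm (dk j x * ?y x powr \<theta>) \<le> norm (pi^2 * (g x + g (2 * pi - x)))"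
      using bnd by eventually_elim (simp add: abs_mult dk_nonneg g0)
  qed
  have "(LINT x|circM. dk j x * ?y x powr \<theta>) \<le> (LINT x|circM. pi^2 * (g x + g (2 * pi - x)))"
    by (rule integral_mono_AE[OF i ci bnd])
  also have "\<dots> = (LINT x:{0..2*pi}|lebesgue. pi^2 * (g x + g (2 * pi - x)))" by (simp add: set_integral_circM)
  also have "\<dots> \<le> (LINT x|lebesgue. pi^2 * (g x + g (2 * pi - x)))"
    unfolding set_lebesgue_integral_def using gi(1) gi' g0
    by (intro integral_mono integrable_mult_indicator) (auto simp: indicator_def)
  also have "\<dots> = pi^2 * (2 * (a powr (- \<theta>) * (1 / (1 - \<theta>) + 1 / \<theta>)))"
    using gi gi' gv' by simp
  also have "a powr (- \<theta>) = 2 powr (real j * \<theta>)"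
    by (simp add: a_def powr_minus powr_divide powr_powr powr_realpow[symmetric])
  finally show "(LINT x|circM. dk j x * ?y x powr \<theta>) \<le> 2 * pi^2 * (1 / (1 - \<theta>) + 1 / \<theta>) * 2 powr (real j * \<theta>)"
    by (simp add: algebra_simps)
qed

lemma sum_dk_powr_integrable:
  assumes "finite J" "\<And>j. j \<in> J \<Longrightarrow> 0 \<le> D j" "0 \<le> q"
  shows "integrable circM (\<lambda>x. (\<Sum>j\<in>J. D j * dk j x) powr q)"
proof (rule integrable_circM_bounded)
  show "(\<lambda>x. (\<Sum>j\<in>J. D j * dk j x) powr q) \<in> borel_measurable circM"
    by (intro borel_measurable_circM) measurable
  show "norm ((\<Sum>j\<in>J. D j * dk j x) powr q) \<le> (\<Sum>j\<in>J. D j * 2 ^ j) powr q" for x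
    using assms by (auto intro!: powr_mono2 sum_nonneg sum_mono mult_left_mono simp: dk_nonneg dk_le)
qed

text \<open>A Schur test with weights \<open>2 powr (- (1 - 1/q) * j)\<close>.\<close>
lemma dk_hardy:
  fixes q :: real
  assumes "1 < q"
  obtains K where "K > 0"
    "\<And>J D. finite J \<Longrightarrow> (\<And>j. j \<in> J \<Longrightarrow> 0 \<le> D j) \<Longrightarrow>
       (LINT x|circM. (\<Sum>j\<in>J. D j * dk j x) powr q) \<le> K * (\<Sum>j\<in>J. 2 powr (real j * (q - 1)) * D j powr q)"
proof -
  let ?y = "\<lambda>x::real. 1 / \<bar>sin (x / 2)\<bar>"
  define \<gamma> where "\<gamma> = 1 - 1 / q"
  have \<gamma>: "0 < \<gamma>" "\<gamma> < 1" using assms by (auto simp: \<gamma>_def)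
  obtain K1 where K1: "K1 > 0" "\<And>J y. finite J \<Longrightarrow> 1 \<le> y \<Longrightarrow>
       (\<Sum>j\<in>J. min (2 ^ j) y * 2 powr (- \<gamma> * real j)) \<le> K1 * y powr (1 - \<gamma>)"
    using sum_min_dyadic_le[OF \<gamma>] by blast
  \<comment> \<open>The power of \<open>1 / \<bar>sin (x / 2)\<bar>\<close> left over by the row
    sums. For this \<open>\<gamma>\<close> it equals \<open>1 - 1 / q\<close>, so
    \<open>dk_powr_integral\<close> applies, and the powers of \<open>2 ^ j\<close> recombine to
    \<open>q - 1\<close> by \<open>exps\<close>.\<close>
  define \<theta> where "\<theta> = (1 - \<gamma>) * (q - 1)"
  have \<theta>: "0 < \<theta>" "\<theta> < 1" using assms by (auto simp: \<theta>_def \<gamma>_def field_simps)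
  define K2 where "K2 = 2 * pi^2 * (1 / (1 - \<theta>) + 1 / \<theta>)"
  have K2: "K2 > 0" using \<theta> by (auto simp: K2_def intro!: mult_pos_pos add_pos_pos)
  have exps: "\<theta> + \<gamma> * (q - 1) = q - 1" using assms by (simp add: \<theta>_def \<gamma>_def field_simps)
  have "(LINT x|circM. (\<Sum>j\<in>J. D j * dk j x) powr q) \<le> K1 powr (q - 1) * K2 * (\<Sum>j\<in>J. 2 powr (real j * (q - 1)) * D j powr q)"
    if J: "finite J" and D: "\<And>j. j \<in> J \<Longrightarrow> 0 \<le> D j" for J and D :: "nat \<Rightarrow> real"
  proof -
    define c where "c j = 2 powr (\<gamma> * real j * (q - 1)) * D j powr q" for j
    have bnd: "AE x in circM. (\<Sum>j\<in>J. D j * dk j x) powr q \<le> K1 powr (q - 1) * (\<Sum>j\<in>J. c j * (dk j x * ?y x powr \<theta>))"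
      using AE_circM_interior
    proof eventually_elim
      case (elim x)
      then have s: "sin (x / 2) \<noteq> 0" using sin_gt_zero[of "x/2"] by auto
      have d: "dk j x = min (2 ^ j) (?y x)" for j using s by (simp add: dk_def)
      have y1: "1 \<le> ?y x" by (rule inverse_sin_half_ge_1[OF s])
      have eq: "(\<Sum>j\<in>J. D j * dk j x) = (\<Sum>j\<in>J. (dk j x * 2 powr (- \<gamma> * real j)) * (D j * 2 powr (\<gamma> * real j)))"
        by (simp add: powr_minus field_simps)
      have "(\<Sum>j\<in>J. D j * dk j x) powr q \<le> (\<Sum>j\<in>J. dk j x * 2 powr (- \<gamma> * real j)) powr (q - 1) *
         (\<Sum>j\<in>J. dk j x * 2 powr (- \<gamma> * real j) * (D j * 2 powr (\<gamma> * real j)) powr q)"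
        unfolding eq using assms J D by (intro weighted_sum_powr_le) (auto simp: dk_nonneg)
      also have "\<dots> \<le> (K1 * ?y x powr (1 - \<gamma>)) powr (q - 1) *
         (\<Sum>j\<in>J. dk j x * 2 powr (- \<gamma> * real j) * (D j * 2 powr (\<gamma> * real j)) powr q)"
        using assms K1(2)[OF J y1] unfolding d[symmetric]
        by (intro mult_right_mono powr_mono2) (auto intro!: sum_nonneg simp: dk_nonneg)
      also have "(K1 * ?y x powr (1 - \<gamma>)) powr (q - 1) = K1 powr (q - 1) * ?y x powr \<theta>"
        using K1(1) by (simp add: powr_mult powr_powr \<theta>_def)
      also have "(\<Sum>j\<in>J. dk j x * 2 powr (- \<gamma> * real j) * (D j * 2 powr (\<gamma> * real j)) powr q) = (\<Sum>j\<in>J. c j * dk j x)"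
      proof (rule sum.cong)
        fix j assume "j \<in> J"
        then have "(D j * 2 powr (\<gamma> * real j)) powr q = D j powr q * 2 powr (\<gamma> * real j * q)"
          using D by (simp add: powr_mult powr_powr)
        moreover have E: "2 powr (- \<gamma> * real j) * 2 powr (\<gamma> * real j * q) = 2 powr (\<gamma> * real j * (q - 1))"
          by (simp add: powr_add[symmetric] algebra_simps)
        ultimately show "dk j x * 2 powr (- \<gamma> * real j) * (D j * 2 powr (\<gamma> * real j)) powr q = c j * dk j x"
          unfolding c_def E[symmetric] by (simp only: mult_ac)
      qed simp
      finally show ?case by (simp add: sum_distrib_left sum_distrib_right mult_ac)
    qed
    have "(LINT x|circM. (\<Sum>j\<in>J. D j * dk j x) powr q)
        \<le> (LINT x|circM. K1 powr (q - 1) * (\<Sum>j\<in>J. c j * (dk j x * ?y x powr \<theta>)))"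
      using assms J D dk_powr_integral(1)[OF \<theta>]
      by (intro integral_mono_AE[OF _ _ bnd] sum_dk_powr_integrable integrable_mult_right Bochner_Integration.integrable_sum) auto
    also have "\<dots> = K1 powr (q - 1) * (\<Sum>j\<in>J. c j * (LINT x|circM. dk j x * ?y x powr \<theta>))"
      using dk_powr_integral(1)[OF \<theta>] by (simp add: Bochner_Integration.integral_sum)
    also have "\<dots> \<le> K1 powr (q - 1) * (\<Sum>j\<in>J. c j * (K2 * 2 powr (real j * \<theta>)))"
      using dk_powr_integral(2)[OF \<theta>] by (intro mult_left_mono sum_mono) (auto simp: K2_def c_def)
    also have "(\<Sum>j\<in>J. c j * (K2 * 2 powr (real j * \<theta>))) = K2 * (\<Sum>j\<in>J. 2 powr (real j * (q - 1)) * D j powr q)"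
    proof -
      have "\<gamma> * real j * (q - 1) + real j * \<theta> = real j * (\<theta> + \<gamma> * (q - 1))" for j
        by (simp add: algebra_simps)
      then have E: "2 powr (\<gamma> * real j * (q - 1)) * 2 powr (real j * \<theta>) = 2 powr (real j * (q - 1))" for j
        by (simp only: powr_add[symmetric] exps)
      have "c j * (K2 * 2 powr (real j * \<theta>)) = K2 * (2 powr (real j * (q - 1)) * D j powr q)" for j
        unfolding c_def E[symmetric] by (simp only: mult_ac)
      then show ?thesis by (simp only: sum_distrib_left)
    qed
    finally show ?thesis by (simp add: mult_ac)
  qed
  then show ?thesis using that[of "K1 powr (q - 1) * K2"] K1 K2 by simp
qed

section \<open>Trigonometric polynomials with general monotone coefficients\<close>

lemma GM_with_mono: "GM_with C d \<Longrightarrow> C \<le> C' \<Longrightarrow> GM_with C' d"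
  unfolding GM_with_def by (meson mult_right_mono norm_ge_zero order_trans)

text \<open>The bound \<open>2 * n + 1\<close> is the full reach of the GM condition at
  \<open>n\<close>, whose last summand is \<open>norm (d (2 * n) - d (2 * n + 1))\<close>. With
  \<open>n = 2 ^ j\<close> it covers the block up to and including \<open>2 ^ Suc j\<close>.\<close>

lemma GM_with_variation:
  assumes "GM_with C d" "1 \<le> n" "n \<le> s" "t \<le> 2 * n + 1"
  shows "(\<Sum>k=s..<t. norm (d k - d (Suc k))) \<le> C * norm (d n)"
proof -
  have "(\<Sum>k=s..<t. norm (d k - d (Suc k))) \<le> (\<Sum>k=n..2*n. norm (d k - d (Suc k)))"
    using assms by (intro sum_mono2) auto
  then show ?thesis using assms unfolding GM_with_def by fastforce
qed

lemma norm_le_variation: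
  fixes d :: "nat \<Rightarrow> 'a :: real_normed_vector"
  assumes "s \<le> t"
  shows "norm (d t) \<le> norm (d s) + (\<Sum>k=s..<t. norm (d k - d (Suc k)))"
    "norm (d s) \<le> norm (d t) + (\<Sum>k=s..<t. norm (d k - d (Suc k)))"
proof -
  have "(\<Sum>k=s..<t. d k - d (Suc k)) = d s - d t"
    using assms by (rule sum_Suc_diff'[of s t "\<lambda>k. - d k", simplified])
  then have "norm (d s - d t) \<le> (\<Sum>k=s..<t. norm (d k - d (Suc k)))"
    by (metis norm_sum)
  then show "norm (d t) \<le> norm (d s) + (\<Sum>k=s..<t. norm (d k - d (Suc k)))"
    "norm (d s) \<le> norm (d t) + (\<Sum>k=s..<t. norm (d k - d (Suc k)))"
    using norm_triangle_ineq2[of "d s" "d t"] norm_triangle_ineq2[of "d t" "d s"] by (auto simp: norm_minus_commute)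
qed

lemma GM_with_norm_le:
  assumes "GM_with C d" "1 \<le> n" "n \<le> k" "k \<le> 2 * n + 1"
  shows "norm (d k) \<le> (1 + C) * norm (d n)"
  using norm_le_variation(1)[of n k d] GM_with_variation[of C d n n k] assms by (simp add: algebra_simps)

text \<open>Two summations by parts: the inner one uses the variation of \<open>d\<close> on the
  block, the outer one the weight, whose variation together with \<open>\<rho> s\<close> telescopes
  to \<open>\<rho> t\<close> because \<open>\<rho>\<close> is increasing.\<close>

lemma GM_block_bound:
  fixes d :: "nat \<Rightarrow> complex" and \<rho> :: "nat \<Rightarrow> real"
  assumes "GM_with C d" "0 \<le> C" "2 ^ j \<le> s" "s \<le> t" "t < 2 ^ Suc j"
    and \<rho>: "\<And>k. s \<le> k \<Longrightarrow> k < t \<Longrightarrow> \<rho> k \<le> \<rho> (Suc k)" "0 \<le> \<rho> s"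
  shows "norm (\<Sum>k=s..t. of_real (\<rho> k) * (d k * of_real (cos (real k * x + \<xi>))))
           \<le> (1 + 2 * C) * (\<rho> t * norm (d (2 ^ j)) * dk j x)"
proof -
  have tail: "norm (\<Sum>k=r..t. d k * of_real (cos (real k * x + \<xi>))) \<le> dk j x * ((1 + 2 * C) * norm (d (2 ^ j)))"
    if r: "s \<le> r" "r \<le> t" for r
  proof -
    have "norm (\<Sum>k=r..t. d k * of_real (cos (real k * x + \<xi>)))
        \<le> dk j x * (norm (d r) + (\<Sum>k=r..<t. norm (d k - d (Suc k))))"
    proof (rule sum_by_parts_bound)
      fix i assume i: "r \<le> i" "i \<le> t"
      have "norm (\<Sum>k=i..t. complex_of_real (cos (real k * x + \<xi>))) = \<bar>\<Sum>k=i..t. cos (real k * x + \<xi>)\<bar>"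
        by (metis norm_of_real of_real_sum)
      also have "\<dots> \<le> dk j x" using assms i r by (intro cos_sum_bound) auto
      finally show "norm (\<Sum>k=i..t. complex_of_real (cos (real k * x + \<xi>))) \<le> dk j x" .
    qed (use r in auto)
    also have "\<dots> \<le> dk j x * ((1 + C) * norm (d (2 ^ j)) + C * norm (d (2 ^ j)))"
      using assms r by (intro mult_left_mono add_mono GM_with_norm_le GM_with_variation dk_nonneg) auto
    finally show ?thesis by (simp add: algebra_simps)
  qed
  have mono: "\<rho> s + (\<Sum>k=s..<t. \<rho> (Suc k) - \<rho> k) = \<rho> t"
    using sum_Suc_diff'[of s t \<rho>] assms by simp
  have "norm (\<Sum>k=s..t. complex_of_real (\<rho> k) * (d k * of_real (cos (real k * x + \<xi>))))
    \<le> dk j x * ((1 + 2 * C) * norm (d (2 ^ j))) *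
        (norm (complex_of_real (\<rho> s)) + (\<Sum>k=s..<t. norm (complex_of_real (\<rho> k) - of_real (\<rho> (Suc k)))))"
    using assms tail by (intro sum_by_parts_bound) auto
  also have "norm (complex_of_real (\<rho> s)) + (\<Sum>k=s..<t. norm (complex_of_real (\<rho> k) - of_real (\<rho> (Suc k))))
      = \<rho> s + (\<Sum>k=s..<t. \<rho> (Suc k) - \<rho> k)"
    using \<rho> by (intro arg_cong2[where f = "(+)"] sum.cong) (auto simp flip: of_real_diff)
  finally show ?thesis unfolding mono by (simp add: mult_ac)
qed

lemma floor_log_iff: "1 \<le> k \<Longrightarrow> floor_log k = j \<longleftrightarrow> 2 ^ j \<le> k \<and> k < 2 ^ Suc j"
  using floor_log_eqI[of k j] floor_log_power[of k] floor_log_exp2_le[of k] floor_log_exp2_gt[of k] by auto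

text \<open>Sorting by \<open>floor_log\<close> cuts the range into dyadic blocks, the outer ones
  possibly truncated, and \<open>GM_block_bound\<close> applies to each. \<open>R j\<close>
  dominates the weight on block \<open>j\<close> and frees the result from the truncation.\<close>

lemma GM_poly_bound:
  fixes d :: "nat \<Rightarrow> complex" and \<rho> R :: "nat \<Rightarrow> real"
  assumes "GM_with C d" "0 \<le> C" "2 ^ u \<le> N" "M < 2 ^ Suc v"
    and \<rho>: "\<And>k. N \<le> k \<Longrightarrow> k < M \<Longrightarrow> \<rho> k \<le> \<rho> (Suc k)" "\<And>k. 0 \<le> \<rho> k"
    and R: "\<And>j k. N \<le> k \<Longrightarrow> k \<le> M \<Longrightarrow> 2 ^ j \<le> k \<Longrightarrow> k < 2 ^ Suc j \<Longrightarrow> \<rho> k \<le> R j" "\<And>j. 0 \<le> R j"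
  shows "norm (\<Sum>k=N..M. of_real (\<rho> k) * (d k * of_real (cos (real k * x + \<xi>))))
           \<le> (1 + 2 * C) * (\<Sum>j=u..v. R j * norm (d (2 ^ j)) * dk j x)"
proof -
  let ?h = "\<lambda>k. complex_of_real (\<rho> k) * (d k * of_real (cos (real k * x + \<xi>)))"
  have N1: "1 \<le> N" using assms(3) by (metis one_le_numeral one_le_power order_trans)
  have fl: "{k \<in> {N..M}. floor_log k = j} = {max N (2 ^ j)..min M (2 ^ Suc j - 1)}" for j
  proof (rule set_eqI)
    fix k
    show "k \<in> {k \<in> {N..M}. floor_log k = j} \<longleftrightarrow> k \<in> {max N (2 ^ j)..min M (2 ^ Suc j - 1)}"
      using floor_log_iff[of k j] N1 by auto
  qed
  have eq: "(\<Sum>k=N..M. ?h k) = (\<Sum>j=u..v. \<Sum>k\<in>{k \<in> {N..M}. floor_log k = j}. ?h k)"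
  proof (rule sum.group[symmetric])
    show "floor_log ` {N..M} \<subseteq> {u..v}"
    proof safe
      fix k assume k: "k \<in> {N..M}"
      have "2 ^ floor_log k \<le> k" "k < 2 ^ Suc (floor_log k)" using N1 k floor_log_iff[of k "floor_log k"] by auto
      then have "(2::nat) ^ u < 2 ^ Suc (floor_log k)" "(2::nat) ^ floor_log k < 2 ^ Suc v" using assms k by auto
      then have "u < Suc (floor_log k)" "floor_log k < Suc v"
        by (simp_all only: power_strict_increasing_iff one_less_numeral_iff semiring_norm)
      then show "floor_log k \<in> {u..v}" by simp
    qed
  qed auto
  have "norm (\<Sum>k=N..M. ?h k) \<le> (\<Sum>j=u..v. (1 + 2 * C) * (R j * norm (d (2 ^ j)) * dk j x))"
    unfolding eq
  proof (rule sum_norm_le)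
    fix j
    show "norm (\<Sum>k\<in>{k \<in> {N..M}. floor_log k = j}. ?h k) \<le> (1 + 2 * C) * (R j * norm (d (2 ^ j)) * dk j x)"
    proof (cases "max N (2 ^ j) \<le> min M (2 ^ Suc j - 1)")
      case True
      let ?t = "min M (2 ^ Suc j - 1)"
      have "?t \<le> 2 ^ Suc j - 1" "0 < (2::nat) ^ Suc j" by simp_all
      then have "?t < 2 ^ Suc j" by linarith
      then have tt: "?t < 2 ^ Suc j" "?t \<le> M" "2 ^ j \<le> ?t" "N \<le> ?t" "max N (2 ^ j) \<le> ?t" "2 ^ j \<le> max N (2 ^ j)"
        using True by auto
      have "norm (\<Sum>k=max N (2 ^ j)..?t. ?h k) \<le> (1 + 2 * C) * (\<rho> ?t * norm (d (2 ^ j)) * dk j x)"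
        using assms(1,2) tt \<rho> by (intro GM_block_bound) auto
      also have "\<dots> \<le> (1 + 2 * C) * (R j * norm (d (2 ^ j)) * dk j x)"
        using assms(2) tt by (intro mult_left_mono mult_right_mono R dk_nonneg) auto
      finally show ?thesis unfolding fl .
    next
      case False
      then have e: "{max N (2 ^ j)..min M (2 ^ Suc j - 1)} = {}" by (simp only: atLeastatMost_empty_iff not_False_eq_True)
      show ?thesis unfolding fl e using assms(2) R(2) by (simp add: dk_nonneg)
    qed
  qed
  then show ?thesis by (simp add: sum_distrib_left)
qed

text \<open>One format for three polynomials: partial sums (weight 1, phase 0), Weyl derivatives
  (weight \<open>real k powr \<alpha>\<close>, phase \<open>\<alpha> * pi / 2\<close>) and, after a
  translation, fractional differences (weight
  \<open>(2 * sin (real k * \<bar>h\<bar> / 2)) powr \<alpha>\<close>, phase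
  \<open>sgn h * \<alpha> * pi / 2\<close>).\<close>

definition wpoly :: "(nat \<Rightarrow> complex) \<Rightarrow> (nat \<Rightarrow> complex) \<Rightarrow> (nat \<Rightarrow> real) \<Rightarrow> real \<Rightarrow> nat \<Rightarrow> nat \<Rightarrow> real \<Rightarrow> complex" where
  "wpoly a b \<rho> \<xi> N M x = (\<Sum>k=N..M. of_real (\<rho> k) *
      (a k * of_real (cos (real k * x + \<xi>)) + b k * of_real (sin (real k * x + \<xi>))))"

lemma wpoly_bound:
  assumes "GM_with C a" "GM_with C b" "0 \<le> C" "2 ^ u \<le> N" "M < 2 ^ Suc v"
    and \<rho>: "\<And>k. N \<le> k \<Longrightarrow> k < M \<Longrightarrow> \<rho> k \<le> \<rho> (Suc k)" "\<And>k. 0 \<le> \<rho> k"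
    and R: "\<And>j k. N \<le> k \<Longrightarrow> k \<le> M \<Longrightarrow> 2 ^ j \<le> k \<Longrightarrow> k < 2 ^ Suc j \<Longrightarrow> \<rho> k \<le> R j" "\<And>j. 0 \<le> R j"
  shows "norm (wpoly a b \<rho> \<xi> N M x)
           \<le> (\<Sum>j=u..v. ((1 + 2 * C) * (R j * (norm (a (2 ^ j)) + norm (b (2 ^ j))))) * dk j x)"
proof -
  have s: "sin (real k * x + \<xi>) = cos (real k * x + (\<xi> - pi / 2))" for k
    by (simp add: cos_diff sin_add cos_add sin_diff)
  have eq: "wpoly a b \<rho> \<xi> N M x = (\<Sum>k=N..M. of_real (\<rho> k) * (a k * of_real (cos (real k * x + \<xi>))))
      + (\<Sum>k=N..M. of_real (\<rho> k) * (b k * of_real (cos (real k * x + (\<xi> - pi / 2)))))"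
    unfolding wpoly_def s by (simp add: sum.distrib algebra_simps)
  have "norm (wpoly a b \<rho> \<xi> N M x) \<le> (1 + 2 * C) * (\<Sum>j=u..v. R j * norm (a (2 ^ j)) * dk j x)
      + (1 + 2 * C) * (\<Sum>j=u..v. R j * norm (b (2 ^ j)) * dk j x)"
    unfolding eq using assms
    by (intro order_trans[OF norm_triangle_ineq] add_mono GM_poly_bound) auto
  also have "\<dots> = (\<Sum>j=u..v. ((1 + 2 * C) * (R j * (norm (a (2 ^ j)) + norm (b (2 ^ j))))) * dk j x)"
    by (simp add: sum_distrib_left sum.distrib[symmetric] algebra_simps)
  finally show ?thesis .
qed

lemma add_powr_le:
  fixes s t p :: real
  assumes "0 \<le> s" "0 \<le> t" "0 \<le> p"
  shows "(s + t) powr p \<le> 2 powr p * (s powr p + t powr p)"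
proof -
  have "(s + t) powr p \<le> (2 * max s t) powr p" using assms by (intro powr_mono2) auto
  also have "\<dots> = 2 powr p * max s t powr p" using assms by (simp add: powr_mult)
  also have "\<dots> \<le> 2 powr p * (s powr p + t powr p)" by (intro mult_left_mono) (auto simp: max_def)
  finally show ?thesis .
qed

lemma wpoly_measurable [measurable]: "wpoly a b \<rho> \<xi> N M \<in> borel_measurable borel"
  unfolding wpoly_def by measurable

text \<open>The constant is produced before the polynomial is chosen, hence is uniform in degree,
  weight and phase. The bounds for the tail of \<open>f\<close>, for the Weyl derivative and for the
  difference of the partial sum are all instances.\<close>

lemma wpoly_Lp_bound:
  assumes "1 < p" "0 \<le> C"
  obtains K where "K > 0"
    "\<And>a b \<rho> R \<xi> u v N M. GM_with C a \<Longrightarrow> GM_with C b \<Longrightarrow> 2 ^ u \<le> N \<Longrightarrow> M < 2 ^ Suc v \<Longrightarrow>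
     (\<And>k. N \<le> k \<Longrightarrow> k < M \<Longrightarrow> \<rho> k \<le> \<rho> (Suc k)) \<Longrightarrow> (\<And>k. 0 \<le> \<rho> k) \<Longrightarrow>
     (\<And>j k. N \<le> k \<Longrightarrow> k \<le> M \<Longrightarrow> 2 ^ j \<le> k \<Longrightarrow> k < 2 ^ Suc j \<Longrightarrow> \<rho> k \<le> R j) \<Longrightarrow> (\<And>j. 0 \<le> R j) \<Longrightarrow>
     (LINT x|circM. norm (wpoly a b \<rho> \<xi> N M x) powr p)
       \<le> K * (\<Sum>j=u..v. 2 powr (real j * (p - 1)) * R j powr p * (norm (a (2 ^ j)) powr p + norm (b (2 ^ j)) powr p))"
proof -
  obtain K1 where K1: "K1 > 0"
    "\<And>J D. finite J \<Longrightarrow> (\<And>j. j \<in> J \<Longrightarrow> 0 \<le> D j) \<Longrightarrow>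
       (LINT x|circM. (\<Sum>j\<in>J. D j * dk j x) powr p) \<le> K1 * (\<Sum>j\<in>J. 2 powr (real j * (p - 1)) * D j powr p)"
    using dk_hardy[OF assms(1)] by blast
  define K where "K = K1 * ((1 + 2 * C) powr p * 2 powr p)"
  have K: "K > 0" using K1 assms by (simp add: K_def)
  show ?thesis
  proof (rule that[OF K])
    fix a b :: "nat \<Rightarrow> complex" and \<rho> R :: "nat \<Rightarrow> real" and \<xi> :: real and u v N M :: nat
    assume h: "GM_with C a" "GM_with C b" "2 ^ u \<le> N" "M < 2 ^ Suc v"
     "\<And>k. N \<le> k \<Longrightarrow> k < M \<Longrightarrow> \<rho> k \<le> \<rho> (Suc k)" "\<And>k. 0 \<le> \<rho> k"
     "\<And>j k. N \<le> k \<Longrightarrow> k \<le> M \<Longrightarrow> 2 ^ j \<le> k \<Longrightarrow> k < 2 ^ Suc j \<Longrightarrow> \<rho> k \<le> R j" "\<And>j. 0 \<le> R j"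
    define D where "D j = (1 + 2 * C) * (R j * (norm (a (2 ^ j)) + norm (b (2 ^ j))))" for j
    have D0: "0 \<le> D j" for j using assms h by (simp add: D_def)
    have bnd: "norm (wpoly a b \<rho> \<xi> N M x) \<le> (\<Sum>j=u..v. D j * dk j x)" for x
      unfolding D_def using assms h by (intro wpoly_bound) auto
    have I: "integrable circM (\<lambda>x. (\<Sum>j=u..v. D j * dk j x) powr p)"
      using assms D0 by (intro sum_dk_powr_integrable) auto
    have "(LINT x|circM. norm (wpoly a b \<rho> \<xi> N M x) powr p) \<le> (LINT x|circM. (\<Sum>j=u..v. D j * dk j x) powr p)"
    proof (rule integral_mono)
      show "integrable circM (\<lambda>x. norm (wpoly a b \<rho> \<xi> N M x) powr p)"
        using assms bnd
        by (intro Bochner_Integration.integrable_bound[OF I] borel_measurable_circM)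
           (measurable, auto intro!: powr_mono2)
    qed (use I assms bnd in \<open>auto intro!: powr_mono2\<close>)
    also have "\<dots> \<le> K1 * (\<Sum>j=u..v. 2 powr (real j * (p - 1)) * D j powr p)"
      using D0 by (intro K1(2)) auto
    also have "\<dots> \<le> K1 * (\<Sum>j=u..v. 2 powr (real j * (p - 1)) * ((1 + 2 * C) powr p * (R j powr p *
        (2 powr p * (norm (a (2 ^ j)) powr p + norm (b (2 ^ j)) powr p)))))"
      unfolding D_def using assms h K1(1)
      by (intro mult_left_mono sum_mono) (auto simp: powr_mult intro!: mult_left_mono add_powr_le)
    also have "\<dots> = K * (\<Sum>j=u..v. 2 powr (real j * (p - 1)) * R j powr p * (norm (a (2 ^ j)) powr p + norm (b (2 ^ j)) powr p))"
      by (simp add: K_def sum_distrib_left mult_ac)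
    finally show "(LINT x|circM. norm (wpoly a b \<rho> \<xi> N M x) powr p)
       \<le> K * (\<Sum>j=u..v. 2 powr (real j * (p - 1)) * R j powr p * (norm (a (2 ^ j)) powr p + norm (b (2 ^ j)) powr p))" .
  qed
qed

section \<open>Uniqueness of Fourier coefficients\<close>

lemma integrable_circM_mult_bounded:
  fixes g h :: "real \<Rightarrow> complex"
  assumes "integrable circM g" "h \<in> borel_measurable circM" "\<And>x. norm (h x) \<le> B"
  shows "integrable circM (\<lambda>x. g x * h x)"
proof (rule Bochner_Integration.integrable_bound)
  show "integrable circM (\<lambda>x. B * norm (g x))" using assms by simp
  show "(\<lambda>x. g x * h x) \<in> borel_measurable circM" using assms by measurable
  have "norm (g x * h x) \<le> norm (B * norm (g x))" for x
  proof -
    have "norm (g x * h x) \<le> norm (g x) * B" using assms by (auto simp: norm_mult intro: mult_left_mono)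
    then show ?thesis by (simp add: mult.commute)
  qed
  then show "AE x in circM. norm (g x * h x) \<le> norm (B * norm (g x))" by simp
qed

definition zero_coeffs :: "(real \<Rightarrow> complex) \<Rightarrow> bool" where
  "zero_coeffs g \<longleftrightarrow> integrable circM g \<and>
     (\<forall>k::nat. (LINT x|circM. g x * of_real (cos (real k * x))) = 0 \<and> (LINT x|circM. g x * of_real (sin (real k * x))) = 0)"

lemma cos_measurable_circM: "(\<lambda>x. complex_of_real (cos (c * x + \<xi>))) \<in> borel_measurable circM"
  by (intro borel_measurable_circM) measurable

lemma integrable_circM_cos:
  "integrable circM g \<Longrightarrow> integrable circM (\<lambda>x. g x * complex_of_real (cos (c * x + \<xi>)))"
  by (rule integrable_circM_mult_bounded[where B = 1]) (auto intro: cos_measurable_circM)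

text \<open>With arbitrary phases the condition is easily seen to be stable under multiplication by
  \<open>cos (x - c)\<close>, and thus by polynomials in it.\<close>

lemma zero_coeffs_iff:
  "zero_coeffs g \<longleftrightarrow> integrable circM g \<and> (\<forall>(k::nat) \<xi>. (LINT x|circM. g x * of_real (cos (real k * x + \<xi>))) = 0)"
proof safe
  assume z: "zero_coeffs g"
  then show i: "integrable circM g" by (simp add: zero_coeffs_def)
  fix k \<xi>
  have i1: "integrable circM (\<lambda>x. g x * of_real (cos (real k * x)))"
    using integrable_circM_cos[OF i, of k 0] by simp
  have i2: "integrable circM (\<lambda>x. g x * of_real (sin (real k * x)))"
    using integrable_circM_cos[OF i, of k "- pi/2"] by (simp add: cos_diff)
  have "(LINT x|circM. g x * of_real (cos (real k * x + \<xi>)))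
      = (LINT x|circM. of_real (cos \<xi>) * (g x * of_real (cos (real k * x))) - of_real (sin \<xi>) * (g x * of_real (sin (real k * x))))"
    by (intro Bochner_Integration.integral_cong) (auto simp: cos_add algebra_simps)
  also have "\<dots> = 0" using z i1 i2 by (simp add: zero_coeffs_def)
  finally show "(LINT x|circM. g x * of_real (cos (real k * x + \<xi>))) = 0" .
next
  assume h: "integrable circM g" "\<forall>(k::nat) \<xi>. (LINT x|circM. g x * of_real (cos (real k * x + \<xi>))) = 0"
  have "(LINT x|circM. g x * of_real (cos (real k * x))) = 0" for k using h(2)[rule_format, of k 0] by simp
  moreover have "(LINT x|circM. g x * of_real (sin (real k * x))) = 0" for k
    using h(2)[rule_format, of k "- pi/2"] by (simp add: cos_diff)
  ultimately show "zero_coeffs g" using h by (simp add: zero_coeffs_def)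
qed

lemma zero_coeffs_cmult: "zero_coeffs g \<Longrightarrow> zero_coeffs (\<lambda>x. g x * c)"
proof -
  assume z: "zero_coeffs g"
  have "(LINT x|circM. g x * c * of_real (cos (real k * x + \<xi>))) = (LINT x|circM. c * (g x * of_real (cos (real k * x + \<xi>))))" for k \<xi>
    by (simp add: mult_ac)
  then show ?thesis using z by (simp add: zero_coeffs_iff)
qed

lemma zero_coeffs_add: "zero_coeffs g \<Longrightarrow> zero_coeffs h \<Longrightarrow> zero_coeffs (\<lambda>x. g x + h x)"
  by (auto simp: zero_coeffs_iff distrib_right integrable_circM_cos)

lemma zero_coeffs_cos:
  assumes "zero_coeffs g" shows "zero_coeffs (\<lambda>x. g x * of_real (cos (x - c)))"
proof -
  have i: "integrable circM g" using assms by (simp add: zero_coeffs_iff)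
  have "(LINT x|circM. g x * of_real (cos (x - c)) * of_real (cos (real k * x + \<xi>))) = 0" for k \<xi>
  proof -
    have p: "of_real (cos (x - c)) * of_real (cos (real k * x + \<xi>)) =
        (of_real (cos (real (Suc k) * x + (\<xi> - c))) + complex_of_real (cos (real k * x + \<xi> - (x - c)))) / 2" for x
      unfolding of_real_mult[symmetric] cos_times_cos by (simp add: algebra_simps cos_diff cos_add)
    \<comment> \<open>The product formula gives the frequency \<open>k - 1\<close>, which is -1 for
      \<open>k = 0\<close>; evenness of the cosine turns it into 1.\<close>
    have q: "\<exists>m::nat. \<exists>\<zeta>. \<forall>x. cos (real k * x + \<xi> - (x - c)) = cos (real m * x + \<zeta>)"
    proof (cases k)
      case 0
      have "cos (\<xi> - (x - c)) = cos (real 1 * x + (- \<xi> - c))" for x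
        using cos_minus[of "\<xi> - (x - c)"] by (simp add: algebra_simps)
      then show ?thesis using 0 by (intro exI[of _ 1] exI[of _ "- \<xi> - c"]) auto
    next
      case (Suc m)
      then show ?thesis by (intro exI[of _ m] exI[of _ "\<xi> + c"]) (auto simp: algebra_simps)
    qed
    then obtain m :: nat and \<zeta> where m: "\<And>x. cos (real k * x + \<xi> - (x - c)) = cos (real m * x + \<zeta>)" by blast
    have "(LINT x|circM. g x * of_real (cos (x - c)) * of_real (cos (real k * x + \<xi>))) =
      (LINT x|circM. (g x * of_real (cos (real (Suc k) * x + (\<xi> - c))) + g x * of_real (cos (real m * x + \<zeta>))) / 2)"
      unfolding mult.assoc p m by (simp add: distrib_left)
    also have "\<dots> = 0" using assms integrable_circM_cos[OF i]
      by (simp add: zero_coeffs_iff del: of_nat_Suc)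
    finally show ?thesis .
  qed
  moreover have "integrable circM (\<lambda>x. g x * of_real (cos (x - c)))"
    using integrable_circM_cos[OF i, of 1 "-c"] by simp
  ultimately show ?thesis by (simp add: zero_coeffs_iff)
qed

text \<open>The induction generalises \<open>g\<close>: a product \<open>f * h\<close> is handled by
  applying the hypothesis for \<open>h\<close> to the function obtained from
  \<open>f\<close>.\<close>

lemma zero_coeffs_poly:
  assumes "real_polynomial_function q" "zero_coeffs g"
  shows "zero_coeffs (\<lambda>x. g x * of_real (q (cos (x - c))))"
  using assms
proof (induction q arbitrary: g rule: real_polynomial_function.induct)
  case (linear f)
  then obtain s where "f = (\<lambda>x. x * s)" using real_bounded_linear by blast
  then show ?case using zero_coeffs_cmult[OF zero_coeffs_cos[OF linear(2), of c], of "of_real s"] by (simp add: mult_ac)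
next
  case (const k)
  then show ?case using zero_coeffs_cmult by blast
next
  case (add f h)
  then show ?case using zero_coeffs_add[OF add.IH(1) add.IH(2)] by (simp add: distrib_left)
next
  case (mult f h)
  then show ?case using mult.IH(2)[OF mult.IH(1)] by (simp add: mult_ac)
qed

text \<open>Steeper and steeper ramps, each replaced by a Weierstrass polynomial up to
  \<open>1 / Suc n\<close>. The uniform bound 2 is what dominated convergence will need.\<close>

lemma indicator_poly_approx:
  fixes s :: real
  obtains q :: "nat \<Rightarrow> real \<Rightarrow> real" where "\<And>n. real_polynomial_function (q n)"
    "\<And>n t. t \<in> {-1..1} \<Longrightarrow> \<bar>q n t\<bar> \<le> 2"
    "\<And>t. t \<in> {-1..1} \<Longrightarrow> (\<lambda>n. q n t) \<longlonglongrightarrow> indicat_real {s<..} t"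
proof -
  define \<phi> where "\<phi> n t = min 1 (max 0 (real n * (t - s)))" for n :: nat and t
  have "\<exists>q. real_polynomial_function q \<and> (\<forall>t\<in>{-1..1}. \<bar>\<phi> n t - q t\<bar> < 1 / real (Suc n))" for n
  proof -
    have "continuous_on {-1..1} (\<phi> n)" unfolding \<phi>_def by (intro continuous_intros)
    then obtain q where "real_polynomial_function q" "\<And>t. t \<in> {-1..1} \<Longrightarrow> \<bar>\<phi> n t - q t\<bar> < 1 / real (Suc n)"
      by (rule Stone_Weierstrass_real_polynomial_function[rotated, where e = "1 / real (Suc n)"]) auto
    then show ?thesis by blast
  qed
  then obtain q where q: "\<And>n. real_polynomial_function (q n)"
     "\<And>n t. t \<in> {-1..1} \<Longrightarrow> \<bar>\<phi> n t - q n t\<bar> < 1 / real (Suc n)" by metis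
  show ?thesis
  proof (rule that[of q])
    fix n and t :: real assume t: "t \<in> {-1..1}"
    have "1 / real (Suc n) \<le> 1" by simp
    moreover have "\<bar>\<phi> n t\<bar> \<le> 1" by (auto simp: \<phi>_def)
    ultimately show "\<bar>q n t\<bar> \<le> 2" using q(2)[OF t, of n] by linarith
  next
    fix t :: real assume t: "t \<in> {-1..1}"
    have "(\<lambda>n. \<phi> n t - q n t) \<longlonglongrightarrow> 0"
    proof (rule Lim_null_comparison)
      show "\<forall>\<^sub>F n in sequentially. norm (\<phi> n t - q n t) \<le> 1 / real (Suc n)"
        using q(2)[OF t] by (intro always_eventually) (auto intro: less_imp_le)
      show "(\<lambda>n. 1 / real (Suc n)) \<longlonglongrightarrow> 0" using LIMSEQ_inverse_real_of_nat by (simp add: inverse_eq_divide)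
    qed
    moreover have "(\<lambda>n. \<phi> n t) \<longlonglongrightarrow> indicat_real {s<..} t"
    proof (cases "t > s")
      case True
      obtain N :: nat where N: "1 / (t - s) < real N" using reals_Archimedean2 by blast
      have "\<phi> n t = 1" if "n \<ge> N" for n
      proof -
        have "1 / (t - s) < real n" using N that by linarith
        then have "1 < real n * (t - s)" using True by (simp add: field_simps)
        then show ?thesis by (simp add: \<phi>_def)
      qed
      then have "\<forall>\<^sub>F n in sequentially. \<phi> n t = 1" by (auto simp: eventually_sequentially)
      then show ?thesis using True by (auto intro: tendsto_eventually)
    next
      case False
      then have "\<phi> n t = 0" for n by (simp add: \<phi>_def max_def mult_le_0_iff zero_le_mult_iff) 
      then show ?thesis using False by simp
    qed
    ultimately have "(\<lambda>n. \<phi> n t - (\<phi> n t - q n t)) \<longlonglongrightarrow> indicat_real {s<..} t - 0"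
      by (intro tendsto_diff)
    then show "(\<lambda>n. q n t) \<longlonglongrightarrow> indicat_real {s<..} t" by simp
  qed (rule q)
qed

text \<open>The interval is \<open>{x. cos (x - c) > cos r}\<close>, so its indicator is a bounded limit of polynomials in \<open>cos (x - c)\<close>.\<close>
lemma zero_coeffs_interval:
  assumes z: "zero_coeffs g" and ab: "0 \<le> a" "a \<le> b" "b \<le> 2 * pi"
  shows "(LINT x|circM. indicat_real {a<..<b} x *\<^sub>R g x) = 0"
proof -
  define c where "c = (a + b) / 2"
  define r where "r = (b - a) / 2"
  obtain q :: "nat \<Rightarrow> real \<Rightarrow> real" where q: "\<And>n. real_polynomial_function (q n)"
    "\<And>n t. t \<in> {-1..1} \<Longrightarrow> \<bar>q n t\<bar> \<le> 2"
    "\<And>t. t \<in> {-1..1} \<Longrightarrow> (\<lambda>n. q n t) \<longlonglongrightarrow> indicat_real {cos r<..} t"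
    using indicator_poly_approx[of "cos r"] by blast
  have i: "integrable circM g" using z by (simp add: zero_coeffs_iff)
  have Q0: "(LINT x|circM. g x * of_real (q n (cos (x - c)))) = 0" for n
    using zero_coeffs_poly[OF q(1) z, of n c] unfolding zero_coeffs_iff
    by (auto dest!: conjunct2 spec[of _ "0::nat"] spec[of _ "0::real"])
  have qc: "q n \<in> borel_measurable borel" for n
    using q(1)[of n] by (intro borel_measurable_continuous_onI continuous_at_imp_continuous_on ballI continuous_real_polymonial_function)
  have "(\<lambda>n. LINT x|circM. g x * of_real (q n (cos (x - c)))) \<longlonglongrightarrow> (LINT x|circM. indicat_real {a<..<b} x *\<^sub>R g x)"
  proof (rule integral_dominated_convergence)
    show "(\<lambda>x. indicat_real {a<..<b} x *\<^sub>R g x) \<in> borel_measurable circM"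
      by (rule borel_measurable_scaleR) (use i in \<open>auto intro!: borel_measurable_circM\<close>)
    show "(\<lambda>x. g x * of_real (q n (cos (x - c)))) \<in> borel_measurable circM" for n
    proof (rule borel_measurable_times)
      show "(\<lambda>x. complex_of_real (q n (cos (x - c)))) \<in> borel_measurable circM"
      proof (rule borel_measurable_circM)
        have [measurable]: "(\<lambda>x. q n (cos (x - c))) \<in> borel_measurable borel"
          by (rule measurable_compose[OF _ qc]) measurable
        show "(\<lambda>x. complex_of_real (q n (cos (x - c)))) \<in> borel_measurable borel"
          by measurable
      qed
    qed (use i in auto)
    show "integrable circM (\<lambda>x. 2 * norm (g x))" using i by simp
    show "AE x in circM. norm (g x * of_real (q n (cos (x - c)))) \<le> 2 * norm (g x)" for n
    proof (rule AE_I2)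
      fix x
      have "norm (g x) * \<bar>q n (cos (x - c))\<bar> \<le> norm (g x) * 2"
        using q(2)[of "cos (x - c)" n] by (intro mult_left_mono) auto
      then show "norm (g x * of_real (q n (cos (x - c)))) \<le> 2 * norm (g x)"
        by (simp add: norm_mult mult.commute)
    qed
    have "AE x in lebesgue. x \<noteq> a \<and> x \<noteq> b"
      using AE_lborel_singleton[of a] AE_lborel_singleton[of b] by (auto intro!: AE_completion)
    then have "AE x in circM. x \<noteq> a \<and> x \<noteq> b" by (auto simp: AE_restrict_space_iff)
    then show "AE x in circM. (\<lambda>n. g x * of_real (q n (cos (x - c)))) \<longlonglongrightarrow> indicat_real {a<..<b} x *\<^sub>R g x"
      using AE_circM_interior
    proof eventually_elim
      case (elim x)
      have "cos r < cos (x - c) \<longleftrightarrow> x \<in> {a<..<b}"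
      proof -
        have r: "0 \<le> r" "r \<le> pi" using ab by (auto simp: r_def)
        have xc: "\<bar>x - c\<bar> < 2 * pi" "\<bar>x - c\<bar> \<le> 2 * pi - r" using elim ab by (auto simp: c_def r_def abs_if field_simps)
        have ne: "\<bar>x - c\<bar> \<noteq> r" using elim by (auto simp: c_def r_def abs_if field_simps)
        have "cos r < cos (x - c) \<longleftrightarrow> \<bar>x - c\<bar> < r"
        proof (cases "\<bar>x - c\<bar> \<le> pi")
          case True
          have "cos r < cos \<bar>x - c\<bar> \<longleftrightarrow> \<bar>x - c\<bar> < r"
            using cos_mono_less_eq[of r "\<bar>x - c\<bar>"] True r by auto
          then show ?thesis by simp
        next
          case False
          \<comment> \<open>Beyond \<open>pi\<close> the cosine rises again, but \<open>xc\<close>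
            keeps the reflected distance \<open>2 * pi - \<bar>x - c\<bar>\<close> at least
            \<open>r\<close>, because the interval lies within one period.\<close>
          have "cos (2 * pi - \<bar>x - c\<bar>) \<le> cos r"
            using False xc r by (intro cos_monotone_0_pi_le) auto
          then have "cos \<bar>x - c\<bar> \<le> cos r" by (simp add: cos_diff)
          then show ?thesis using False r by auto
        qed
        also have "\<dots> \<longleftrightarrow> x \<in> {a<..<b}" by (auto simp: c_def r_def abs_if field_simps)
        finally show ?thesis .
      qed
      then have e: "indicat_real {cos r<..} (cos (x - c)) = indicat_real {a<..<b} x" by (auto simp: indicator_def)
      have "(\<lambda>n. g x * of_real (q n (cos (x - c)))) \<longlonglongrightarrow> g x * of_real (indicat_real {cos r<..} (cos (x - c)))"
        by (intro tendsto_intros q(3)) auto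
      then show ?case unfolding e by (simp add: scaleR_conv_of_real mult.commute)
    qed
  qed
  then show ?thesis unfolding Q0 by (simp add: LIMSEQ_const_iff)
qed

text \<open>Dynkin's argument: open intervals form an intersection-stable generator of the Borel
  sets. Complements use that the integral over the whole period vanishes, the case
  \<open>k = 0\<close> of the hypothesis.\<close>

lemma zero_coeffs_borel:
  assumes z: "zero_coeffs g" and B: "B \<in> sets borel"
  shows "(LINT x:B|lebesgue. indicat_real {0..2 * pi} x *\<^sub>R g x) = 0"
proof -
  define h where "h x = indicat_real {0..2 * pi} x *\<^sub>R g x" for x
  have i: "integrable circM g" using z by (simp add: zero_coeffs_iff)
  have ih: "integrable lebesgue h"
    using i unfolding h_def by (simp add: integrable_restrict_space)
  have si: "set_integrable lebesgue A h" if "A \<in> sets borel" for A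
    unfolding set_integrable_def using ih that by (intro integrable_mult_indicator) auto
  let ?G = "range (\<lambda>(a::real, b). {a<..<b})"
  have sb: "sets borel = sigma_sets UNIV ?G"
    by (simp add: borel_eq_box box_real)
  have st: "Int_stable ?G"
  proof (rule Int_stableI)
    fix A B assume "A \<in> ?G" "B \<in> ?G"
    then obtain a b c d where "A = {a<..<b}" "B = {c<..<d}" by auto
    then have "A \<inter> B = (\<lambda>(a, b). {a<..<b}) (max a c, min b d)" by auto
    then show "A \<inter> B \<in> ?G" by blast
  qed
  have all: "(LINT x:UNIV|lebesgue. h x) = 0"
  proof -
    have "(LINT x|circM. g x) = 0"
      using z unfolding zero_coeffs_iff by (auto dest!: conjunct2 spec[of _ "0::nat"] spec[of _ "0::real"])
    then show ?thesis by (simp add: h_def set_lebesgue_integral_def integral_restrict_space)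
  qed
  have "B \<in> sigma_sets UNIV ?G" using B sb by simp
  then have "(LINT x:B|lebesgue. h x) = 0"
  proof (induction rule: sigma_sets_induct_disjoint[OF st subset_UNIV[of ?G, unfolded Pow_UNIV[symmetric]], consumes 1, case_names basic empty compl union])
    case (basic A)
    then obtain a b where A: "A = {a<..<b}" by auto
    \<comment> \<open>Clipping to the period, with \<open>b' \<ge> a'\<close> also when the interval
      misses the period, so that \<open>zero_coeffs_interval\<close> applies.\<close>
    define a' where "a' = max 0 (min a (2*pi))"
    define b' where "b' = max a' (min b (2 * pi))"
    have "(LINT x:A|lebesgue. h x) = (LINT x|circM. indicat_real A x *\<^sub>R g x)"
      by (simp add: set_lebesgue_integral_def h_def integral_restrict_space mult.commute scaleR_left_commute)
    also have "\<dots> = (LINT x|circM. indicat_real {a'<..<b'} x *\<^sub>R g x)"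
    proof (rule integral_cong_AE)
      show "AE x in circM. indicat_real A x *\<^sub>R g x = indicat_real {a'<..<b'} x *\<^sub>R g x"
        using AE_circM_interior by eventually_elim (auto simp: A a'_def b'_def indicator_def)
      have m: "(\<lambda>x. indicat_real {s<..<t} x *\<^sub>R g x) \<in> borel_measurable circM" for s t
        by (rule borel_measurable_scaleR) (use i in \<open>auto intro!: borel_measurable_circM\<close>)
      show "(\<lambda>x. indicat_real A x *\<^sub>R g x) \<in> borel_measurable circM" unfolding A by (rule m)
      show "(\<lambda>x. indicat_real {a'<..<b'} x *\<^sub>R g x) \<in> borel_measurable circM" by (rule m)
    qed
    also have "\<dots> = 0" using z by (intro zero_coeffs_interval) (auto simp: a'_def b'_def)
    finally show ?case .
  next
    case empty
    then show ?case by (simp add: set_lebesgue_integral_def)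
  next
    case (compl A)
    then have A: "A \<in> sets borel" using sb by simp
    have "(LINT x:UNIV|lebesgue. h x) = (LINT x:A|lebesgue. h x) + (LINT x:-A|lebesgue. h x)"
      using set_integral_Un[of A "-A" lebesgue h] si[of A] si[of "-A"] A by (simp add: Compl_partition)
    then show ?case using all compl by (simp add: Compl_eq_Diff_UNIV)
  next
    case (union A)
    then have A: "A n \<in> sets borel" for n using sb by auto
    have "(LINT x:(\<Union>n. A n)|lebesgue. h x) = (\<Sum>n. (LINT x:A n|lebesgue. h x))"
    proof (rule lebesgue_integral_countable_add)
      show "A n \<in> sets lebesgue" for n using A[of n] by simp
      show "set_integrable lebesgue (\<Union>n. A n) h" using A by (intro si) auto
    qed (use union in \<open>auto simp: disjoint_family_on_def\<close>)
    then show ?case using union by simp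
  qed
  then show ?thesis by (simp add: h_def)
qed

text \<open>Uniqueness of Fourier series for integrable functions. A Lebesgue set is a Borel set up
  to a negligible set, so the integral of \<open>g\<close> over every measurable set
  vanishes.\<close>

theorem zero_coeffs_imp_AE_zero:
  assumes z: "zero_coeffs g"
  shows "AE x in circM. g x = 0"
proof (rule sigma_finite_measure.density_zero)
  show "sigma_finite_measure circM" using finite_measure_circM by (rule finite_measure.axioms)
  show i: "integrable circM g" using z by (simp add: zero_coeffs_iff)
  fix A assume A: "A \<in> sets circM"
  then have "A \<in> sets lebesgue" by (auto simp: sets_restrict_space)
  then obtain B N where BN: "B \<in> sets borel" "negligible N" "B \<union> N = A"
    using sets_lebesgue_almost_borel by blast
  have N: "AE x in circM. x \<notin> N"
    using BN(2) AE_not_in[of N lebesgue] by (auto simp: AE_restrict_space_iff negligible_iff_null_sets elim: eventually_mono)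
  have "(LINT x:A|circM. g x) = (LINT x|circM. indicat_real B x *\<^sub>R g x)"
    unfolding set_lebesgue_integral_def
  proof (rule integral_cong_AE)
    show "AE x in circM. indicat_real A x *\<^sub>R g x = indicat_real B x *\<^sub>R g x"
      using N by eventually_elim (use BN(3) in \<open>auto simp: indicator_def\<close>)
    show "(\<lambda>x. indicat_real A x *\<^sub>R g x) \<in> borel_measurable circM"
      by (rule borel_measurable_scaleR) (use i A in \<open>auto\<close>)
    show "(\<lambda>x. indicat_real B x *\<^sub>R g x) \<in> borel_measurable circM"
      by (rule borel_measurable_scaleR) (use i BN(1) in \<open>auto intro!: borel_measurable_circM\<close>)
  qed
  also have "\<dots> = (LINT x:B|lebesgue. indicat_real {0..2 * pi} x *\<^sub>R g x)"
    by (simp add: set_lebesgue_integral_def integral_restrict_space mult.commute scaleR_left_commute)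
  also have "\<dots> = 0" by (rule zero_coeffs_borel[OF z BN(1)])
  finally show "(LINT x:A|circM. g x) = 0" .
qed

section \<open>Almost everywhere convergence of the Fourier series\<close>

text \<open>Half-open periods can be cut and reassembled without overlap. As \<open>g\<close> is
  arbitrary, measurability has to be carried across the change at the single point
  \<open>2 * pi\<close> in both directions.\<close>

lemma has_bochner_circM_iff:
  fixes g :: "real \<Rightarrow> 'a :: euclidean_space"
  shows "has_bochner_integral circM g I \<longleftrightarrow> has_bochner_integral lebesgue (\<lambda>x. indicat_real {0..<2 * pi} x *\<^sub>R g x) I"
proof -
  have "AE x in lebesgue. x \<noteq> 2 * pi"
    using AE_lborel_singleton[of "2 * pi"] by (rule AE_completion)
  then have ae: "AE x in lebesgue. indicat_real {0..2 * pi} x *\<^sub>R g x = indicat_real {0..<2 * pi} x *\<^sub>R g x"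
    by eventually_elim (auto simp: indicator_def)
  have "has_bochner_integral circM g I \<longleftrightarrow> has_bochner_integral lebesgue (\<lambda>x. indicat_real {0..2 * pi} x *\<^sub>R g x) I"
    by (simp add: has_bochner_integral_restrict_space)
  also have "\<dots> \<longleftrightarrow> has_bochner_integral lebesgue (\<lambda>x. indicat_real {0..<2 * pi} x *\<^sub>R g x) I"
  proof -
    have m: "(\<lambda>x. indicat_real {0..2 * pi} x *\<^sub>R g x) \<in> borel_measurable lebesgue
       \<longleftrightarrow> (\<lambda>x. indicat_real {0..<2 * pi} x *\<^sub>R g x) \<in> borel_measurable lebesgue"
    proof
      assume "(\<lambda>x. indicat_real {0..2 * pi} x *\<^sub>R g x) \<in> borel_measurable lebesgue"
      then have "(\<lambda>x. indicat_real {0..<2 * pi} x *\<^sub>R (indicat_real {0..2 * pi} x *\<^sub>R g x)) \<in> borel_measurable lebesgue"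
        by (rule borel_measurable_scaleR[OF borel_measurable_indicator, rotated]) auto
      also have "(\<lambda>x. indicat_real {0..<2 * pi} x *\<^sub>R (indicat_real {0..2 * pi} x *\<^sub>R g x)) = (\<lambda>x. indicat_real {0..<2 * pi} x *\<^sub>R g x)"
        by (auto simp: indicator_def fun_eq_iff)
      finally show "(\<lambda>x. indicat_real {0..<2 * pi} x *\<^sub>R g x) \<in> borel_measurable lebesgue" .
    next
      assume "(\<lambda>x. indicat_real {0..<2 * pi} x *\<^sub>R g x) \<in> borel_measurable lebesgue"
      then have "(\<lambda>x. indicat_real {0..<2 * pi} x *\<^sub>R g x + indicat_real {2 * pi} x *\<^sub>R g (2 * pi)) \<in> borel_measurable lebesgue"
        by (rule borel_measurable_add[OF _ borel_measurable_scaleR[OF borel_measurable_indicator borel_measurable_const]]) simp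
      also have "(\<lambda>x. indicat_real {0..<2 * pi} x *\<^sub>R g x + indicat_real {2 * pi} x *\<^sub>R g (2 * pi)) = (\<lambda>x. indicat_real {0..2 * pi} x *\<^sub>R g x)"
      proof (rule ext)
        fix x
        show "indicat_real {0..<2 * pi} x *\<^sub>R g x + indicat_real {2 * pi} x *\<^sub>R g (2 * pi) = indicat_real {0..2 * pi} x *\<^sub>R g x"
          by (cases "x < 2 * pi"; cases "x = 2 * pi") (simp_all add: indicator_def)
      qed
      finally show "(\<lambda>x. indicat_real {0..2 * pi} x *\<^sub>R g x) \<in> borel_measurable lebesgue" .
    qed
    show ?thesis
    proof (cases "(\<lambda>x. indicat_real {0..2 * pi} x *\<^sub>R g x) \<in> borel_measurable lebesgue")
      case True
      then show ?thesis using m by (intro has_bochner_integral_cong_AE ae) auto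
    next
      case False
      then show ?thesis using m by (auto dest: borel_measurable_has_bochner_integral)
    qed
  qed
  finally show ?thesis .
qed

text \<open>Reduce \<open>c\<close> modulo the period to \<open>c0\<close>, cut the period at
  \<open>c0\<close>, move the left piece up by \<open>2 * pi\<close>, and translate the resulting
  interval from \<open>c0\<close> to \<open>2 * pi + c0\<close> back to the origin.\<close>

lemma has_bochner_circM_shift:
  fixes g :: "real \<Rightarrow> 'a :: euclidean_space"
  assumes per: "\<And>x. g (x + 2 * pi) = g x" and I: "has_bochner_integral circM g I"
  shows "has_bochner_integral circM (\<lambda>x. g (x + c)) I"
proof -
  interpret periodic_fun_simple g "2 * pi" by unfold_locales (rule per)
  define m where "m = \<lfloor>c / (2 * pi)\<rfloor>"
  define c0 where "c0 = c - of_int m * (2 * pi)"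
  have c0: "0 \<le> c0" "c0 < 2 * pi"
  proof -
    have "of_int m \<le> c / (2 * pi)" "c / (2 * pi) < of_int m + 1" unfolding m_def by linarith+
    then show "0 \<le> c0" "c0 < 2 * pi" by (auto simp: c0_def field_simps)
  qed
  have gc: "g (x + c) = g (x + c0)" for x
    using plus_of_int[of "x + c0" m] by (simp add: c0_def)
  let ?h = "\<lambda>S x. indicat_real S x *\<^sub>R g x"
  have i0: "has_bochner_integral lebesgue (?h {0..<2*pi}) I" using I by (simp add: has_bochner_circM_iff)
  have sub: "has_bochner_integral lebesgue (?h S) (integral\<^sup>L lebesgue (?h S))" if "S \<subseteq> {0..<2*pi}" "S \<in> sets lebesgue" for S
  proof -
    have "integrable lebesgue (\<lambda>x. indicat_real S x *\<^sub>R ?h {0..<2*pi} x)"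
      using i0 that by (intro integrable_mult_indicator[OF that(2)]) (simp add: has_bochner_integral_iff)
    also have "(\<lambda>x. indicat_real S x *\<^sub>R ?h {0..<2*pi} x) = ?h S" using that by (auto simp: indicator_def fun_eq_iff)
    finally show ?thesis by (simp add: has_bochner_integral_iff)
  qed
  define I1 where "I1 = integral\<^sup>L lebesgue (?h {c0..<2*pi})"
  define I2 where "I2 = integral\<^sup>L lebesgue (?h {0..<c0})"
  have h1: "has_bochner_integral lebesgue (?h {c0..<2*pi}) I1" unfolding I1_def using c0 by (intro sub) auto
  have h2: "has_bochner_integral lebesgue (?h {0..<c0}) I2" unfolding I2_def using c0 by (intro sub) auto
  have "has_bochner_integral lebesgue (\<lambda>x. ?h {c0..<2*pi} x + ?h {0..<c0} x) (I1 + I2)"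
    by (intro has_bochner_integral_add h1 h2)
  also have "(\<lambda>x. ?h {c0..<2*pi} x + ?h {0..<c0} x) = ?h {0..<2*pi}" using c0 by (auto simp: indicator_def fun_eq_iff)
  finally have sum: "I1 + I2 = I" using i0 by (metis has_bochner_integral_eq)
  have "has_bochner_integral lebesgue (\<lambda>x. ?h {0..<c0} (- 2 * pi + 1 * x)) (I2 /\<^sub>R \<bar>1\<bar>)"
    using h2 by (subst has_bochner_integral_lebesgue_real_affine_iff[symmetric]) auto
  moreover have "?h {0..<c0} (- 2 * pi + 1 * x) = ?h {2*pi..<2*pi + c0} x" for x
    using per[of "x - 2 * pi"] by (auto simp: indicator_def)
  ultimately have h3: "has_bochner_integral lebesgue (?h {2*pi..<2*pi + c0}) I2" by simp
  have "has_bochner_integral lebesgue (\<lambda>x. ?h {c0..<2*pi} x + ?h {2*pi..<2*pi + c0} x) (I1 + I2)"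
    by (intro has_bochner_integral_add h1 h3)
  also have "(\<lambda>x. ?h {c0..<2*pi} x + ?h {2*pi..<2*pi + c0} x) = ?h {c0..<2*pi + c0}" using c0 by (auto simp: indicator_def fun_eq_iff)
  finally have "has_bochner_integral lebesgue (?h {c0..<2*pi + c0}) I" using sum by simp
  then have "has_bochner_integral lebesgue (\<lambda>x. ?h {c0..<2*pi + c0} (c0 + 1 * x)) (I /\<^sub>R \<bar>1\<bar>)"
    by (subst has_bochner_integral_lebesgue_real_affine_iff[symmetric]) auto
  moreover have "?h {c0..<2*pi + c0} (c0 + 1 * x) = indicat_real {0..<2*pi} x *\<^sub>R g (x + c)" for x
    unfolding gc by (auto simp: indicator_def add.commute)
  ultimately show ?thesis by (simp add: has_bochner_circM_iff)
qed

lemma circM_shift: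
  fixes g :: "real \<Rightarrow> 'a :: euclidean_space"
  assumes "\<And>x. g (x + 2 * pi) = g x" "integrable circM g"
  shows "integrable circM (\<lambda>x. g (x + c))" "(LINT x|circM. g (x + c)) = (LINT x|circM. g x)"
  using has_bochner_circM_shift[where g = g and c = c and I = "integral\<^sup>L circM g"] assms
  by (auto simp: has_bochner_integral_iff)

lemma measurable_lebesgue_shift:
  "f \<in> borel_measurable lebesgue \<Longrightarrow> (\<lambda>x. f (x + c)) \<in> borel_measurable lebesgue" for c :: real
  using measurable_compose[OF lebesgue_affine_measurable[of "\<lambda>_. 1" c], of f borel]
  by (simp add: add.commute)

lemma cos_add_period: "cos (real k * (x + 2 * pi) + \<zeta>) = cos (real k * x + \<zeta>)"
  using cos_int_2pin[of "int k"] sin_int_2pin[of "int k"] cos_add[of "real k * x + \<zeta>" "2 * pi * real k"]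
  by (simp add: algebra_simps)

section \<open>Orthogonality and Fourier coefficients of trigonometric polynomials\<close>

lemma integral_cos_circM:
  assumes "m \<noteq> (0::int)"
  shows "(LINT x|circM. cos (of_int m * x + \<xi>)) = 0"
proof -
  have "((\<lambda>x. cos (of_int m * x + \<xi>)) has_integral
     (sin (of_int m * (2 * pi) + \<xi>) / of_int m - sin (of_int m * 0 + \<xi>) / of_int m)) {0..2*pi}"
    using assms by (intro fundamental_theorem_of_calculus)
      (auto intro!: derivative_eq_intros simp flip: has_real_derivative_iff_has_vector_derivative)
  moreover have "sin (of_int m * (2 * pi) + \<xi>) = sin \<xi>"
    using sin_int_2pin[of m] cos_int_2pin[of m] by (simp add: sin_add mult_ac)
  ultimately have "integral {0..2*pi} (\<lambda>x. cos (of_int m * x + \<xi>)) = 0" by (simp add: integral_unique)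
  moreover have "integrable circM (\<lambda>x. cos (of_int m * x + \<xi>))"
    by (rule integrable_circM_bounded[where B = 1]) (auto intro!: borel_measurable_circM)
  ultimately show ?thesis by (simp add: lebesgue_integral_eq_integral)
qed

lemma measure_circM: "measure circM (space circM) = 2 * pi"
  by (simp add: measure_restrict_space)

lemma integral_cos_cos:
  fixes k l :: nat
  assumes "1 \<le> k"
  shows "(LINT x|circM. cos (real k * x + \<xi>) * cos (real l * x + \<zeta>)) = (if k = l then pi * cos (\<xi> - \<zeta>) else 0)"
proof -
  have i: "integrable circM (\<lambda>x. cos (of_int m * x + \<xi>))" for m \<xi>
    by (rule integrable_circM_bounded[where B = 1]) (auto intro!: borel_measurable_circM)
  have "cos (real k * x + \<xi>) * cos (real l * x + \<zeta>)
      = (cos (of_int (int k - int l) * x + (\<xi> - \<zeta>)) + cos (of_int (int k + int l) * x + (\<xi> + \<zeta>))) / 2" for x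
    unfolding cos_times_cos by (simp add: algebra_simps)
  then have "(LINT x|circM. cos (real k * x + \<xi>) * cos (real l * x + \<zeta>))
     = (LINT x|circM. (cos (of_int (int k - int l) * x + (\<xi> - \<zeta>)) + cos (of_int (int k + int l) * x + (\<xi> + \<zeta>))) / 2)"
    by presburger
  also have "\<dots> = ((LINT x|circM. cos (of_int (int k - int l) * x + (\<xi> - \<zeta>))) + (LINT x|circM. cos (of_int (int k + int l) * x + (\<xi> + \<zeta>)))) / 2"
    using i by (simp del: of_int_diff of_int_add of_int_of_nat_eq)
  also have "(LINT x|circM. cos (of_int (int k + int l) * x + (\<xi> + \<zeta>))) = 0"
    using assms by (intro integral_cos_circM) auto
  also have "(LINT x|circM. cos (of_int (int k - int l) * x + (\<xi> - \<zeta>))) = (if k = l then 2 * pi * cos (\<xi> - \<zeta>) else 0)"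
  proof (cases "k = l")
    case True
    then show ?thesis using measure_circM by simp
  next
    case False
    then show ?thesis by (simp add: integral_cos_circM del: of_int_diff)
  qed
  finally show ?thesis by auto
qed

lemma sin_eq_cos_shift: "sin (t + \<xi>) = cos (t + (\<xi> - pi / 2))" for t \<xi> :: real
  by (simp add: cos_diff sin_add cos_add sin_diff)

text \<open>The test phase is free: \<open>\<zeta> = \<xi>\<close> isolates \<open>a l\<close> and
  \<open>\<zeta> = \<xi> - pi / 2\<close> isolates \<open>b l\<close>. This is how a constant phase
  in the multiplier is removed in the lower bounds.\<close>

lemma wpoly_coeff:
  assumes "1 \<le> N"
  shows "(LINT x|circM. wpoly a b \<rho> \<xi> N M x * of_real (cos (real l * x + \<zeta>)))
     = (if l \<in> {N..M} then of_real (pi * \<rho> l) * (a l * of_real (cos (\<xi> - \<zeta>)) + b l * of_real (sin (\<xi> - \<zeta>))) else 0)"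
proof -
  have i: "integrable circM (\<lambda>x. complex_of_real (cos (real k * x + \<xi>) * cos (real l * x + \<zeta>)))" for k \<xi>
    by (rule integrable_circM_bounded[where B = 1])
      (auto intro!: borel_measurable_circM mult_le_one simp: norm_mult abs_mult)
  have v: "(LINT x|circM. complex_of_real (cos (real k * x + \<xi>) * cos (real l * x + \<zeta>))) = (if k = l then of_real (pi * cos (\<xi> - \<zeta>)) else 0)"
    if "1 \<le> k" for k \<xi>
  proof -
    have "integrable circM (\<lambda>x. cos (real k * x + \<xi>) * cos (real l * x + \<zeta>))"
      using i[of k \<xi>] by (simp only: complex_of_real_integrable_eq)
    then show ?thesis using integral_cos_cos[OF that, of \<xi> l \<zeta>] by (simp del: of_real_mult)
  qed
  have "(LINT x|circM. wpoly a b \<rho> \<xi> N M x * of_real (cos (real l * x + \<zeta>)))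
     = (LINT x|circM. (\<Sum>k=N..M. (of_real (\<rho> k) * a k) * complex_of_real (cos (real k * x + \<xi>) * cos (real l * x + \<zeta>))
        + (of_real (\<rho> k) * b k) * complex_of_real (cos (real k * x + (\<xi> - pi / 2)) * cos (real l * x + \<zeta>))))"
    unfolding wpoly_def sin_eq_cos_shift sum_distrib_right
    by (intro Bochner_Integration.integral_cong sum.cong refl) (simp add: algebra_simps)
  also have "\<dots> = (\<Sum>k=N..M. (of_real (\<rho> k) * a k) * (if k = l then of_real (pi * cos (\<xi> - \<zeta>)) else 0)
        + (of_real (\<rho> k) * b k) * (if k = l then of_real (pi * cos (\<xi> - pi / 2 - \<zeta>)) else 0))"
    using i v assms by (simp add: Bochner_Integration.integral_sum del: of_real_mult)
  also have "\<dots> = (if l \<in> {N..M} then of_real (pi * \<rho> l) * (a l * of_real (cos (\<xi> - \<zeta>)) + b l * of_real (sin (\<xi> - \<zeta>))) else 0)"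
  proof -
    have "cos (\<xi> - pi / 2 - \<zeta>) = sin (\<xi> - \<zeta>)" by (simp add: sin_diff cos_diff)
    then show ?thesis by (auto simp: if_distrib sum.delta algebra_simps cong: if_cong)
  qed
  finally show ?thesis .
qed


lemma fourier_cos_circM: "fourier_cos f k = (LINT x|circM. f x * of_real (cos (real k * x))) / of_real pi"
  by (simp add: fourier_cos_def set_integral_circM)

lemma fourier_sin_circM: "fourier_sin f k = (LINT x|circM. f x * of_real (sin (real k * x))) / of_real pi"
  by (simp add: fourier_sin_def set_integral_circM)

lemma fourier_coeff_shift:
  assumes "integrable circM f"
  shows "(LINT x|circM. f x * of_real (cos (real k * x + \<zeta>)))
     = of_real pi * (fourier_cos f k * of_real (cos \<zeta>) - fourier_sin f k * of_real (sin \<zeta>))"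
proof -
  have i1: "integrable circM (\<lambda>x. f x * of_real (cos (real k * x)))"
    using integrable_circM_cos[OF assms, of k 0] by simp
  have i2: "integrable circM (\<lambda>x. f x * of_real (sin (real k * x)))"
    using integrable_circM_cos[OF assms, of k "- pi/2"] by (simp add: cos_diff)
  have "(LINT x|circM. f x * of_real (cos (real k * x + \<zeta>)))
      = (LINT x|circM. of_real (cos \<zeta>) * (f x * of_real (cos (real k * x))) - of_real (sin \<zeta>) * (f x * of_real (sin (real k * x))))"
    by (intro Bochner_Integration.integral_cong) (auto simp: cos_add algebra_simps)
  also have "\<dots> = of_real (cos \<zeta>) * (of_real pi * fourier_cos f k) - of_real (sin \<zeta>) * (of_real pi * fourier_sin f k)"
    using i1 i2 by (simp add: fourier_cos_circM fourier_sin_circM)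
  finally show ?thesis by (simp add: algebra_simps)
qed

lemma fourier_sum_eq_wpoly:
  "fourier_cos f 0 = 0 \<Longrightarrow> fourier_sum n f x = wpoly (fourier_cos f) (fourier_sin f) (\<lambda>_. 1) 0 1 n x"
  by (simp add: fourier_sum_def wpoly_def)

lemma wpoly_diff:
  assumes "1 \<le> N" "N \<le> Suc M"
  shows "wpoly a b \<rho> \<xi> 1 M x - wpoly a b \<rho> \<xi> 1 (N - 1) x = wpoly a b \<rho> \<xi> N M x"
proof -
  have "{1..M} = {1..N - 1} \<union> {N..M}" "{1..N - 1} \<inter> {N..M} = {}" using assms by auto
  then show ?thesis unfolding wpoly_def by (simp add: sum.union_disjoint)
qed

section \<open>Convergence of the partial sums and passage to the limit\<close>

lemma sum_tail_small:
  fixes A :: "nat \<Rightarrow> real"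
  assumes "summable A" "\<And>j. 0 \<le> A j" "0 < e"
  obtains U where "\<And>u v. U \<le> u \<Longrightarrow> (\<Sum>j=u..v. A j) < e"
proof -
  obtain U where U: "\<And>m n. m \<ge> U \<Longrightarrow> norm (sum A {m..<n}) < e"
    using assms(1,3) unfolding summable_Cauchy by blast
  have "(\<Sum>j=u..v. A j) < e" if "U \<le> u" for u v
    using U[OF that, of "Suc v"] by (simp add: atLeastLessThanSuc_atLeastAtMost)
  then show ?thesis by (rule that)
qed

text \<open>The partial sums converge off the zeros of \<open>sin (x / 2)\<close> with an integrable majorant, so their
  limit has the Fourier coefficients of \<open>f\<close>.\<close>
lemma fourier_series_tendsto_AE:
  assumes f: "integrable circM f" "fourier_cos f 0 = 0"
    and GM: "GM_with C (fourier_cos f)" "GM_with C (fourier_sin f)" "0 \<le> C"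
    and \<theta>: "0 < \<theta>" "\<theta> < 1"
    and summ: "summable (\<lambda>j. 2 powr (real j * \<theta>) * (norm (fourier_cos f (2 ^ j)) + norm (fourier_sin f (2 ^ j))))"
  shows "AE x in circM. (\<lambda>n. fourier_sum n f x) \<longlonglongrightarrow> f x"
proof -
  let ?a = "fourier_cos f" and ?b = "fourier_sin f"
  let ?y = "\<lambda>x::real. 1 / \<bar>sin (x / 2)\<bar>"
  define S where "S n x = wpoly ?a ?b (\<lambda>_. 1) 0 1 n x" for n x
  define A where "A j = (1 + 2 * C) * (norm (?a (2 ^ j)) + norm (?b (2 ^ j)))" for j
  have A0: "0 \<le> A j" for j using GM by (simp add: A_def)
  have summ2: "summable (\<lambda>j. 2 powr (real j * \<theta>) * A j)"
    using summable_mult[OF summ, of "1 + 2 * C"] by (simp add: A_def mult_ac)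
  have summ1: "summable A"
  proof (rule summable_comparison_test[OF _ summ2], intro exI allI impI)
    fix j
    have "1 * A j \<le> 2 powr (real j * \<theta>) * A j" using A0 \<theta> by (intro mult_right_mono ge_one_powr_ge_zero) auto
    then show "norm (A j) \<le> 2 powr (real j * \<theta>) * A j" using A0[of j] by simp
  qed
  have bnd: "norm (wpoly ?a ?b (\<lambda>_. 1) 0 N M x) \<le> (\<Sum>j=u..v. A j * dk j x)"
    if "2 ^ u \<le> N" "M < 2 ^ Suc v" for u v N M x
    using wpoly_bound[OF GM that, of "\<lambda>_. 1" "\<lambda>_. 1" 0 x] by (simp add: A_def)
  \<comment> \<open>At a fixed point every \<open>dk j x\<close> is at most
    \<open>1 / \<bar>sin (x / 2)\<bar>\<close>, so plain summability of \<open>A\<close> suffices;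
    the weight \<open>2 powr (real j * \<theta>)\<close> is needed for the majorant only.\<close>
  have conv: "convergent (\<lambda>n. S n x)" if s: "sin (x / 2) \<noteq> 0" for x
  proof (rule Cauchy_convergent, rule metric_CauchyI)
    fix e :: real assume e: "0 < e"
    have y: "?y x > 0" using s by simp
    obtain U where U: "\<And>u v. U \<le> u \<Longrightarrow> (\<Sum>j=u..v. A j) < e / ?y x"
      using sum_tail_small[OF summ1 A0, of "e / ?y x"] e y by auto
    have d: "dist (S M x) (S N x) < e" if "2 ^ U \<le> N" "N \<le> M" for N M
    proof -
      have "dist (S M x) (S N x) = norm (wpoly ?a ?b (\<lambda>_. 1) 0 (Suc N) M x)"
        using wpoly_diff[of "Suc N" M ?a ?b "\<lambda>_. 1" 0 x] that by (simp add: S_def dist_norm)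
      also have "\<dots> \<le> (\<Sum>j=U..M. A j * dk j x)"
        using that by (intro bnd) (auto intro: less_trans[OF less_exp])
      also have "\<dots> \<le> (\<Sum>j=U..M. A j * ?y x)"
        using A0 s by (intro sum_mono mult_left_mono) (auto simp: dk_def)
      also have "\<dots> = (\<Sum>j=U..M. A j) * ?y x" by (simp only: sum_distrib_right)
      also have "\<dots> < e" using U[of U M] y by (simp only: pos_less_divide_eq order_refl)
      finally show ?thesis .
    qed
    show "\<exists>M. \<forall>m\<ge>M. \<forall>n\<ge>M. dist (S m x) (S n x) < e"
      by (intro exI[of _ "2 ^ U"] allI impI) (metis d dist_commute nle_le)
  qed
  define F where "F x = lim (\<lambda>n. S n x)" for x
  have SF: "AE x in circM. (\<lambda>n. S n x) \<longlonglongrightarrow> F x"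
    using AE_circM_interior
  proof eventually_elim
    case (elim x)
    then have "sin (x / 2) \<noteq> 0" using sin_gt_zero[of "x/2"] by auto
    then show ?case using conv unfolding F_def by (simp add: convergent_LIMSEQ_iff)
  qed
  define B where "B = (\<Sum>j. 2 powr (real j * \<theta>) * A j)"
  \<comment> \<open>The factor \<open>dk 0 x\<close> is 1 off the zeros of the sine; it brings the
    majorant into the form of \<open>dk_powr_integral\<close> with exponent
    \<open>1 - \<theta>\<close>.\<close>
  define G where "G x = B * (dk 0 x * ?y x powr (1 - \<theta>))" for x
  have G: "integrable circM G"
    unfolding G_def using dk_powr_integral(1)[of "1 - \<theta>" 0] \<theta> by simp
  have dom: "AE x in circM. norm (S n x) \<le> G x" for n
    using AE_circM_interior
  proof eventually_elim
    case (elim x)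
    then have s: "sin (x / 2) \<noteq> 0" using sin_gt_zero[of "x/2"] by auto
    have y1: "1 \<le> ?y x" by (rule inverse_sin_half_ge_1[OF s])
    \<comment> \<open>Interpolation between the bounds \<open>2 ^ j\<close> and
      \<open>1 / \<bar>sin (x / 2)\<bar>\<close>: the first factor is paid for by
      \<open>summ\<close>, the second is integrable because \<open>1 - \<theta> < 1\<close>.\<close>
    have dk: "dk j x \<le> 2 powr (real j * \<theta>) * ?y x powr (1 - \<theta>)" for j
    proof -
      have d: "dk j x = min (2 ^ j) (?y x)" using s by (simp add: dk_def)
      have d0: "0 < dk j x" using s unfolding d by simp
      have "dk j x = dk j x powr \<theta> * dk j x powr (1 - \<theta>)" using d0 by (simp add: powr_add[symmetric])
      also have "\<dots> \<le> (2 ^ j) powr \<theta> * ?y x powr (1 - \<theta>)"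
        using \<theta> d0 by (intro mult_mono powr_mono2) (auto simp: d)
      also have "(2 ^ j) powr \<theta> = 2 powr (real j * \<theta>)" by (simp add: powr_realpow[symmetric] powr_powr)
      finally show ?thesis .
    qed
    have "norm (S n x) \<le> (\<Sum>j=0..n. A j * dk j x)"
      unfolding S_def by (rule bnd) (auto intro: less_trans[OF less_exp])
    also have "\<dots> \<le> (\<Sum>j=0..n. A j * (2 powr (real j * \<theta>) * ?y x powr (1 - \<theta>)))"
      using A0 dk by (intro sum_mono mult_left_mono) auto
    also have "\<dots> = (\<Sum>j=0..n. 2 powr (real j * \<theta>) * A j) * ?y x powr (1 - \<theta>)"
      unfolding sum_distrib_right by (intro sum.cong refl) (simp only: mult_ac)
    also have "\<dots> \<le> B * ?y x powr (1 - \<theta>)"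
      unfolding B_def using summ2 A0 by (intro mult_right_mono sum_le_suminf) auto
    also have "dk 0 x = 1" using y1 s by (simp add: dk_def)
    then have "B * ?y x powr (1 - \<theta>) = G x" by (simp add: G_def)
    finally show ?case .
  qed
  have Sm: "S n \<in> borel_measurable borel" for n unfolding S_def by measurable
  have Fm: "F \<in> borel_measurable borel" unfolding F_def by (rule borel_measurable_lim_metric[OF Sm])
  have Fi: "integrable circM F"
    by (rule integrable_dominated_convergence[OF _ _ G SF dom]) (use Sm Fm in \<open>auto intro: borel_measurable_circM\<close>)
  have "zero_coeffs (\<lambda>x. f x - F x)"
    unfolding zero_coeffs_iff
  proof (intro conjI allI)
    fix l :: nat and \<zeta> :: real
    have "(\<lambda>n. LINT x|circM. S n x * of_real (cos (real l * x + \<zeta>))) \<longlonglongrightarrow> (LINT x|circM. F x * of_real (cos (real l * x + \<zeta>)))"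
    proof (rule integral_dominated_convergence[OF _ _ G])
      show "AE x in circM. (\<lambda>n. S n x * of_real (cos (real l * x + \<zeta>))) \<longlonglongrightarrow> F x * of_real (cos (real l * x + \<zeta>))"
        using SF by eventually_elim (intro tendsto_intros)
      show "AE x in circM. norm (S n x * of_real (cos (real l * x + \<zeta>))) \<le> G x" for n
        using dom[of n] 
      proof eventually_elim
        case (elim x)
        have "norm (S n x * of_real (cos (real l * x + \<zeta>))) \<le> norm (S n x) * 1"
          unfolding norm_mult by (intro mult_left_mono) auto
        then show ?case using elim by simp
      qed
    qed (use Sm Fm in \<open>auto intro!: borel_measurable_circM\<close>)
    moreover have "(\<lambda>n. LINT x|circM. S n x * of_real (cos (real l * x + \<zeta>))) \<longlonglongrightarrow> (LINT x|circM. f x * of_real (cos (real l * x + \<zeta>)))"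
    proof (rule tendsto_eventually)
      show "\<forall>\<^sub>F n in sequentially. (LINT x|circM. S n x * of_real (cos (real l * x + \<zeta>))) = (LINT x|circM. f x * of_real (cos (real l * x + \<zeta>)))"
        unfolding eventually_sequentially
      proof (intro exI[of _ l] allI impI)
        fix n assume "l \<le> n"
        moreover have "fourier_sin f 0 = 0" by (simp add: fourier_sin_circM)
        \<comment> \<open>From \<open>n = l\<close> on, the coefficient of \<open>S n\<close> at
          \<open>l\<close> no longer changes. For \<open>l = 0\<close>, which is not a frequency of
          \<open>S n\<close>, both sides vanish by \<open>f(2)\<close>.\<close>
        ultimately show "(LINT x|circM. S n x * of_real (cos (real l * x + \<zeta>))) = (LINT x|circM. f x * of_real (cos (real l * x + \<zeta>)))"
          unfolding S_def wpoly_coeff[OF order_refl] fourier_coeff_shift[OF f(1)]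
          using f(2) by (cases "l = 0") auto
      qed
    qed
    ultimately have "(LINT x|circM. F x * of_real (cos (real l * x + \<zeta>))) = (LINT x|circM. f x * of_real (cos (real l * x + \<zeta>)))"
      by (rule LIMSEQ_unique)
    then show "(LINT x|circM. (f x - F x) * of_real (cos (real l * x + \<zeta>))) = 0"
      using integrable_circM_cos[OF f(1)] integrable_circM_cos[OF Fi] by (simp add: left_diff_distrib)
  qed (use f Fi in auto)
  then have "AE x in circM. f x - F x = 0" by (rule zero_coeffs_imp_AE_zero)
  then show ?thesis using SF by eventually_elim (use f(2) in \<open>auto simp: fourier_sum_eq_wpoly S_def\<close>)
qed

text \<open>Fatou's lemma, used here to obtain integrability of the limit as well as its
  bound.\<close>

lemma Lp_bound_AE_limit:
  fixes g :: "nat \<Rightarrow> real \<Rightarrow> complex"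
  assumes lim: "AE x in circM. (\<lambda>n. g n x) \<longlonglongrightarrow> h x" and p: "0 < p"
    and m: "\<And>n. g n \<in> borel_measurable circM" "h \<in> borel_measurable circM"
    and i: "\<And>n. integrable circM (\<lambda>x. norm (g n x) powr p)"
    and B: "\<And>n. n \<ge> N \<Longrightarrow> (LINT x|circM. norm (g n x) powr p) \<le> B"
  shows "integrable circM (\<lambda>x. norm (h x) powr p)" "(LINT x|circM. norm (h x) powr p) \<le> B"
proof -
  have B0: "0 \<le> B" using B[of N] by (intro order_trans[OF _ B[of N]] integral_nonneg_AE) auto
  have "(\<integral>\<^sup>+x. ennreal (norm (h x) powr p) \<partial>circM) = (\<integral>\<^sup>+x. liminf (\<lambda>n. ennreal (norm (g n x) powr p)) \<partial>circM)"
  proof (rule nn_integral_cong_AE)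
    show "AE x in circM. ennreal (norm (h x) powr p) = liminf (\<lambda>n. ennreal (norm (g n x) powr p))"
      using lim
    proof eventually_elim
      case (elim x)
      have "(\<lambda>n. norm (g n x) powr p) \<longlonglongrightarrow> norm (h x) powr p"
        using p by (intro tendsto_powr' tendsto_norm elim tendsto_const) auto
      then have "(\<lambda>n. ennreal (norm (g n x) powr p)) \<longlonglongrightarrow> ennreal (norm (h x) powr p)" by (rule tendsto_ennrealI)
      from lim_imp_Liminf[OF _ this] show ?case by simp
    qed
  qed
  also have "\<dots> \<le> liminf (\<lambda>n. \<integral>\<^sup>+x. ennreal (norm (g n x) powr p) \<partial>circM)"
    using m by (intro nn_integral_liminf) auto
  also have "\<dots> \<le> ennreal B"
  proof (rule Liminf_le)
    show "\<forall>\<^sub>F n in sequentially. (\<integral>\<^sup>+x. ennreal (norm (g n x) powr p) \<partial>circM) \<le> ennreal B"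
      unfolding eventually_sequentially
      using i B by (intro exI[of _ N]) (auto simp: nn_integral_eq_integral intro!: ennreal_leI)
  qed simp
  finally have le: "(\<integral>\<^sup>+x. ennreal (norm (h x) powr p) \<partial>circM) \<le> ennreal B" .
  show I: "integrable circM (\<lambda>x. norm (h x) powr p)"
    using m le by (intro integrableI_bounded) (auto simp: less_top[symmetric] top_unique)
  show "(LINT x|circM. norm (h x) powr p) \<le> B"
    using le B0 nn_integral_eq_integral[OF I] by (auto simp: ennreal_le_iff)
qed

section \<open>Lower bounds by duality\<close>

text \<open>Young's inequality in place of Hoelder's: \<open>c k\<close> behaves like the \<open>k\<close>-th coefficient, with respect to
  \<open>cos (k x + \<xi>)\<close>, of a function whose \<open>p\<close>-th power has integral at most \<open>X\<close>. Free choice of \<open>\<mu>\<close> replaces homogeneity.\<close>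
definition dual_bound :: "real \<Rightarrow> real \<Rightarrow> real \<Rightarrow> (nat \<Rightarrow> complex) \<Rightarrow> nat set \<Rightarrow> bool" where
  "dual_bound p X \<xi> c S \<longleftrightarrow> (\<forall>K \<gamma> \<mu>. finite K \<and> K \<subseteq> S \<and> 0 < \<mu> \<longrightarrow>
     Re (\<Sum>k\<in>K. \<gamma> k * c k) \<le> \<mu> powr p * X + \<mu> powr (- (p / (p - 1))) *
       (LINT x|circM. norm (\<Sum>k\<in>K. \<gamma> k * of_real (cos (real k * x + \<xi>))) powr (p / (p - 1))))"

lemma integrable_of_powr:
  fixes \<Phi> :: "real \<Rightarrow> complex"
  assumes "1 \<le> p" "\<Phi> \<in> borel_measurable circM" "integrable circM (\<lambda>x. norm (\<Phi> x) powr p)"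
  shows "integrable circM \<Phi>"
proof (rule Bochner_Integration.integrable_bound)
  show "integrable circM (\<lambda>x. 1 + norm (\<Phi> x) powr p)"
    by (rule Bochner_Integration.integrable_add[OF integrable_circM_bounded[where B = 1] assms(3)]) auto
  have "s \<le> 1 + s powr p" if "0 \<le> s" for s :: real
  proof (cases "s \<le> 1")
    case False
    then have "s powr 1 \<le> s powr p" using assms(1) by (intro powr_mono) auto
    then show ?thesis using False by simp
  qed (simp add: add_increasing2)
  then show "AE x in circM. norm (\<Phi> x) \<le> norm (1 + norm (\<Phi> x) powr p)"
    by (intro AE_I2) (simp add: abs_of_nonneg)
qed (rule assms)

text \<open>The last identity is the balance of the powers of 2 by which the Hardy bound for the
  test sum in \<open>dual_lower_bound_good\<close> reproduces the sum that is to be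
  estimated.\<close>

lemma conjugate_exponents:
  fixes p :: real assumes "1 < p"
  defines "q \<equiv> p / (p - 1)"
  shows "1 < q" "1 / p + 1 / q = 1" "(p - 1) * q = p" "(q - 1) + (p - 2) * q = p - 1"
proof -
  show "1 < q" "1 / p + 1 / q = 1" "(p - 1) * q = p" using assms by (auto simp: q_def field_simps)
  have "(p - 1) * ((q - 1) + (p - 2) * q) = (p - 1) * (p - 1)"
    using \<open>(p - 1) * q = p\<close> by (simp add: algebra_simps)
  then show "(q - 1) + (p - 2) * q = p - 1" using assms by simp
qed

text \<open>Integrating \<open>\<Phi>\<close> against the test polynomial gives \<open>pi\<close>
  times the left-hand side; Young's inequality is applied to the factors
  \<open>\<mu> * norm (\<Phi> x)\<close> and \<open>norm (g x) / \<mu>\<close>. The constants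
  \<open>1 / p\<close>, \<open>1 / q\<close> and \<open>1 / pi\<close> are all below 1 and are
  dropped.\<close>

lemma dual_boundI:
  fixes \<Phi> :: "real \<Rightarrow> complex"
  assumes p: "1 < p" and \<Phi>: "\<Phi> \<in> borel_measurable circM" "integrable circM (\<lambda>x. norm (\<Phi> x) powr p)"
    and X: "(LINT x|circM. norm (\<Phi> x) powr p) \<le> X"
    and c: "\<And>k. k \<in> S \<Longrightarrow> (LINT x|circM. \<Phi> x * of_real (cos (real k * x + \<xi>))) = of_real pi * c k"
  shows "dual_bound p X \<xi> c S"
  unfolding dual_bound_def
proof (intro allI impI; elim conjE)
  fix K \<gamma> and \<mu> :: real
  assume K: "finite K" "K \<subseteq> S" and \<mu>: "0 < \<mu>"
  define q where "q = p / (p - 1)"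
  note q = conjugate_exponents[OF p, folded q_def]
  define g where "g x = (\<Sum>k\<in>K. \<gamma> k * complex_of_real (cos (real k * x + \<xi>)))" for x
  have gm: "g \<in> borel_measurable borel" unfolding g_def by measurable
  have gb: "norm (g x) \<le> (\<Sum>k\<in>K. norm (\<gamma> k))" for x
    unfolding g_def by (intro sum_norm_le) (auto simp: norm_mult intro: mult_left_le)
  have \<Phi>i: "integrable circM \<Phi>" using p \<Phi> by (intro integrable_of_powr[of p]) auto
  have gi: "integrable circM (\<lambda>x. norm (g x) powr q)"
    using gb q(1) gm by (intro integrable_circM_bounded[where B = "(\<Sum>k\<in>K. norm (\<gamma> k)) powr q"] borel_measurable_circM)
      (auto intro!: powr_mono2)
  let ?R = "\<lambda>x. \<mu> powr p * norm (\<Phi> x) powr p + \<mu> powr (- q) * norm (g x) powr q"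
  have Ri: "integrable circM ?R" using gi \<Phi> by (intro Bochner_Integration.integrable_add integrable_mult_right) auto
  have R0: "0 \<le> (LINT x|circM. ?R x)" by (intro integral_nonneg_AE) auto
  have "of_real pi * (\<Sum>k\<in>K. \<gamma> k * c k) = (\<Sum>k\<in>K. \<gamma> k * (LINT x|circM. \<Phi> x * of_real (cos (real k * x + \<xi>))))"
    using K c by (simp add: sum_distrib_left subset_iff mult_ac)
  also have "\<dots> = (LINT x|circM. (\<Sum>k\<in>K. \<gamma> k * (\<Phi> x * of_real (cos (real k * x + \<xi>)))))"
    using integrable_circM_cos[OF \<Phi>i] by (simp add: Bochner_Integration.integral_sum)
  also have "\<dots> = (LINT x|circM. \<Phi> x * g x)"
    unfolding g_def by (simp add: sum_distrib_left mult_ac)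
  finally have eq: "of_real pi * (\<Sum>k\<in>K. \<gamma> k * c k) = (LINT x|circM. \<Phi> x * g x)" .
  have "pi * Re (\<Sum>k\<in>K. \<gamma> k * c k) = Re (of_real pi * (\<Sum>k\<in>K. \<gamma> k * c k))" by simp
  also have "\<dots> \<le> norm (LINT x|circM. \<Phi> x * g x)" unfolding eq by (rule complex_Re_le_cmod)
  also have "\<dots> \<le> (LINT x|circM. ?R x)"
  proof (rule Bochner_Integration.integral_norm_bound_integral[OF _ Ri])
    show "integrable circM (\<lambda>x. \<Phi> x * g x)"
      using \<Phi>i gm gb by (intro integrable_circM_mult_bounded borel_measurable_circM) auto
    fix x
    have "norm (\<Phi> x * g x) = (\<mu> * norm (\<Phi> x)) * (norm (g x) / \<mu>)" using \<mu> by (simp add: norm_mult)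
    also have "\<dots> \<le> (\<mu> * norm (\<Phi> x)) powr p / p + (norm (g x) / \<mu>) powr q / q"
      using p q \<mu> by (intro Youngs_inequality) auto
    also have "\<dots> \<le> (\<mu> * norm (\<Phi> x)) powr p + (norm (g x) / \<mu>) powr q"
    proof (intro add_mono)
      have "s / r \<le> s" if "0 \<le> s" "1 < r" for s r :: real
        using mult_left_mono[of 1 r s] that by (simp add: divide_le_eq)
      then show "(\<mu> * norm (\<Phi> x)) powr p / p \<le> (\<mu> * norm (\<Phi> x)) powr p"
        "(norm (g x) / \<mu>) powr q / q \<le> (norm (g x) / \<mu>) powr q"
        using p q by auto
    qed
    also have "\<dots> = ?R x" using \<mu> by (simp add: powr_mult powr_divide powr_minus field_simps)
    finally show "norm (\<Phi> x * g x) \<le> ?R x" .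
  qed
  finally have "pi * Re (\<Sum>k\<in>K. \<gamma> k * c k) \<le> (LINT x|circM. ?R x)" .
  moreover have "y \<le> R" if "pi * y \<le> R" "0 \<le> R" for y R :: real
    using pi_ge_two that mult_right_mono[of 1 pi y] by (cases "0 \<le> y") auto
  ultimately have "Re (\<Sum>k\<in>K. \<gamma> k * c k) \<le> (LINT x|circM. ?R x)"
    using R0 by blast
  also have "\<dots> = \<mu> powr p * (LINT x|circM. norm (\<Phi> x) powr p) + \<mu> powr (- q) * (LINT x|circM. norm (g x) powr q)"
    using gi \<Phi> by simp
  also have "\<dots> \<le> \<mu> powr p * X + \<mu> powr (- q) * (LINT x|circM. norm (g x) powr q)"
    using X by (intro add_right_mono mult_left_mono) auto
  finally show "Re (\<Sum>k\<in>K. \<gamma> k * c k) \<le> \<mu> powr p * X + \<mu> powr (- (p / (p - 1))) *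
       (LINT x|circM. norm (\<Sum>k\<in>K. \<gamma> k * of_real (cos (real k * x + \<xi>))) powr (p / (p - 1)))"
    by (simp add: q_def g_def)
qed

text \<open>Rests on the identity |u| (sgn u - sgn v) = (u - v) + (|v| - |u|) sgn v. It transfers
  the variation of the coefficients to their signs.\<close>

lemma norm_sgn_diff_le:
  fixes u v :: complex
  assumes "u \<noteq> 0"
  shows "norm (sgn u - sgn v) \<le> 2 * norm (u - v) / norm u"
proof (cases "v = 0")
  case True
  then show ?thesis using assms by (simp add: norm_sgn)
next
  case False
  have "of_real (norm u) * (sgn u - sgn v) = (u - v) + of_real (norm v - norm u) * sgn v"
    using assms False by (simp add: sgn_eq field_simps)
  then have "norm u * norm (sgn u - sgn v) = norm ((u - v) + of_real (norm v - norm u) * sgn v)"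
    by (metis norm_mult norm_of_real abs_norm_cancel)
  also have "\<dots> \<le> norm (u - v) + \<bar>norm v - norm u\<bar> * norm (sgn v)"
    by (metis norm_mult norm_of_real norm_triangle_ineq)
  also have "\<dots> \<le> norm (u - v) + norm (u - v)"
    using False norm_triangle_ineq3[of v u] by (simp add: norm_sgn norm_minus_commute)
  finally show ?thesis using assms by (simp add: field_simps)
qed

text \<open>The half-open dyadic block ending at \<open>2 ^ j\<close>; for \<open>j = 0\<close> it is \<open>{1}\<close>, as \<open>1 div 2 = 0\<close>.\<close>
abbreviation dyblock :: "nat \<Rightarrow> nat set" where
  "dyblock j \<equiv> {2 ^ j div 2<..2 ^ j}"

text \<open>The growth bound read backwards: because the block ends at \<open>2 ^ j\<close>, every
  coefficient in it is bounded below by the one at its end.\<close>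

lemma dyblock_norm_ge:
  assumes "GM_with C d" "0 \<le> C" "k \<in> dyblock j"
  shows "norm (d (2 ^ j)) \<le> (1 + C) * norm (d k)"
proof -
  have "1 \<le> k" "k \<le> 2 ^ j" "2 ^ j \<le> 2 * k + 1" using assms(3) by auto
  then show ?thesis using assms by (intro GM_with_norm_le) auto
qed

lemma dyblock_card: "2 ^ j \<le> 2 * real (card (dyblock j))"
proof -
  have "(2::nat) ^ j \<le> 2 * (2 ^ j - 2 ^ j div 2)" by linarith
  then have "real (2 ^ j) \<le> real (2 * (2 ^ j - 2 ^ j div 2))" by (rule of_nat_mono)
  then show ?thesis by simp
qed

lemma dyblock_half: "k \<in> dyblock j \<Longrightarrow> 2 ^ j / 2 \<le> real k"
proof -
  assume "k \<in> dyblock j"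
  then have "2 ^ j \<le> 2 * k" by auto
  then have "real (2 ^ j) \<le> real (2 * k)" by (rule of_nat_mono)
  then show ?thesis by simp
qed

text \<open>The variation of the signs is at most that of \<open>d\<close>, divided by a lower bound
  for \<open>norm (d k)\<close> on the block. The GM condition at \<open>2 ^ (j - 1)\<close> bounds
  the variation of \<open>d\<close> by \<open>C * norm (d (2 ^ (j - 1)))\<close>, and
  \<open>good\<close> converts this into a multiple of \<open>norm (d (2 ^ j))\<close>, which
  cancels.\<close>

lemma dyblock_sgn_sum_bound:
  assumes GM: "GM_with C d" "0 \<le> C" and nz: "d (2 ^ j) \<noteq> 0"
    and good: "j = 0 \<or> norm (d (2 ^ (j - 1))) \<le> \<kappa> * norm (d (2 ^ j))" and \<kappa>: "0 \<le> \<kappa>"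
  shows "norm (\<Sum>k\<in>dyblock j. cnj (sgn (d k)) * of_real (cos (real k * x + \<xi>))) \<le> (1 + 2 * (1 + C) * C * \<kappa>) * dk j x"
proof -
  let ?s = "2 ^ j div 2 + 1 :: nat"
  have st: "?s \<le> 2 ^ j" by (cases j) auto
  have B: "dyblock j = {?s..2 ^ j}" by auto
  have var: "(\<Sum>k=?s..<2 ^ j. norm (cnj (sgn (d k)) - cnj (sgn (d (Suc k))))) \<le> 2 * (1 + C) * C * \<kappa>"
  proof (cases "j = 0")
    case True
    then show ?thesis using GM \<kappa> by simp
  next
    case False
    then obtain i where i: "j = Suc i" by (cases j) auto
    have "(\<Sum>k=?s..<2 ^ j. norm (cnj (sgn (d k)) - cnj (sgn (d (Suc k)))))
        \<le> (\<Sum>k=?s..<2 ^ j. 2 * (1 + C) / norm (d (2 ^ j)) * norm (d k - d (Suc k)))"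
    proof (rule sum_mono)
      fix k assume k: "k \<in> {?s..<2 ^ j}"
      then have le: "norm (d (2 ^ j)) \<le> (1 + C) * norm (d k)"
        using GM by (intro dyblock_norm_ge) auto
      then have dk: "d k \<noteq> 0" using nz by auto
      have "norm (cnj (sgn (d k)) - cnj (sgn (d (Suc k)))) = norm (sgn (d k) - sgn (d (Suc k)))"
        by (metis complex_cnj_diff complex_mod_cnj)
      also have "\<dots> \<le> 2 * norm (d k - d (Suc k)) / norm (d k)" by (rule norm_sgn_diff_le[OF dk])
      also have "\<dots> \<le> 2 * (1 + C) / norm (d (2 ^ j)) * norm (d k - d (Suc k))"
      proof -
        have "1 / norm (d k) \<le> (1 + C) / norm (d (2 ^ j))" using le dk nz by (simp add: field_simps)
        then have "2 * norm (d k - d (Suc k)) * (1 / norm (d k)) \<le> 2 * norm (d k - d (Suc k)) * ((1 + C) / norm (d (2 ^ j)))"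
          by (rule mult_left_mono) simp
        also have "\<dots> = 2 * (1 + C) / norm (d (2 ^ j)) * norm (d k - d (Suc k))" by simp
        finally show ?thesis by simp
      qed
      finally show "norm (cnj (sgn (d k)) - cnj (sgn (d (Suc k)))) \<le> 2 * (1 + C) / norm (d (2 ^ j)) * norm (d k - d (Suc k))" .
    qed
    also have "\<dots> = 2 * (1 + C) / norm (d (2 ^ j)) * (\<Sum>k=?s..<2 ^ j. norm (d k - d (Suc k)))"
      by (simp only: sum_distrib_left)
    also have "\<dots> \<le> 2 * (1 + C) / norm (d (2 ^ j)) * (C * norm (d (2 ^ i)))"
      using GM by (intro mult_left_mono GM_with_variation) (auto simp: i)
    also have "\<dots> \<le> 2 * (1 + C) / norm (d (2 ^ j)) * (C * (\<kappa> * norm (d (2 ^ j))))"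
      using GM good i by (intro mult_left_mono) auto
    also have "\<dots> = 2 * (1 + C) * C * \<kappa>" using nz by simp
    finally show ?thesis .
  qed
  have "norm (\<Sum>k=?s..2 ^ j. cnj (sgn (d k)) * complex_of_real (cos (real k * x + \<xi>)))
      \<le> dk j x * (norm (cnj (sgn (d ?s))) + (\<Sum>k=?s..<2 ^ j. norm (cnj (sgn (d k)) - cnj (sgn (d (Suc k))))))"
  proof (rule sum_by_parts_bound[OF st])
    fix r assume r: "?s \<le> r" "r \<le> 2 ^ j"
    have "norm (\<Sum>k=r..2 ^ j. complex_of_real (cos (real k * x + \<xi>))) = \<bar>\<Sum>k=r..2 ^ j. cos (real k * x + \<xi>)\<bar>"
      by (metis norm_of_real of_real_sum)
    also have "\<dots> \<le> dk j x" using r by (intro cos_sum_bound) auto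
    finally show "norm (\<Sum>k=r..2 ^ j. complex_of_real (cos (real k * x + \<xi>))) \<le> dk j x" .
  qed
  also have "\<dots> \<le> dk j x * (1 + 2 * (1 + C) * C * \<kappa>)"
    using var by (intro mult_left_mono add_mono dk_nonneg) (auto simp: norm_sgn)
  finally show ?thesis unfolding B by (simp add: mult.commute)
qed

text \<open>Test against \<open>\<Sum>j\<in>G. w j * (\<Sum>k\<in>dyblock j. cnj (sgn (d k)) * cos (k x + \<xi>))\<close>: on blocks where \<open>d\<close> does
  not drop by more than \<open>\<kappa>\<close> the signs have bounded variation.\<close>
lemma dual_lower_bound_good:
  fixes p C \<kappa> :: real
  assumes p: "1 < p" and C: "0 \<le> C" and \<kappa>: "0 \<le> \<kappa>"
  obtains K where "K > 0"
    "\<And>X \<xi> \<rho> l d S G. GM_with C d \<Longrightarrow> dual_bound p X \<xi> (\<lambda>k. of_real (\<rho> k) * d k) S \<Longrightarrow> finite G \<Longrightarrow>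
       (\<And>j. j \<in> G \<Longrightarrow> dyblock j \<subseteq> S) \<Longrightarrow> (\<And>j. j \<in> G \<Longrightarrow> 0 \<le> l j) \<Longrightarrow>
       (\<And>j k. j \<in> G \<Longrightarrow> k \<in> dyblock j \<Longrightarrow> l j \<le> \<rho> k) \<Longrightarrow>
       (\<And>j. j \<in> G \<Longrightarrow> j = 0 \<or> norm (d (2 ^ (j - 1))) \<le> \<kappa> * norm (d (2 ^ j))) \<Longrightarrow>
       (\<Sum>j\<in>G. 2 powr (real j * (p - 1)) * (l j * norm (d (2 ^ j))) powr p) \<le> K * X"
proof -
  define q where "q = p / (p - 1)"
  note q = conjugate_exponents[OF p, folded q_def]
  obtain K1 where K1: "K1 > 0"
    "\<And>J D. finite J \<Longrightarrow> (\<And>j. j \<in> J \<Longrightarrow> 0 \<le> D j) \<Longrightarrow>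
       (LINT x|circM. (\<Sum>j\<in>J. D j * dk j x) powr q) \<le> K1 * (\<Sum>j\<in>J. 2 powr (real j * (q - 1)) * D j powr q)"
    using dk_hardy[OF q(1)] by blast
  define V where "V = 1 + 2 * (1 + C) * C * \<kappa>"
  have V: "V > 0" using C \<kappa> unfolding V_def by (intro add_pos_nonneg) auto
  \<comment> \<open>Makes the dual term equal to \<open>T / (4 * (1 + C))\<close>, half of the lower
    bound \<open>T / (2 * (1 + C))\<close> for the pairing, so that it can be absorbed.\<close>
  define \<mu> where "\<mu> = (4 * (1 + C) * (V powr q * K1)) powr (1 / q)"
  have \<mu>: "\<mu> > 0" using C V K1 by (simp add: \<mu>_def)
  have \<mu>q: "\<mu> powr (- q) * (V powr q * K1) = 1 / (4 * (1 + C))"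
  proof -
    define W where "W = 4 * (1 + C) * (V powr q * K1)"
    have W: "W > 0" using C V K1 by (simp add: W_def)
    have "\<mu> = W powr (1 / q)" by (simp only: \<mu>_def W_def)
    then have "\<mu> powr (- q) = 1 / W" using W q(1) by (simp add: powr_powr powr_minus_divide)
    moreover have "V powr q * K1 > 0" using V K1 by simp
    moreover have "1 / (4 * (1 + C) * Z) * Z = 1 / (4 * (1 + C))" if "Z > 0" for Z :: real
      using that by simp
    ultimately show ?thesis unfolding W_def by metis
  qed
  define K where "K = 4 * (1 + C) * \<mu> powr p"
  show ?thesis
  proof (rule that[of K])
    show "K > 0" using C \<mu> by (simp add: K_def)
    fix X \<xi> and \<rho> l :: "nat \<Rightarrow> real" and d S G
    assume GM: "GM_with C d" and db: "dual_bound p X \<xi> (\<lambda>k. of_real (\<rho> k) * d k) S" and G: "finite G"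
      and GS: "\<And>j. j \<in> G \<Longrightarrow> dyblock j \<subseteq> S" and l0: "\<And>j. j \<in> G \<Longrightarrow> 0 \<le> l j"
      and l: "\<And>j k. j \<in> G \<Longrightarrow> k \<in> dyblock j \<Longrightarrow> l j \<le> \<rho> k"
      and good: "\<And>j. j \<in> G \<Longrightarrow> j = 0 \<or> norm (d (2 ^ (j - 1))) \<le> \<kappa> * norm (d (2 ^ j))"
    define t where "t j = l j * norm (d (2 ^ j))" for j
    have t0: "0 \<le> t j" if "j \<in> G" for j using l0[OF that] by (simp add: t_def)
    define T where "T = (\<Sum>j\<in>G. 2 powr (real j * (p - 1)) * t j powr p)"
    \<comment> \<open>The extremal weights of duality: both \<open>w j * 2 powr real j * t j\<close>
      and \<open>2 powr (real j * (q - 1)) * w j powr q\<close> equal the \<open>j\<close>-th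
      summand of \<open>T\<close>.\<close>
    define w where "w j = 2 powr (real j * (p - 2)) * t j powr (p - 1)" for j
    have w0: "0 \<le> w j" for j by (simp add: w_def)
    define KK where "KK = (\<Union>j\<in>G. dyblock j)"
    \<comment> \<open>Summing over all blocks that contain \<open>k\<close> turns \<open>sw\<close>
      into a mere exchange of two sums.\<close>
    define \<gamma> where "\<gamma> k = (\<Sum>j\<in>G. if k \<in> dyblock j then of_real (w j) * cnj (sgn (d k)) else 0)" for k
    have sw: "(\<Sum>k\<in>KK. \<gamma> k * h k) = (\<Sum>j\<in>G. of_real (w j) * (\<Sum>k\<in>dyblock j. cnj (sgn (d k)) * h k))" for h :: "nat \<Rightarrow> complex"
    proof -
      have "(\<Sum>k\<in>KK. \<gamma> k * h k) = (\<Sum>j\<in>G. \<Sum>k\<in>KK. if k \<in> dyblock j then of_real (w j) * (cnj (sgn (d k)) * h k) else 0)"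
        unfolding \<gamma>_def sum_distrib_right by (subst sum.swap) (intro sum.cong refl, simp)
      also have "\<dots> = (\<Sum>j\<in>G. \<Sum>k\<in>dyblock j. of_real (w j) * (cnj (sgn (d k)) * h k))"
      proof (rule sum.cong[OF refl])
        fix j assume "j \<in> G"
        then have i: "KK \<inter> dyblock j = dyblock j" by (auto simp: KK_def)
        have f: "finite KK" using G by (simp add: KK_def)
        show "(\<Sum>k\<in>KK. if k \<in> dyblock j then of_real (w j) * (cnj (sgn (d k)) * h k) else 0)
            = (\<Sum>k\<in>dyblock j. of_real (w j) * (cnj (sgn (d k)) * h k))"
          by (simp only: sum.inter_restrict[OF f, symmetric] i)
      qed
      finally show ?thesis by (simp add: sum_distrib_left)
    qed
    have wt: "w j * 2 powr real j * t j = 2 powr (real j * (p - 1)) * t j powr p" if "j \<in> G" for j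
    proof (cases "t j = 0")
      case True
      then show ?thesis using p by simp
    next
      case False
      then have E1: "t j powr (p - 1) * t j = t j powr p" using t0[OF that] powr_add[of "t j" "p - 1" 1] by simp
      have E2: "2 powr (real j * (p - 2)) * 2 powr real j = 2 powr (real j * (p - 1))"
        by (simp add: powr_add[symmetric] algebra_simps)
      show ?thesis unfolding w_def E1[symmetric] E2[symmetric] by (simp only: mult_ac)
    qed
    have low: "T / (2 * (1 + C)) \<le> Re (\<Sum>k\<in>KK. \<gamma> k * (of_real (\<rho> k) * d k))"
    proof -
      have "T / (2 * (1 + C)) = (\<Sum>j\<in>G. w j * (2 ^ j / 2 * (l j * (norm (d (2 ^ j)) / (1 + C)))))"
        unfolding T_def sum_divide_distrib using wt
        by (intro sum.cong refl) (simp add: t_def powr_realpow[symmetric] field_simps)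
      also have "\<dots> \<le> (\<Sum>j\<in>G. w j * (\<Sum>k\<in>dyblock j. \<rho> k * norm (d k)))"
      proof (intro sum_mono mult_left_mono w0)
        fix j assume j: "j \<in> G"
        have "2 ^ j / 2 * (l j * (norm (d (2 ^ j)) / (1 + C))) \<le> real (card (dyblock j)) * (l j * (norm (d (2 ^ j)) / (1 + C)))"
          using dyblock_card[of j] l0[OF j] C by (intro mult_right_mono) auto
        also have "\<dots> = (\<Sum>k\<in>dyblock j. l j * (norm (d (2 ^ j)) / (1 + C)))" by simp
        also have "\<dots> \<le> (\<Sum>k\<in>dyblock j. \<rho> k * norm (d k))"
        proof (intro sum_mono mult_mono)
          fix k assume k: "k \<in> dyblock j"
          show "l j \<le> \<rho> k" by (rule l[OF j k])
          then show "0 \<le> \<rho> k" using l0[OF j] by simp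
          show "norm (d (2 ^ j)) / (1 + C) \<le> norm (d k)"
            using dyblock_norm_ge[OF GM C k] C by (simp add: field_simps)
        qed (use C in auto)
        finally show "2 ^ j / 2 * (l j * (norm (d (2 ^ j)) / (1 + C))) \<le> (\<Sum>k\<in>dyblock j. \<rho> k * norm (d k))" .
      qed
      also have "\<dots> = Re (\<Sum>k\<in>KK. \<gamma> k * (of_real (\<rho> k) * d k))"
      proof -
        have "cnj (sgn z) * (of_real r * z) = of_real (r * norm z)" for z :: complex and r :: real
          by (cases "z = 0") (simp_all add: sgn_eq complex_norm_square[symmetric] power2_eq_square mult_ac field_simps)
        then show ?thesis unfolding sw by (simp del: of_real_mult)
      qed
      finally show ?thesis .
    qed
    have up: "norm (\<Sum>k\<in>KK. \<gamma> k * of_real (cos (real k * x + \<xi>))) \<le> (\<Sum>j\<in>G. (V * w j) * dk j x)" for x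
      unfolding sw
    proof (rule sum_norm_le)
      fix j assume j: "j \<in> G"
      show "norm (of_real (w j) * (\<Sum>k\<in>dyblock j. cnj (sgn (d k)) * of_real (cos (real k * x + \<xi>)))) \<le> V * w j * dk j x"
      \<comment> \<open>If \<open>d (2 ^ j) = 0\<close> the signs on the block are not controlled,
        but then the block has weight \<open>w j = 0\<close>.\<close>
      proof (cases "d (2 ^ j) = 0")
        case True
        then have "w j = 0" using p by (simp add: w_def t_def)
        then show ?thesis by simp
      next
        case False
        have "norm (of_real (w j) * (\<Sum>k\<in>dyblock j. cnj (sgn (d k)) * complex_of_real (cos (real k * x + \<xi>))))
           \<le> w j * (V * dk j x)"
          unfolding norm_mult norm_of_real abs_of_nonneg[OF w0] V_def
          by (intro mult_left_mono dyblock_sgn_sum_bound GM C False good j \<kappa> w0)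
        then show ?thesis by (simp add: mult_ac)
      qed
    qed
    have gq: "(LINT x|circM. norm (\<Sum>k\<in>KK. \<gamma> k * of_real (cos (real k * x + \<xi>))) powr q) \<le> V powr q * K1 * T"
    proof -
      have I: "integrable circM (\<lambda>x. (\<Sum>j\<in>G. (V * w j) * dk j x) powr q)"
        using G V w0 q(1) by (intro sum_dk_powr_integrable) auto
      have "(LINT x|circM. norm (\<Sum>k\<in>KK. \<gamma> k * of_real (cos (real k * x + \<xi>))) powr q) \<le> (LINT x|circM. (\<Sum>j\<in>G. (V * w j) * dk j x) powr q)"
        using I up q(1) by (intro integral_mono') (auto intro!: powr_mono2)
      also have "\<dots> \<le> K1 * (\<Sum>j\<in>G. 2 powr (real j * (q - 1)) * (V * w j) powr q)"
        using G V w0 by (intro K1(2)) auto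
      also have "(\<Sum>j\<in>G. 2 powr (real j * (q - 1)) * (V * w j) powr q) = V powr q * T"
        unfolding T_def sum_distrib_left
      proof (intro sum.cong refl)
        fix j assume j: "j \<in> G"
        have "real j * (q - 1) + real j * (p - 2) * q = real j * ((q - 1) + (p - 2) * q)" by (simp add: algebra_simps)
        then have E: "2 powr (real j * (q - 1)) * 2 powr (real j * (p - 2) * q) = 2 powr (real j * (p - 1))"
          by (simp only: powr_add[symmetric] q(4))
        have "(V * w j) powr q = V powr q * (2 powr (real j * (p - 2) * q) * t j powr p)"
          using V w0[of j] t0[OF j] by (simp add: w_def powr_mult powr_powr q(3))
        then show "2 powr (real j * (q - 1)) * (V * w j) powr q = V powr q * (2 powr (real j * (p - 1)) * t j powr p)"
          unfolding E[symmetric] by (simp only: mult_ac)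
      qed
      finally show ?thesis by (simp add: mult_ac)
    qed
    have KK: "finite KK" "KK \<subseteq> S" using G GS by (auto simp: KK_def)
    have "Re (\<Sum>k\<in>KK. \<gamma> k * (of_real (\<rho> k) * d k)) \<le> \<mu> powr p * X + \<mu> powr (- q) *
       (LINT x|circM. norm (\<Sum>k\<in>KK. \<gamma> k * of_real (cos (real k * x + \<xi>))) powr q)"
      using db KK \<mu> unfolding dual_bound_def q_def by blast
    also have "\<dots> \<le> \<mu> powr p * X + \<mu> powr (- q) * (V powr q * K1 * T)"
      by (intro add_left_mono mult_left_mono gq) auto
    also have "\<dots> = \<mu> powr p * X + T / (4 * (1 + C))"
      using arg_cong[OF \<mu>q, of "\<lambda>z. z * T"] by (simp add: mult_ac)
    finally have "T / (2 * (1 + C)) \<le> \<mu> powr p * X + T / (4 * (1 + C))" using low by linarith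
    moreover have "T / (2 * D) = 2 * (T / (4 * D))" for D :: real by simp
    from this[of "1 + C"] have "T / (2 * (1 + C)) = 2 * (T / (4 * (1 + C)))" .
    moreover have "z \<le> M" if "y \<le> M + z" "y = 2 * z" for y z M :: real using that by linarith
    ultimately have "T / (4 * (1 + C)) \<le> \<mu> powr p * X" by blast
    then have "T \<le> \<mu> powr p * X * (4 * (1 + C))" using C by (subst (asm) pos_divide_le_eq) auto
    then have "T \<le> K * X" by (simp add: K_def mult_ac)
    then show "(\<Sum>j\<in>G. 2 powr (real j * (p - 1)) * (l j * norm (d (2 ^ j))) powr p) \<le> K * X"
      by (simp add: T_def t_def)
  qed
qed


text \<open>Across a bad block the weighted term at least halves, so the bad blocks are absorbed.\<close>
lemma dual_lower_bound:
  fixes p C r :: real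
  assumes p: "1 < p" and C: "0 \<le> C" and r: "0 < r"
  obtains K where "K > 0"
    "\<And>X \<xi> \<rho> l d S u v. GM_with C d \<Longrightarrow> dual_bound p X \<xi> (\<lambda>k. of_real (\<rho> k) * d k) S \<Longrightarrow> 0 \<le> X \<Longrightarrow>
       (\<And>j. u \<le> j \<Longrightarrow> j \<le> v \<Longrightarrow> dyblock j \<subseteq> S) \<Longrightarrow> (\<And>j. 0 \<le> l j) \<Longrightarrow> (\<And>j. l (Suc j) \<le> r * l j) \<Longrightarrow>
       (\<And>j k. u \<le> j \<Longrightarrow> j \<le> v \<Longrightarrow> k \<in> dyblock j \<Longrightarrow> l j \<le> \<rho> k) \<Longrightarrow>
       (\<Sum>j=u..v. 2 powr (real j * (p - 1)) * (l j * norm (d (2 ^ j))) powr p)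
         \<le> K * (X + (if u = 0 then 0 else 2 powr (real u * (p - 1)) * (l u * norm (d (2 ^ u))) powr p))"
proof -
  obtain K1 where K1: "K1 > 0"
    "\<And>X \<xi> \<rho> l d S G. GM_with C d \<Longrightarrow> dual_bound p X \<xi> (\<lambda>k. of_real (\<rho> k) * d k) S \<Longrightarrow> finite G \<Longrightarrow>
       (\<And>j. j \<in> G \<Longrightarrow> dyblock j \<subseteq> S) \<Longrightarrow> (\<And>j. j \<in> G \<Longrightarrow> 0 \<le> l j) \<Longrightarrow>
       (\<And>j k. j \<in> G \<Longrightarrow> k \<in> dyblock j \<Longrightarrow> l j \<le> \<rho> k) \<Longrightarrow>
       (\<And>j. j \<in> G \<Longrightarrow> j = 0 \<or> norm (d (2 ^ (j - 1))) \<le> (2 * r) * norm (d (2 ^ j))) \<Longrightarrow>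
       (\<Sum>j\<in>G. 2 powr (real j * (p - 1)) * (l j * norm (d (2 ^ j))) powr p) \<le> K1 * X"
  proof -
    have "0 \<le> 2 * r" using r by simp
    show ?thesis
    proof (rule dual_lower_bound_good[OF p C \<open>0 \<le> 2 * r\<close>], goal_cases)
      case (1 K)
      show ?case by (rule that[OF 1])
    qed
  qed
  show ?thesis
  proof (rule that[of "2 * (K1 + 1)"])
    fix X \<xi> and \<rho> l :: "nat \<Rightarrow> real" and d S u v
    assume GM: "GM_with C d" and db: "dual_bound p X \<xi> (\<lambda>k. of_real (\<rho> k) * d k) S" and X: "0 \<le> X"
      and S: "\<And>j. u \<le> j \<Longrightarrow> j \<le> v \<Longrightarrow> dyblock j \<subseteq> S" and l0: "\<And>j. 0 \<le> l j" and lr: "\<And>j. l (Suc j) \<le> r * l j"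
      and l: "\<And>j k. u \<le> j \<Longrightarrow> j \<le> v \<Longrightarrow> k \<in> dyblock j \<Longrightarrow> l j \<le> \<rho> k"
    define t where "t j = 2 powr (real j * (p - 1)) * (l j * norm (d (2 ^ j))) powr p" for j
    have t0: "0 \<le> t j" for j by (simp add: t_def)
    define good where "good j \<longleftrightarrow> j = 0 \<or> norm (d (2 ^ (j - 1))) \<le> (2 * r) * norm (d (2 ^ j))" for j
    define F where "F = (if u = 0 then 0 else t u)"
    have F0: "0 \<le> F" using t0 by (simp add: F_def)
    \<comment> \<open>Failing the threshold \<open>2 * r\<close> costs a factor 2 beyond the
      possible growth \<open>r\<close> of \<open>l\<close>. Its \<open>p\<close>-th power beats the
      growth \<open>2 powr (p - 1)\<close> of the dyadic weight and leaves exactly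
      \<open>1 / 2\<close>.\<close>
    have bad: "t (Suc i) \<le> t i / 2" if "\<not> good (Suc i)" for i
    proof -
      have "2 * r * norm (d (2 ^ Suc i)) \<le> norm (d (2 ^ i))" using that by (simp add: good_def)
      then have nd: "norm (d (2 ^ Suc i)) \<le> norm (d (2 ^ i)) / (2 * r)" using r by (simp add: field_simps)
      have "l (Suc i) * norm (d (2 ^ Suc i)) \<le> (r * l i) * (norm (d (2 ^ i)) / (2 * r))"
        using lr[of i] nd l0 r by (intro mult_mono) auto
      also have "\<dots> = (l i * norm (d (2 ^ i))) / 2" using r by simp
      finally have "(l (Suc i) * norm (d (2 ^ Suc i))) powr p \<le> ((l i * norm (d (2 ^ i))) / 2) powr p"
        using l0 p by (intro powr_mono2) auto
      also have "\<dots> = (l i * norm (d (2 ^ i))) powr p / 2 powr p" using l0 by (simp add: powr_divide)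
      finally have "t (Suc i) \<le> 2 powr (real (Suc i) * (p - 1)) * ((l i * norm (d (2 ^ i))) powr p / 2 powr p)"
        unfolding t_def by (intro mult_left_mono) auto
      also have "2 powr (real (Suc i) * (p - 1)) = 2 powr (real i * (p - 1)) * (2 powr p / 2)"
      proof -
        have "real (Suc i) * (p - 1) = real i * (p - 1) + (p - 1)" by (simp add: algebra_simps)
        then show ?thesis by (simp only: powr_add powr_diff) simp
      qed
      finally show ?thesis by (simp add: t_def)
    qed
    \<comment> \<open>A bad block is charged to its predecessor. The first block \<open>u\<close>
      has none within the sum, which is where the extra term \<open>F\<close> comes from; block 0 is
      good by definition.\<close>
    have step: "t j \<le> (if good j then t j else 0) + ((if u < j then t (j - 1) / 2 else 0) + (if j = u then F else 0))" if "u \<le> j" for j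
    proof (cases "good j")
      case True
      then show ?thesis using t0 F0 by auto
    next
      case False
      then have "j \<noteq> 0" by (auto simp: good_def)
      then show ?thesis using that False bad[of "j - 1"] by (auto simp: F_def)
    qed
    have "(\<Sum>j=u..v. t j) \<le> (\<Sum>j=u..v. if good j then t j else 0) +
        ((\<Sum>j=u..v. if u < j then t (j - 1) / 2 else 0) + (\<Sum>j=u..v. if j = u then F else 0))"
      unfolding sum.distrib[symmetric] by (intro sum_mono step) auto
    also have "(\<Sum>j=u..v. if good j then t j else 0) = (\<Sum>j\<in>{j \<in> {u..v}. good j}. t j)"
      by (rule sum.inter_filter[symmetric]) simp
    also have "\<dots> \<le> K1 * X"
      unfolding t_def using GM db S l0 l
      by (intro K1(2)) (auto simp: good_def)
    also have "(\<Sum>j=u..v. if u < j then t (j - 1) / 2 else 0) \<le> (\<Sum>j=u..v. t j) / 2"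
    proof -
      have "(\<Sum>j=u..v. if u < j then t (j - 1) / 2 else 0) = (\<Sum>j\<in>{u<..v}. t (j - 1) / 2)"
        by (subst sum.inter_filter[symmetric]) (auto intro!: sum.cong)
      also have "\<dots> = (\<Sum>i\<in>(\<lambda>j. j - 1) ` {u<..v}. t i / 2)"
        by (subst sum.reindex) (auto simp: inj_on_def)
      also have "\<dots> \<le> (\<Sum>i=u..v. t i / 2)" using t0 by (intro sum_mono2) auto
      finally show ?thesis by (simp add: sum_divide_distrib)
    qed
    also have "(\<Sum>j=u..v. if j = u then F else 0) \<le> F" using F0 by (simp add: sum.delta)
    finally have "(\<Sum>j=u..v. t j) \<le> 2 * (K1 * X + F)" by simp
    also have "\<dots> \<le> 2 * (K1 + 1) * (X + F)" using X F0 K1(1) by (simp add: algebra_simps)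
    finally show "(\<Sum>j=u..v. 2 powr (real j * (p - 1)) * (l j * norm (d (2 ^ j))) powr p)
         \<le> 2 * (K1 + 1) * (X + (if u = 0 then 0 else 2 powr (real u * (p - 1)) * (l u * norm (d (2 ^ u))) powr p))"
      unfolding t_def F_def .
  qed (use K1 in auto)
qed

section \<open>Fractional differences\<close>

text \<open>Taylor coefficients at 0 of the principal power of \<open>1 - z\<close> with exponent
  \<open>\<alpha>\<close>.\<close>

definition bcoef :: "real \<Rightarrow> nat \<Rightarrow> real" where
  "bcoef \<alpha> \<nu> = (-1) ^ \<nu> * (\<alpha> gchoose \<nu>)"

lemma bcoef_0 [simp]: "bcoef \<alpha> 0 = 1"
  by (simp add: bcoef_def)

text \<open>The coefficients are of order \<open>n powr (- (\<alpha> + 1))\<close>. Only boundedness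
  of the asymptotic ratio enters, so integer \<open>\<alpha>\<close>, where its limit is 0, needs no
  separate treatment.\<close>

lemma summable_bcoef:
  assumes "0 < \<alpha>"
  shows "summable (\<lambda>\<nu>. \<bar>bcoef \<alpha> \<nu>\<bar>)"
proof -
  have "(\<lambda>n. (\<alpha> gchoose n) / ((-1)^n / exp ((\<alpha>+1) * ln (real n)))) \<longlonglongrightarrow> inverse (Gamma (- \<alpha>))"
    using gbinomial_asymptotic[of \<alpha>] by simp
  then have "Bseq (\<lambda>n. (\<alpha> gchoose n) / ((-1)^n / exp ((\<alpha>+1) * ln (real n))))"
    by (intro convergent_imp_Bseq convergentI)
  then obtain M where M: "\<And>n. norm ((\<alpha> gchoose n) / ((-1)^n / exp ((\<alpha>+1) * ln (real n)))) \<le> M"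
    by (auto simp: Bseq_def)
  have b: "\<bar>bcoef \<alpha> n\<bar> \<le> M * real n powr (- (\<alpha> + 1))" if "n \<ge> 1" for n
  proof -
    have "\<bar>\<alpha> gchoose n\<bar> * exp ((\<alpha>+1) * ln (real n)) \<le> M"
      using M[of n] by (simp add: abs_mult power_abs)
    then have "\<bar>\<alpha> gchoose n\<bar> \<le> M / exp ((\<alpha>+1) * ln (real n))" by (simp add: pos_le_divide_eq)
    also have "\<dots> = M * real n powr (- (\<alpha> + 1))"
      unfolding powr_minus_divide using that by (simp add: powr_def)
    finally show ?thesis by (simp add: bcoef_def abs_mult power_abs)
  qed
  have S: "summable (\<lambda>n. M * real n powr (- (\<alpha> + 1)))"
    using assms by (intro summable_mult) (simp add: summable_real_powr_iff)
  show ?thesis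
    by (rule summable_comparison_test[OF exI[of _ 1] S]) (use b in \<open>simp del: One_nat_def\<close>)
qed

text \<open>Abel's limit argument: absolute convergence makes the series continuous along the radius
  up to the boundary, and the principal power is continuous there too, since \<open>1 - z\<close>
  has positive real part unless \<open>z = 1\<close>, where \<open>0 < \<alpha>\<close> makes the
  limit 0.\<close>

lemma bcoef_sums_boundary:
  fixes z :: complex
  assumes \<alpha>: "0 < \<alpha>" and z: "norm z = 1"
  shows "(\<lambda>\<nu>. of_real (bcoef \<alpha> \<nu>) * z ^ \<nu>) sums ((1 - z) powr of_real \<alpha>)"
proof -
  define P where "P r = (\<Sum>\<nu>. of_real (bcoef \<alpha> \<nu>) * (of_real r * z) ^ \<nu>)" for r :: real
  have "uniform_limit {0..1} (\<lambda>n r. \<Sum>\<nu><n. of_real (bcoef \<alpha> \<nu>) * (of_real r * z) ^ \<nu>) P sequentially"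
    unfolding P_def
  proof (rule Weierstrass_m_test[OF _ summable_bcoef[OF \<alpha>]])
    fix n and r :: real assume "r \<in> {0..1}"
    then show "norm (of_real (bcoef \<alpha> n) * (of_real r * z) ^ n) \<le> \<bar>bcoef \<alpha> n\<bar>"
      using z by (simp add: norm_mult norm_power power_mult_distrib mult_left_le power_le_one)
  qed
  then have cont: "continuous_on {0..1} P"
    by (rule uniform_limit_theorem[rotated]) (auto intro!: always_eventually continuous_intros)
  then have "(P \<longlongrightarrow> P 1) (at 1 within {0..1})"
    by (simp add: continuous_on_def)
  then have lim1: "(P \<longlongrightarrow> P 1) (at_left 1)"
    by (simp add: at_within_Icc_at_left)
  have "P r = (1 - of_real r * z) powr of_real \<alpha>" if r: "0 \<le> r" "r < 1" for r
  proof -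
    have "norm (- (of_real r * z)) < 1" using r z by (simp add: norm_mult)
    from gen_binomial_complex[OF this, of "of_real \<alpha>"]
    have "(\<lambda>n. (of_real \<alpha> gchoose n) * (- (of_real r * z)) ^ n) sums (1 - of_real r * z) powr of_real \<alpha>" by simp
    moreover have "(complex_of_real \<alpha> gchoose n) * (- (of_real r * z)) ^ n = of_real (bcoef \<alpha> n) * (of_real r * z) ^ n" for n
    proof -
      have "complex_of_real \<alpha> gchoose n = of_real (\<alpha> gchoose n)" by (simp add: gbinomial_prod_rev)
      then show ?thesis by (simp add: bcoef_def power_minus[of "of_real r * z"])
    qed
    ultimately show ?thesis unfolding P_def by (simp add: sums_iff)
  qed
  then have "\<forall>\<^sub>F r in at_left 1. P r = (1 - of_real r * z) powr of_real \<alpha>"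
    unfolding eventually_at_left_field by (intro exI[of _ 0]) auto
  then have lim2: "((\<lambda>r. (1 - of_real r * z) powr of_real \<alpha>) \<longlongrightarrow> P 1) (at_left 1)"
    using lim1 by (rule Lim_transform_eventually[rotated])
  have "((\<lambda>r. (1 - of_real r * z) powr of_real \<alpha>) \<longlongrightarrow> (1 - z) powr of_real \<alpha>) (at_left 1)"
  proof (rule tendsto_powr_complex')
    have "(Re z)\<^sup>2 + (Im z)\<^sup>2 = 1" using z by (metis cmod_power2 one_power2)
    then have "Re z = 1 \<Longrightarrow> Im z = 0" by simp
    moreover have "Re z \<le> 1" using complex_Re_le_cmod[of z] z by simp
    ultimately show "1 - z \<notin> \<real>\<^sub>\<le>\<^sub>0 \<or> 1 - z = 0 \<and> Re (of_real \<alpha>) > 0"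
      using \<alpha> by (auto simp: complex_eq_iff less_le complex_nonpos_Reals_iff)
    have "((\<lambda>r::real. 1 - complex_of_real r * z) \<longlongrightarrow> 1 - of_real 1 * z) (at_left 1)"
      by (intro tendsto_intros)
    then show "((\<lambda>r::real. 1 - complex_of_real r * z) \<longlongrightarrow> 1 - z) (at_left 1)" by simp
  qed (rule tendsto_const)
  then have P1: "P 1 = (1 - z) powr of_real \<alpha>" using lim2 tendsto_unique[OF trivial_limit_at_left_real] by blast
  have "summable (\<lambda>\<nu>. of_real (bcoef \<alpha> \<nu>) * z ^ \<nu>)"
    by (rule summable_norm_cancel) (use summable_bcoef[OF \<alpha>] z in \<open>simp add: norm_mult norm_power\<close>)
  then show ?thesis using P1 unfolding P_def by (simp add: sums_iff)
qed

text \<open>For \<open>0 < u < 2 * pi\<close> this is the polar form with argument between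
  \<open>- pi / 2\<close> and \<open>pi / 2\<close>, so the principal power can be read off.\<close>

lemma one_minus_cis: "1 - cis u = of_real (2 * sin (u / 2)) * cis ((u - pi) / 2)"
proof -
  have "cos ((u - pi) / 2) = sin (u / 2)" "sin ((u - pi) / 2) = - cos (u / 2)"
    by (simp_all add: diff_divide_distrib cos_diff sin_diff)
  moreover have "cos u = 1 - 2 * (sin (u / 2))\<^sup>2" "sin u = 2 * sin (u / 2) * cos (u / 2)"
    using cos_double_sin[of "u/2"] sin_double[of "u/2"] by simp_all
  ultimately show ?thesis by (simp add: complex_eq_iff power2_eq_square)
qed

lemma powr_polar:
  assumes "0 < r" "- pi < \<theta>" "\<theta> \<le> pi"
  shows "(of_real r * cis \<theta>) powr of_real \<alpha> = of_real (r powr \<alpha>) * cis (\<alpha> * \<theta>)"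
proof -
  define w where "w = of_real (ln r) + \<i> * complex_of_real \<theta>"
  have "of_real r * cis \<theta> = exp w"
    unfolding w_def exp_add cis_conv_exp using assms by (simp add: exp_of_real)
  moreover have "Ln (exp w) = w" using assms by (intro Ln_exp) (auto simp: w_def)
  ultimately have "(of_real r * cis \<theta>) powr of_real \<alpha> = exp (of_real \<alpha> * w)" by (simp add: powr_def)
  also have "of_real \<alpha> * w = of_real (\<alpha> * ln r) + \<i> * of_real (\<alpha> * \<theta>)" by (simp add: w_def algebra_simps)
  finally show ?thesis using assms by (simp only: exp_add exp_of_real cis_conv_exp powr_def if_False less_irrefl)
      (simp add: powr_def)
qed

text \<open>The phase is affine in \<open>u\<close>. With \<open>u = real k * h\<close> it splits
  into a translation by a multiple of \<open>h\<close> and a phase independent of \<open>k\<close>,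
  so the multiplier is in effect the real weight
  \<open>(2 * sin (u / 2)) powr \<alpha>\<close>.\<close>

lemma bcoef_cos_sums:
  assumes "0 < \<alpha>" "0 < u" "u < 2 * pi"
  shows "(\<lambda>\<nu>. bcoef \<alpha> \<nu> * cos (t + real \<nu> * u)) sums ((2 * sin (u / 2)) powr \<alpha> * cos (t - \<alpha> * (pi - u) / 2))"
proof -
  have s: "2 * sin (u / 2) > 0" using assms by (simp add: sin_gt_zero)
  have "(of_real (2 * sin (u / 2)) * cis ((u - pi) / 2)) powr of_real \<alpha> = of_real ((2 * sin (u / 2)) powr \<alpha>) * cis (\<alpha> * ((u - pi) / 2))"
    using assms pi_ge_two by (intro powr_polar s) auto
  then have e: "(1 - cis u) powr of_real \<alpha> = of_real ((2 * sin (u / 2)) powr \<alpha>) * cis (\<alpha> * (u - pi) / 2)"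
    unfolding one_minus_cis by (simp only: times_divide_eq_right)
  have "(\<lambda>\<nu>. of_real (bcoef \<alpha> \<nu>) * cis u ^ \<nu>) sums ((1 - cis u) powr of_real \<alpha>)"
    using assms by (intro bcoef_sums_boundary) auto
  then have "(\<lambda>\<nu>. Re (cis t * (of_real (bcoef \<alpha> \<nu>) * cis u ^ \<nu>))) sums Re (cis t * (of_real ((2 * sin (u / 2)) powr \<alpha>) * cis (\<alpha> * (u - pi) / 2)))"
    unfolding e by (intro sums_Re sums_mult)
  moreover have "Re (cis t * (of_real c * cis s)) = c * cos (t + s)" for c s
    by (simp add: cos_add algebra_simps)
  ultimately show ?thesis by (simp only: Complex.DeMoivre) (simp add: algebra_simps diff_divide_distrib add_divide_distrib)
qed

lemma bcoef_suminf_0: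
  assumes "0 < \<alpha>" shows "bcoef \<alpha> sums 0"
proof -
  have "(\<lambda>\<nu>. complex_of_real (bcoef \<alpha> \<nu>)) sums of_real 0"
    using bcoef_sums_boundary[OF assms, of 1] by simp
  then show ?thesis by (simp only: sums_of_real_iff)
qed

section \<open>Boundedness and Fourier coefficients of fractional differences\<close>

lemma frac_diff_bcoef: "frac_diff \<alpha> h f x = (\<Sum>\<nu>. of_real (bcoef \<alpha> \<nu>) * f (x + (\<alpha> - real \<nu>) * h))"
  by (simp add: frac_diff_def bcoef_def)

lemma Lp_iff: "f \<in> Lp p \<longleftrightarrow> (\<forall>x. f (x + 2 * pi) = f x) \<and> f \<in> borel_measurable lebesgue \<and>
    integrable circM (\<lambda>x. norm (f x) powr p)"
  by (simp add: Lp_def set_integrable_circM)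

lemma borel_measurable_circM': "f \<in> borel_measurable lebesgue \<Longrightarrow> f \<in> borel_measurable circM"
  by (rule measurable_restrict_space1)

lemma Lp_integrable:
  assumes "1 \<le> p" "f \<in> Lp p" shows "integrable circM f"
  using assms by (intro integrable_of_powr[of p]) (auto simp: Lp_iff borel_measurable_circM')

lemma Lp_shift:
  assumes "f \<in> Lp p"
  shows "(\<lambda>x. f (x + c)) \<in> Lp p"
    "(LINT x|circM. norm (f (x + c)) powr p) = (LINT x|circM. norm (f x) powr p)"
proof -
  have f: "\<And>x. f (x + 2 * pi) = f x" "f \<in> borel_measurable lebesgue" "integrable circM (\<lambda>x. norm (f x) powr p)"
    using assms by (auto simp: Lp_iff)
  have "f (x + 2 * pi + c) = f (x + c)" for x using f(1)[of "x + c"] by (simp add: add_ac)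
  then show "(\<lambda>x. f (x + c)) \<in> Lp p"
    using f circM_shift(1)[of "\<lambda>x. norm (f x) powr p" c] measurable_lebesgue_shift[OF f(2), of c] by (simp add: Lp_iff)
  show "(LINT x|circM. norm (f (x + c)) powr p) = (LINT x|circM. norm (f x) powr p)"
    using f circM_shift(2)[of "\<lambda>x. norm (f x) powr p" c] by simp
qed

text \<open>By Tonelli and translation invariance the series of norms has a finite integral. Almost
  everywhere the \<open>suminf\<close> in \<open>frac_diff\<close> is therefore a genuine
  sum.\<close>

lemma frac_diff_summable_AE:
  assumes \<alpha>: "0 < \<alpha>" and f: "f \<in> Lp 1"
  shows "AE x in circM. summable (\<lambda>\<nu>. norm (of_real (bcoef \<alpha> \<nu>) * f (x + (\<alpha> - real \<nu>) * h)))"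
proof -
  let ?g = "\<lambda>\<nu> x. norm (complex_of_real (bcoef \<alpha> \<nu>) * f (x + (\<alpha> - real \<nu>) * h))"
  have m: "(\<lambda>x. f (x + c)) \<in> borel_measurable circM" for c
    using f by (intro borel_measurable_circM' measurable_lebesgue_shift) (simp add: Lp_iff)
  have i: "integrable circM (\<lambda>x. norm (f (x + c)))" for c
    using Lp_integrable[OF order_refl Lp_shift(1)[OF f]] by (rule integrable_norm)
  have v: "(LINT x|circM. norm (f (x + c))) = (LINT x|circM. norm (f x))" for c
    using Lp_shift(2)[OF f, of c] by simp
  have "(\<integral>\<^sup>+x. (\<Sum>\<nu>. ennreal (?g \<nu> x)) \<partial>circM) = (\<Sum>\<nu>. \<integral>\<^sup>+x. ennreal (?g \<nu> x) \<partial>circM)"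
    using m by (intro nn_integral_suminf) measurable
  also have "\<dots> = (\<Sum>\<nu>. ennreal (\<bar>bcoef \<alpha> \<nu>\<bar> * (LINT x|circM. norm (f x))))"
    using i v by (subst nn_integral_eq_integral) (auto simp: norm_mult)
  also have "\<dots> < \<infinity>"
    using summable_bcoef[OF \<alpha>] by (subst suminf_ennreal2) (auto intro!: mult_nonneg_nonneg integral_nonneg_AE summable_mult2)
  finally have "AE x in circM. (\<Sum>\<nu>. ennreal (?g \<nu> x)) \<noteq> \<infinity>"
    using m by (intro nn_integral_PInf_AE) (measurable, auto)
  then show ?thesis
    by eventually_elim (auto intro!: summable_suminf_not_top)
qed


definition Bsum :: "real \<Rightarrow> real" where
  "Bsum \<alpha> = (\<Sum>\<nu>. \<bar>bcoef \<alpha> \<nu>\<bar>)"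

lemma Bsum_ge_1: "0 < \<alpha> \<Longrightarrow> 1 \<le> Bsum \<alpha>"
  using sum_le_suminf[OF summable_bcoef, of \<alpha> "{0}"] by (simp add: Bsum_def)

lemma frac_diff_periodic:
  assumes "\<And>x. f (x + 2 * pi) = f x"
  shows "frac_diff \<alpha> h f (x + 2 * pi) = frac_diff \<alpha> h f x"
proof -
  have "f (x + 2 * pi + c) = f (x + c)" for c using assms[of "x + c"] by (simp add: add_ac)
  then show ?thesis by (simp add: frac_diff_def)
qed

lemma frac_diff_measurable:
  assumes "f \<in> borel_measurable lebesgue"
  shows "frac_diff \<alpha> h f \<in> borel_measurable lebesgue"
proof -
  have [measurable]: "(\<lambda>x. f (x + c)) \<in> borel_measurable lebesgue" for c
    using assms by (rule measurable_lebesgue_shift)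
  show ?thesis unfolding frac_diff_bcoef[abs_def] by (rule borel_measurable_suminf) measurable
qed

lemma Lp_subset_L1: "1 \<le> p \<Longrightarrow> f \<in> Lp p \<Longrightarrow> f \<in> Lp 1"
proof -
  assume p: "1 \<le> p" and f: "f \<in> Lp p"
  have "integrable circM (\<lambda>x. norm (f x) powr 1)" using Lp_integrable[OF p f] by simp
  then show ?thesis using f unfolding Lp_iff by blast
qed

text \<open>For partial sums the bound is Jensen's inequality with weights
  \<open>\<bar>bcoef \<alpha> \<nu>\<bar>\<close> and translation invariance; Fatou's lemma passes
  to the limit.\<close>

lemma frac_diff_Lp:
  assumes \<alpha>: "0 < \<alpha>" and p: "1 \<le> p" and f: "f \<in> Lp p"
  shows "frac_diff \<alpha> h f \<in> Lp p"
    "(LINT x|circM. norm (frac_diff \<alpha> h f x) powr p) \<le> Bsum \<alpha> powr p * (LINT x|circM. norm (f x) powr p)"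
proof -
  define T where "T \<nu> x = f (x + (\<alpha> - real \<nu>) * h)" for \<nu> x
  define g where "g n x = (\<Sum>\<nu><n. of_real (bcoef \<alpha> \<nu>) * T \<nu> x)" for n x
  have Tm: "T \<nu> \<in> borel_measurable circM" for \<nu>
    unfolding T_def using f by (intro borel_measurable_circM' measurable_lebesgue_shift) (simp add: Lp_iff)
  have Ti: "integrable circM (\<lambda>x. norm (T \<nu> x) powr p)" for \<nu>
    unfolding T_def using Lp_shift(1)[OF f] by (simp add: Lp_iff)
  have Tv: "(LINT x|circM. norm (T \<nu> x) powr p) = (LINT x|circM. norm (f x) powr p)" for \<nu>
    unfolding T_def by (rule Lp_shift(2)[OF f])
  have I0: "0 \<le> (LINT x|circM. norm (f x) powr p)" by (intro integral_nonneg_AE) auto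
  have Bn: "(\<Sum>\<nu><n. \<bar>bcoef \<alpha> \<nu>\<bar>) \<le> Bsum \<alpha>" for n
    unfolding Bsum_def using summable_bcoef[OF \<alpha>] by (intro sum_le_suminf) auto
  have gm: "g n \<in> borel_measurable circM" for n unfolding g_def using Tm by measurable
  have fm: "frac_diff \<alpha> h f \<in> borel_measurable lebesgue" using f by (intro frac_diff_measurable) (simp add: Lp_iff)
  have lim: "AE x in circM. (\<lambda>n. g n x) \<longlonglongrightarrow> frac_diff \<alpha> h f x"
    using frac_diff_summable_AE[OF \<alpha> Lp_subset_L1[OF p f], of h]
  proof eventually_elim
    case (elim x)
    then show ?case unfolding g_def T_def frac_diff_bcoef by (rule summable_LIMSEQ[OF summable_norm_cancel])
  qed
  have pt: "norm (g n x) powr p \<le> Bsum \<alpha> powr (p - 1) * (\<Sum>\<nu><n. \<bar>bcoef \<alpha> \<nu>\<bar> * norm (T \<nu> x) powr p)" for n x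
  proof -
    have "norm (g n x) \<le> (\<Sum>\<nu><n. \<bar>bcoef \<alpha> \<nu>\<bar> * norm (T \<nu> x))"
      unfolding g_def by (intro sum_norm_le) (simp add: norm_mult)
    then have "norm (g n x) powr p \<le> (\<Sum>\<nu><n. \<bar>bcoef \<alpha> \<nu>\<bar> * norm (T \<nu> x)) powr p"
      using p by (intro powr_mono2) auto
    also have "\<dots> \<le> (\<Sum>\<nu><n. \<bar>bcoef \<alpha> \<nu>\<bar>) powr (p - 1) * (\<Sum>\<nu><n. \<bar>bcoef \<alpha> \<nu>\<bar> * norm (T \<nu> x) powr p)"
      using p by (intro weighted_sum_powr_le) auto
    also have "\<dots> \<le> Bsum \<alpha> powr (p - 1) * (\<Sum>\<nu><n. \<bar>bcoef \<alpha> \<nu>\<bar> * norm (T \<nu> x) powr p)"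
      using p Bn by (intro mult_right_mono powr_mono2) (auto intro!: sum_nonneg)
    finally show ?thesis .
  qed
  have Ri: "integrable circM (\<lambda>x. Bsum \<alpha> powr (p - 1) * (\<Sum>\<nu><n. \<bar>bcoef \<alpha> \<nu>\<bar> * norm (T \<nu> x) powr p))" for n
    using Ti by (intro integrable_mult_right Bochner_Integration.integrable_sum) auto
  have gi: "integrable circM (\<lambda>x. norm (g n x) powr p)" for n
  proof (rule Bochner_Integration.integrable_bound[OF Ri[of n]])
    show "(\<lambda>x. norm (g n x) powr p) \<in> borel_measurable circM" using gm[of n] by measurable
    show "AE x in circM. norm (norm (g n x) powr p) \<le> norm (Bsum \<alpha> powr (p - 1) * (\<Sum>\<nu><n. \<bar>bcoef \<alpha> \<nu>\<bar> * norm (T \<nu> x) powr p))"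
      using pt by (intro AE_I2) (auto intro: order_trans[OF _ abs_ge_self])
  qed
  have gB: "(LINT x|circM. norm (g n x) powr p) \<le> Bsum \<alpha> powr p * (LINT x|circM. norm (f x) powr p)" for n
  proof -
    have "(LINT x|circM. norm (g n x) powr p) \<le> (LINT x|circM. Bsum \<alpha> powr (p - 1) * (\<Sum>\<nu><n. \<bar>bcoef \<alpha> \<nu>\<bar> * norm (T \<nu> x) powr p))"
      by (intro integral_mono gi Ri pt)
    also have "\<dots> = Bsum \<alpha> powr (p - 1) * ((\<Sum>\<nu><n. \<bar>bcoef \<alpha> \<nu>\<bar>) * (LINT x|circM. norm (f x) powr p))"
      using Ti Tv by (simp add: Bochner_Integration.integral_sum sum_distrib_right)
    also have "\<dots> \<le> Bsum \<alpha> powr (p - 1) * (Bsum \<alpha> * (LINT x|circM. norm (f x) powr p))"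
      using Bn I0 by (intro mult_left_mono mult_right_mono) auto
    also have "\<dots> = Bsum \<alpha> powr p * (LINT x|circM. norm (f x) powr p)"
      using Bsum_ge_1[OF \<alpha>] by (simp add: powr_diff)
    finally show ?thesis .
  qed
  have p0: "0 < p" using p by simp
  note L = Lp_bound_AE_limit[OF lim p0 gm borel_measurable_circM'[OF fm] gi gB]
  show "frac_diff \<alpha> h f \<in> Lp p"
    using f fm L(1) frac_diff_periodic[of f \<alpha> h] by (simp add: Lp_iff)
  show "(LINT x|circM. norm (frac_diff \<alpha> h f x) powr p) \<le> Bsum \<alpha> powr p * (LINT x|circM. norm (f x) powr p)"
    by (rule L(2))
qed

text \<open>Termwise integration, with each translation moved into the phase of the cosine. There is
  no restriction on \<open>real k * h\<close>, which is essential for the high frequencies.\<close>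

lemma frac_diff_coeff_sums:
  assumes \<alpha>: "0 < \<alpha>" and f: "f \<in> Lp 1"
  shows "(\<lambda>\<nu>. of_real (bcoef \<alpha> \<nu>) * (LINT x|circM. f x * of_real (cos (real k * x + (\<xi> - real k * \<alpha> * h + real \<nu> * (real k * h))))))
     sums (LINT x|circM. frac_diff \<alpha> h f x * of_real (cos (real k * x + \<xi>)))"
proof -
  define T where "T \<nu> x = of_real (bcoef \<alpha> \<nu>) * f (x + (\<alpha> - real \<nu>) * h)" for \<nu> x
  have fi: "integrable circM f" using f by (intro Lp_integrable) auto
  have Ti: "integrable circM (T \<nu>)" for \<nu>
    unfolding T_def using Lp_integrable[OF order_refl Lp_shift(1)[OF f]] by simp
  have Tc: "integrable circM (\<lambda>x. T \<nu> x * of_real (cos (real k * x + \<xi>)))" for \<nu>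
    by (rule integrable_circM_cos[OF Ti])
  have v: "(LINT x|circM. norm (T \<nu> x)) = \<bar>bcoef \<alpha> \<nu>\<bar> * (LINT x|circM. norm (f x))" for \<nu>
    unfolding T_def using Lp_shift(2)[OF f, of "(\<alpha> - real \<nu>) * h"] by (simp add: norm_mult)
  have cle: "norm (T \<nu> x * of_real (cos (real k * x + \<xi>))) \<le> norm (T \<nu> x)" for \<nu> x
    unfolding norm_mult by (intro mult_left_le) auto
  have ae: "AE x in circM. summable (\<lambda>\<nu>. norm (T \<nu> x))"
    using frac_diff_summable_AE[OF \<alpha> f, of h] by (simp add: T_def)
  then have ae2: "AE x in circM. summable (\<lambda>\<nu>. norm (T \<nu> x * of_real (cos (real k * x + \<xi>))))"
    by eventually_elim (rule summable_comparison_test', assumption, use cle in auto)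
  have sm: "summable (\<lambda>\<nu>. LINT x|circM. norm (T \<nu> x * of_real (cos (real k * x + \<xi>))))"
  proof (rule summable_comparison_test'[where N = 0])
    show "summable (\<lambda>\<nu>. \<bar>bcoef \<alpha> \<nu>\<bar> * (LINT x|circM. norm (f x)))"
      using summable_bcoef[OF \<alpha>] by (rule summable_mult2)
    show "norm (LINT x|circM. norm (T n x * of_real (cos (real k * x + \<xi>)))) \<le> \<bar>bcoef \<alpha> n\<bar> * (LINT x|circM. norm (f x))" for n
    proof -
      have "(LINT x|circM. norm (T n x * of_real (cos (real k * x + \<xi>)))) \<le> (LINT x|circM. norm (T n x))"
        using Ti Tc cle by (intro integral_mono integrable_norm) auto
      moreover have "0 \<le> (LINT x|circM. norm (T n x * of_real (cos (real k * x + \<xi>))))"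
        by (intro integral_nonneg_AE) auto
      ultimately show ?thesis unfolding v by simp
    qed
  qed
  have "(\<lambda>\<nu>. LINT x|circM. T \<nu> x * of_real (cos (real k * x + \<xi>))) sums (LINT x|circM. (\<Sum>\<nu>. T \<nu> x * of_real (cos (real k * x + \<xi>))))"
    by (rule sums_integral[OF Tc ae2 sm])
  also have "(LINT x|circM. (\<Sum>\<nu>. T \<nu> x * of_real (cos (real k * x + \<xi>)))) = (LINT x|circM. frac_diff \<alpha> h f x * of_real (cos (real k * x + \<xi>)))"
  proof (rule integral_cong_AE)
    show "AE x in circM. (\<Sum>\<nu>. T \<nu> x * of_real (cos (real k * x + \<xi>))) = frac_diff \<alpha> h f x * of_real (cos (real k * x + \<xi>))"
      using ae by eventually_elim (simp add: T_def frac_diff_bcoef suminf_mult2[OF summable_norm_cancel])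
    show "(\<lambda>x. \<Sum>\<nu>. T \<nu> x * of_real (cos (real k * x + \<xi>))) \<in> borel_measurable circM"
      using Tc by (intro borel_measurable_suminf) auto
    show "(\<lambda>x. frac_diff \<alpha> h f x * of_real (cos (real k * x + \<xi>))) \<in> borel_measurable circM"
      using f by (intro borel_measurable_times cos_measurable_circM borel_measurable_circM' frac_diff_measurable) (simp add: Lp_iff)
  qed
  also have "(\<lambda>\<nu>. LINT x|circM. T \<nu> x * of_real (cos (real k * x + \<xi>))) =
    (\<lambda>\<nu>. of_real (bcoef \<alpha> \<nu>) * (LINT x|circM. f x * of_real (cos (real k * x + (\<xi> - real k * \<alpha> * h + real \<nu> * (real k * h))))))"
  proof
    fix \<nu>
    define c where "c = (\<alpha> - real \<nu>) * h"
    define G where "G x = f x * of_real (cos (real k * x + (\<xi> - real k * c)))" for x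
    have Gi: "integrable circM G" unfolding G_def by (rule integrable_circM_cos[OF fi])
    have fp: "f (x + 2 * pi) = f x" for x using f by (simp add: Lp_iff)
    have Gp: "G (x + 2 * pi) = G x" for x unfolding G_def cos_add_period fp ..
    have "(LINT x|circM. T \<nu> x * of_real (cos (real k * x + \<xi>))) = (LINT x|circM. of_real (bcoef \<alpha> \<nu>) * G (x + c))"
      unfolding T_def G_def c_def[symmetric] by (intro Bochner_Integration.integral_cong refl) (simp add: algebra_simps)
    also have "\<dots> = of_real (bcoef \<alpha> \<nu>) * (LINT x|circM. G x)"
      using circM_shift[of G c, OF Gp Gi] by simp
    finally show "(LINT x|circM. T \<nu> x * of_real (cos (real k * x + \<xi>))) = 
      of_real (bcoef \<alpha> \<nu>) * (LINT x|circM. f x * of_real (cos (real k * x + (\<xi> - real k * \<alpha> * h + real \<nu> * (real k * h)))))"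
      by (simp add: G_def c_def algebra_simps)
  qed
  finally show ?thesis .
qed

section \<open>Hardy-Littlewood bounds and the tail of the Fourier series\<close>

definition Ecoef :: "real \<Rightarrow> (nat \<Rightarrow> complex) \<Rightarrow> (nat \<Rightarrow> complex) \<Rightarrow> nat \<Rightarrow> real" where
  "Ecoef p a b j = norm (a (2 ^ j)) powr p + norm (b (2 ^ j)) powr p"

lemma Ecoef_nonneg: "0 \<le> Ecoef p a b j"
  by (simp add: Ecoef_def)

lemma dual_lower_pair:
  fixes p C r :: real
  assumes p: "1 < p" and C: "0 \<le> C" and r: "0 < r"
  obtains K where "K > 0"
    "\<And>X \<xi> \<zeta> \<rho> l a b S u v. GM_with C a \<Longrightarrow> GM_with C b \<Longrightarrow>
       dual_bound p X \<xi> (\<lambda>k. of_real (\<rho> k) * a k) S \<Longrightarrow> dual_bound p X \<zeta> (\<lambda>k. of_real (\<rho> k) * b k) S \<Longrightarrow> 0 \<le> X \<Longrightarrow>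
       (\<And>j. u \<le> j \<Longrightarrow> j \<le> v \<Longrightarrow> dyblock j \<subseteq> S) \<Longrightarrow> (\<And>j. 0 \<le> l j) \<Longrightarrow> (\<And>j. l (Suc j) \<le> r * l j) \<Longrightarrow>
       (\<And>j k. u \<le> j \<Longrightarrow> j \<le> v \<Longrightarrow> k \<in> dyblock j \<Longrightarrow> l j \<le> \<rho> k) \<Longrightarrow>
       (\<Sum>j=u..v. 2 powr (real j * (p - 1)) * l j powr p * Ecoef p a b j)
         \<le> K * (X + (if u = 0 then 0 else 2 powr (real u * (p - 1)) * l u powr p * Ecoef p a b u))"
proof -
  obtain K1 where K1: "K1 > 0"
    "\<And>X \<xi> \<rho> l d S u v. GM_with C d \<Longrightarrow> dual_bound p X \<xi> (\<lambda>k. of_real (\<rho> k) * d k) S \<Longrightarrow> 0 \<le> X \<Longrightarrow>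
       (\<And>j. u \<le> j \<Longrightarrow> j \<le> v \<Longrightarrow> dyblock j \<subseteq> S) \<Longrightarrow> (\<And>j. 0 \<le> l j) \<Longrightarrow> (\<And>j. l (Suc j) \<le> r * l j) \<Longrightarrow>
       (\<And>j k. u \<le> j \<Longrightarrow> j \<le> v \<Longrightarrow> k \<in> dyblock j \<Longrightarrow> l j \<le> \<rho> k) \<Longrightarrow>
       (\<Sum>j=u..v. 2 powr (real j * (p - 1)) * (l j * norm (d (2 ^ j))) powr p)
         \<le> K1 * (X + (if u = 0 then 0 else 2 powr (real u * (p - 1)) * (l u * norm (d (2 ^ u))) powr p))"
  proof (rule dual_lower_bound[OF p C r], goal_cases)
    case (1 K)
    show ?case by (rule 1(1)[OF 1(2) 1(3)])
  qed
  show ?thesis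
  proof (rule that[of "2 * K1"])
    fix X \<xi> \<zeta> and \<rho> l :: "nat \<Rightarrow> real" and a b S u v
    assume GM: "GM_with C a" "GM_with C b"
      and db: "dual_bound p X \<xi> (\<lambda>k. of_real (\<rho> k) * a k) S" "dual_bound p X \<zeta> (\<lambda>k. of_real (\<rho> k) * b k) S" and X: "0 \<le> X"
      and S: "\<And>j. u \<le> j \<Longrightarrow> j \<le> v \<Longrightarrow> dyblock j \<subseteq> S" and l0: "\<And>j. 0 \<le> l j" and lr: "\<And>j. l (Suc j) \<le> r * l j"
      and l: "\<And>j k. u \<le> j \<Longrightarrow> j \<le> v \<Longrightarrow> k \<in> dyblock j \<Longrightarrow> l j \<le> \<rho> k"
    define F where "F d = (if u = 0 then 0 else 2 powr (real u * (p - 1)) * (l u * norm (d (2 ^ u))) powr p)" for d :: "nat \<Rightarrow> complex"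
    have split: "2 powr (real j * (p - 1)) * l j powr p * Ecoef p a b j =
       2 powr (real j * (p - 1)) * (l j * norm (a (2 ^ j))) powr p + 2 powr (real j * (p - 1)) * (l j * norm (b (2 ^ j))) powr p" for j
      using l0[of j] by (simp add: Ecoef_def powr_mult algebra_simps)
    have "(\<Sum>j=u..v. 2 powr (real j * (p - 1)) * l j powr p * Ecoef p a b j) \<le> K1 * (X + F a) + K1 * (X + F b)"
      unfolding split sum.distrib F_def
      by (intro add_mono K1(2)[where d = a and \<rho> = \<rho> and l = l, OF GM(1) db(1) X S l0 lr l]
        K1(2)[where d = b and \<rho> = \<rho> and l = l, OF GM(2) db(2) X S l0 lr l])
    also have "\<dots> = K1 * (2 * X + (F a + F b))" by (simp add: algebra_simps)
    also have "F a + F b = (if u = 0 then 0 else 2 powr (real u * (p - 1)) * l u powr p * Ecoef p a b u)" (is "_ = ?F")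
      by (simp add: F_def split)
    also have "K1 * (2 * X + ?F) \<le> 2 * K1 * (X + ?F)"
      using K1(1) Ecoef_nonneg[of p a b u] by (simp add: distrib_left)
    finally show "(\<Sum>j=u..v. 2 powr (real j * (p - 1)) * l j powr p * Ecoef p a b j)
         \<le> 2 * K1 * (X + (if u = 0 then 0 else 2 powr (real u * (p - 1)) * l u powr p * Ecoef p a b u))" .
  qed (use K1 in simp)
qed

lemma fourier_pair_coeff:
  assumes "integrable circM f"
  shows "(LINT x|circM. f x * of_real (cos (real k * x))) = of_real pi * fourier_cos f k"
    "(LINT x|circM. f x * of_real (cos (real k * x + - (pi / 2)))) = of_real pi * fourier_sin f k"
  using fourier_coeff_shift[OF assms, of k 0] fourier_coeff_shift[OF assms, of k "- (pi / 2)"] by simp_all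

text \<open>The function \<open>f\<close> is itself tested, with weight 1; the sum starts at
  \<open>u = 0\<close>, so no boundary term arises. The decay of the coefficients needed for
  convergence comes from here.\<close>

lemma Hardy_Littlewood_lower:
  fixes p C :: real
  assumes p: "1 < p" and C: "0 \<le> C"
  obtains K where "K > 0"
    "\<And>f m. f \<in> Lp p \<Longrightarrow> GM_with C (fourier_cos f) \<Longrightarrow> GM_with C (fourier_sin f) \<Longrightarrow>
       (\<Sum>j=0..m. 2 powr (real j * (p - 1)) * Ecoef p (fourier_cos f) (fourier_sin f) j) \<le> K * (LINT x|circM. norm (f x) powr p)"
proof (rule dual_lower_pair[OF p C zero_less_one], goal_cases)
  case (1 K)
  note K = 1(2) 1(3)
  show ?case
  proof (rule 1(1)[OF K(1)])
    fix f m assume f: "f \<in> Lp p" and GM: "GM_with C (fourier_cos f)" "GM_with C (fourier_sin f)"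
    have fi: "integrable circM f" using p f by (intro Lp_integrable) auto
    have fm: "f \<in> borel_measurable circM" "integrable circM (\<lambda>x. norm (f x) powr p)"
      using f by (auto simp: Lp_iff borel_measurable_circM')
    have "dual_bound p (LINT x|circM. norm (f x) powr p) 0 (\<lambda>k. of_real 1 * fourier_cos f k) UNIV"
      "dual_bound p (LINT x|circM. norm (f x) powr p) (- (pi / 2)) (\<lambda>k. of_real 1 * fourier_sin f k) UNIV"
      using fourier_pair_coeff[OF fi] by (auto intro!: dual_boundI[OF p fm order_refl])
    from K(2)[OF GM this, of 0 m "\<lambda>_. 1"]
    show "(\<Sum>j=0..m. 2 powr (real j * (p - 1)) * Ecoef p (fourier_cos f) (fourier_sin f) j) \<le> K * (LINT x|circM. norm (f x) powr p)"
      by (simp add: integral_nonneg_AE)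
  qed
qed

lemma norm_le_Ecoef_root:
  assumes "0 < p" "2 powr (real j * (p - 1)) * Ecoef p a b j \<le> Z" "0 \<le> Z"
  shows "norm (a (2 ^ j)) + norm (b (2 ^ j)) \<le> 2 * Z powr (1 / p) * 2 powr (- (real j * (1 - 1 / p)))"
proof -
  have aux: "s \<le> Z powr (1 / p) * 2 powr (- (real j * (1 - 1 / p)))" if s: "0 \<le> s" "s powr p \<le> Ecoef p a b j" for s
  proof -
    have "s powr p \<le> Z * 2 powr (- (real j * (p - 1)))"
    proof -
      have "Ecoef p a b j * 2 powr (real j * (p - 1)) \<le> Z" using assms(2) by (simp only: mult.commute)
      then have "Ecoef p a b j \<le> Z / 2 powr (real j * (p - 1))" by (subst pos_le_divide_eq) auto
      then show ?thesis using s(2) unfolding powr_minus_divide by simp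
    qed
    then have "(s powr p) powr (1 / p) \<le> (Z * 2 powr (- (real j * (p - 1)))) powr (1 / p)"
      using assms by (intro powr_mono2) auto
    also have "\<dots> = Z powr (1 / p) * 2 powr (- (real j * (p - 1)) * (1 / p))"
      using assms by (simp add: powr_mult powr_powr)
    also have "- (real j * (p - 1)) * (1 / p) = - (real j * (1 - 1 / p))"
      using assms by (simp add: field_simps)
    finally show ?thesis using s(1) assms(1) by (simp add: powr_powr)
  qed
  show ?thesis using aux[of "norm (a (2 ^ j))"] aux[of "norm (b (2 ^ j))"] by (simp add: Ecoef_def)
qed

lemma fourier_series_tendsto_AE_Lp:
  assumes p: "1 < p" and C: "0 \<le> C" and f: "f \<in> Lp p" "fourier_cos f 0 = 0"
    and GM: "GM_with C (fourier_cos f)" "GM_with C (fourier_sin f)"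
  shows "AE x in circM. (\<lambda>n. fourier_sum n f x) \<longlonglongrightarrow> f x"
proof -
  obtain K where K: "K > 0"
    "\<And>m. (\<Sum>j=0..m. 2 powr (real j * (p - 1)) * Ecoef p (fourier_cos f) (fourier_sin f) j) \<le> K * (LINT x|circM. norm (f x) powr p)"
    by (rule Hardy_Littlewood_lower[OF p C]) (use f GM in blast)
  define Z where "Z = K * (LINT x|circM. norm (f x) powr p)"
  have Z: "0 \<le> Z" using K(1) by (simp add: Z_def integral_nonneg_AE)
  \<comment> \<open>The coefficients at \<open>2 ^ j\<close> decay like
    \<open>2 powr (- (real j * (1 - 1 / p)))\<close>; half of the exponent pays for the weight and
    the other half leaves a geometric series.\<close>
  define \<theta> where "\<theta> = (1 - 1 / p) / 2"
  have \<theta>: "0 < \<theta>" "\<theta> < 1" "1 - 1 / p = 2 * \<theta>" using p by (auto simp: \<theta>_def field_simps)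
  have le: "2 powr (real j * (p - 1)) * Ecoef p (fourier_cos f) (fourier_sin f) j \<le> Z" for j
    using K(2)[of j] member_le_sum[of j "{0..j}" "\<lambda>j. 2 powr (real j * (p - 1)) * Ecoef p (fourier_cos f) (fourier_sin f) j"]
    by (simp add: Ecoef_nonneg Z_def)
  have bd: "2 powr (real j * \<theta>) * (norm (fourier_cos f (2 ^ j)) + norm (fourier_sin f (2 ^ j))) \<le> 2 * Z powr (1 / p) * (2 powr (- \<theta>)) ^ j" for j
  proof -
    have "2 powr (real j * \<theta>) * (norm (fourier_cos f (2 ^ j)) + norm (fourier_sin f (2 ^ j)))
        \<le> 2 powr (real j * \<theta>) * (2 * Z powr (1 / p) * 2 powr (- (real j * (1 - 1 / p))))"
      using p le[of j] Z by (intro mult_left_mono norm_le_Ecoef_root) auto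
    also have "\<dots> = 2 * Z powr (1 / p) * (2 powr (real j * \<theta>) * 2 powr (- (real j * (2 * \<theta>))))"
      unfolding \<theta>(3) by (simp add: mult_ac)
    also have "2 powr (real j * \<theta>) * 2 powr (- (real j * (2 * \<theta>))) = (2 powr (- \<theta>)) ^ j"
      by (simp add: powr_add[symmetric] powr_realpow[symmetric] powr_powr algebra_simps)
    finally show ?thesis .
  qed
  have "summable (\<lambda>j. 2 powr (real j * \<theta>) * (norm (fourier_cos f (2 ^ j)) + norm (fourier_sin f (2 ^ j))))"
  proof (rule summable_comparison_test'[where N = 0])
    show "summable (\<lambda>j. 2 * Z powr (1 / p) * (2 powr (- \<theta>)) ^ j)"
      using \<theta> by (intro summable_mult summable_geometric) (simp add: powr_less_one)
    show "norm (2 powr (real j * \<theta>) * (norm (fourier_cos f (2 ^ j)) + norm (fourier_sin f (2 ^ j)))) \<le> 2 * Z powr (1 / p) * (2 powr (- \<theta>)) ^ j" for j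
      using bd[of j] by (simp add: abs_mult)
  qed
  moreover have "integrable circM f" using p f by (intro Lp_integrable) auto
  ultimately show ?thesis using f(2) GM C \<theta> by (intro fourier_series_tendsto_AE) auto
qed

text \<open>The tail is the almost everywhere limit of its truncations at \<open>2 ^ m\<close>, for
  which \<open>wpoly_Lp_bound\<close> is uniform in \<open>m\<close>. Stating the hypothesis for
  finite sums avoids any infinite series here.\<close>

lemma fourier_tail_Lp:
  fixes p C :: real
  assumes p: "1 < p" and C: "0 \<le> C"
  obtains K where "K > 0"
    "\<And>f n Z. f \<in> Lp p \<Longrightarrow> fourier_cos f 0 = 0 \<Longrightarrow> GM_with C (fourier_cos f) \<Longrightarrow> GM_with C (fourier_sin f) \<Longrightarrow>
       (\<And>m. (\<Sum>j=n..m. 2 powr (real j * (p - 1)) * Ecoef p (fourier_cos f) (fourier_sin f) j) \<le> Z) \<Longrightarrow>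
       (LINT x|circM. norm (f x - fourier_sum (2 ^ n) f x) powr p) \<le> K * Z"
proof (rule wpoly_Lp_bound[OF p C], goal_cases)
  case (1 K)
  note K = 1(2) 1(3)
  show ?case
  proof (rule 1(1)[OF K(1)])
    fix f n Z assume f: "f \<in> Lp p" "fourier_cos f 0 = 0" and GM: "GM_with C (fourier_cos f)" "GM_with C (fourier_sin f)"
      and Z: "\<And>m. (\<Sum>j=n..m. 2 powr (real j * (p - 1)) * Ecoef p (fourier_cos f) (fourier_sin f) j) \<le> Z"
    let ?a = "fourier_cos f" and ?b = "fourier_sin f"
    define g where "g m = wpoly ?a ?b (\<lambda>_. 1) 0 (Suc (2 ^ n)) (2 ^ m)" for m
    have lim: "AE x in circM. (\<lambda>m. g m x) \<longlonglongrightarrow> f x - fourier_sum (2 ^ n) f x"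
      using fourier_series_tendsto_AE_Lp[OF p C f GM]
    proof eventually_elim
      case (elim x)
      have "(\<lambda>m. fourier_sum (2 ^ m) f x) \<longlonglongrightarrow> f x"
        using LIMSEQ_subseq_LIMSEQ[OF elim, of "\<lambda>m. 2 ^ m"] by (auto simp: strict_mono_def o_def)
      then have "(\<lambda>m. fourier_sum (2 ^ m) f x - fourier_sum (2 ^ n) f x) \<longlonglongrightarrow> f x - fourier_sum (2 ^ n) f x"
        by (intro tendsto_intros)
      moreover have "\<forall>\<^sub>F m in sequentially. fourier_sum (2 ^ m) f x - fourier_sum (2 ^ n) f x = g m x"
        unfolding eventually_sequentially
      proof (intro exI[of _ n] allI impI)
        fix m assume "n \<le> m"
        then have "(2::nat) ^ n \<le> 2 ^ m" by simp
        then show "fourier_sum (2 ^ m) f x - fourier_sum (2 ^ n) f x = g m x"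
          using wpoly_diff[of "Suc (2 ^ n)" "2 ^ m" ?a ?b "\<lambda>_. 1" 0 x] by (simp add: fourier_sum_eq_wpoly[of f, OF f(2)] g_def)
      qed
      ultimately show ?case by (rule Lim_transform_eventually)
    qed
    have gm: "g m \<in> borel_measurable circM" for m unfolding g_def by (intro borel_measurable_circM) measurable
    have hm: "(\<lambda>x. f x - fourier_sum (2 ^ n) f x) \<in> borel_measurable circM"
      unfolding fourier_sum_eq_wpoly[of f, OF f(2)]
      using f by (intro borel_measurable_diff borel_measurable_circM' borel_measurable_circM) (auto simp: Lp_iff)
    have gi: "integrable circM (\<lambda>x. norm (g m x) powr p)" for m
    proof (rule integrable_circM_bounded[where B = "(\<Sum>k=Suc (2 ^ n)..2 ^ m. norm (?a k) + norm (?b k)) powr p"])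
      show "(\<lambda>x. norm (g m x) powr p) \<in> borel_measurable circM" using gm[of m] by measurable
      have "norm (g m x) \<le> (\<Sum>k=Suc (2 ^ n)..2 ^ m. norm (?a k) + norm (?b k))" for x
        unfolding g_def wpoly_def
        by (intro sum_norm_le) (auto simp: norm_mult intro!: order_trans[OF norm_triangle_ineq] add_mono mult_left_le)
      then show "norm (norm (g m x) powr p) \<le> (\<Sum>k=Suc (2 ^ n)..2 ^ m. norm (?a k) + norm (?b k)) powr p" for x
        using p by (auto intro!: powr_mono2)
    qed
    have gB: "(LINT x|circM. norm (g m x) powr p) \<le> K * Z" for m
    proof -
      have "(LINT x|circM. norm (g m x) powr p)
         \<le> K * (\<Sum>j=n..m. 2 powr (real j * (p - 1)) * 1 powr p * (norm (?a (2 ^ j)) powr p + norm (?b (2 ^ j)) powr p))"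
        unfolding g_def by (intro K(2)[OF GM]) auto
      also have "\<dots> \<le> K * Z" using Z[of m] K(1) by (simp add: Ecoef_def)
      finally show ?thesis .
    qed
    have p0: "0 < p" using p by simp
    show "(LINT x|circM. norm (f x - fourier_sum (2 ^ n) f x) powr p) \<le> K * Z"
      by (rule Lp_bound_AE_limit(2)[OF lim p0 gm hm gi gB])
  qed
qed

text \<open>The steps run in the direction of \<open>- h\<close>, so for positive \<open>h\<close>
  the argument of the cosine is negated before \<open>bcoef_cos_sums\<close> is applied. This is the
  origin of the sign in the phase.\<close>

lemma frac_diff_cos_sums:
  assumes \<alpha>: "0 < \<alpha>" and h: "h \<noteq> 0" "0 < real k * \<bar>h\<bar>" "real k * \<bar>h\<bar> < 2 * pi"
  shows "(\<lambda>\<nu>. bcoef \<alpha> \<nu> * cos (real k * (x + (\<alpha> - real \<nu>) * h) + \<zeta>)) sums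
     ((2 * sin (real k * \<bar>h\<bar> / 2)) powr \<alpha> * cos (real k * (x + \<alpha> * h / 2) + (sgn h * \<alpha> * pi / 2 + \<zeta>)))"
proof (cases "h > 0")
  case True
  define t where "t = - (real k * x + real k * \<alpha> * h + \<zeta>)"
  have "cos (real k * (x + (\<alpha> - real \<nu>) * h) + \<zeta>) = cos (t + real \<nu> * (real k * \<bar>h\<bar>))" for \<nu>
    using True cos_minus[of "real k * (x + (\<alpha> - real \<nu>) * h) + \<zeta>"] by (simp add: t_def algebra_simps)
  moreover have "t - \<alpha> * (pi - real k * \<bar>h\<bar>) / 2 = - (real k * (x + \<alpha> * h / 2) + (sgn h * \<alpha> * pi / 2 + \<zeta>))"
    using True by (simp add: t_def field_simps)
  then have "cos (t - \<alpha> * (pi - real k * \<bar>h\<bar>) / 2) = cos (real k * (x + \<alpha> * h / 2) + (sgn h * \<alpha> * pi / 2 + \<zeta>))"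
    by (simp only: cos_minus)
  ultimately show ?thesis using bcoef_cos_sums[OF \<alpha> h(2,3), of t] by simp
next
  case False
  then have h0: "h < 0" using h by simp
  define t where "t = real k * x + real k * \<alpha> * h + \<zeta>"
  have "real k * (x + (\<alpha> - real \<nu>) * h) + \<zeta> = t + real \<nu> * (real k * \<bar>h\<bar>)" for \<nu>
    using h0 by (simp add: t_def algebra_simps)
  moreover have "t - \<alpha> * (pi - real k * \<bar>h\<bar>) / 2 = real k * (x + \<alpha> * h / 2) + (sgn h * \<alpha> * pi / 2 + \<zeta>)"
    using h0 by (simp add: t_def field_simps)
  ultimately show ?thesis using bcoef_cos_sums[OF \<alpha> h(2,3), of t] by simp
qed

lemma frac_diff_wpoly_sums:
  assumes \<alpha>: "0 < \<alpha>" and h: "h \<noteq> 0" "real N * \<bar>h\<bar> < 2 * pi"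
  shows "(\<lambda>\<nu>. of_real (bcoef \<alpha> \<nu>) * wpoly a b (\<lambda>_. 1) 0 1 N (x + (\<alpha> - real \<nu>) * h)) sums
     wpoly a b (\<lambda>k. (2 * sin (real k * \<bar>h\<bar> / 2)) powr \<alpha>) (sgn h * \<alpha> * pi / 2) 1 N (x + \<alpha> * h / 2)"
proof -
  have "(\<lambda>\<nu>. \<Sum>k=1..N. a k * of_real (bcoef \<alpha> \<nu> * cos (real k * (x + (\<alpha> - real \<nu>) * h) + 0))
        + b k * of_real (bcoef \<alpha> \<nu> * cos (real k * (x + (\<alpha> - real \<nu>) * h) + - (pi/2)))) sums
     (\<Sum>k=1..N. a k * of_real ((2 * sin (real k * \<bar>h\<bar> / 2)) powr \<alpha> * cos (real k * (x + \<alpha> * h / 2) + (sgn h * \<alpha> * pi / 2 + 0)))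
        + b k * of_real ((2 * sin (real k * \<bar>h\<bar> / 2)) powr \<alpha> * cos (real k * (x + \<alpha> * h / 2) + (sgn h * \<alpha> * pi / 2 + - (pi/2)))))"
  proof (intro sums_sum sums_add sums_mult sums_of_real)
    fix k assume k: "k \<in> {1..N}"
    have "real k * \<bar>h\<bar> \<le> real N * \<bar>h\<bar>" using k by (intro mult_right_mono) auto
    then have "real k * \<bar>h\<bar> < 2 * pi" using h(2) by (rule le_less_trans)
    moreover have "0 < real k * \<bar>h\<bar>" using h(1) k by simp
    ultimately have "0 < real k * \<bar>h\<bar>" "real k * \<bar>h\<bar> < 2 * pi" by auto
    note S = frac_diff_cos_sums[OF \<alpha> h(1) this]
    show "(\<lambda>\<nu>. bcoef \<alpha> \<nu> * cos (real k * (x + (\<alpha> - real \<nu>) * h) + 0)) sums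
      ((2 * sin (real k * \<bar>h\<bar> / 2)) powr \<alpha> * cos (real k * (x + \<alpha> * h / 2) + (sgn h * \<alpha> * pi / 2 + 0)))" by (rule S)
    show "(\<lambda>\<nu>. bcoef \<alpha> \<nu> * cos (real k * (x + (\<alpha> - real \<nu>) * h) + - (pi/2))) sums
      ((2 * sin (real k * \<bar>h\<bar> / 2)) powr \<alpha> * cos (real k * (x + \<alpha> * h / 2) + (sgn h * \<alpha> * pi / 2 + - (pi/2))))" by (rule S)
  qed
  then show ?thesis
    unfolding wpoly_def sin_eq_cos_shift by (simp add: sum_distrib_left algebra_simps)
qed

section \<open>Weyl derivatives\<close>

text \<open>The factors at \<open>k\<close> and \<open>- k\<close> share the modulus
  \<open>real k powr \<alpha>\<close> and have opposite phases, so the pair of exponentials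
  recombines into a shifted cosine and sine.\<close>

lemma weyl_frequency:
  fixes a b :: complex
  assumes "1 \<le> k"
  shows "(\<i> * of_int (int k)) powr of_real \<alpha> * ((a - \<i> * b) / 2) * cis (of_int (int k) * x)
     + (\<i> * of_int (- int k)) powr of_real \<alpha> * ((a + \<i> * b) / 2) * cis (of_int (- int k) * x)
     = of_real (real k powr \<alpha>) * (a * of_real (cos (real k * x + \<alpha> * pi / 2)) + b * of_real (sin (real k * x + \<alpha> * pi / 2)))"
proof -
  have k: "real k > 0" using assms by simp
  have e: "\<i> * of_int (int k) = of_real (real k) * cis (pi / 2)"
    "\<i> * of_int (- int k) = of_real (real k) * cis (- (pi / 2))"
    by (simp_all add: complex_eq_iff)
  have p1: "(\<i> * of_int (int k)) powr of_real \<alpha> = of_real (real k powr \<alpha>) * cis (\<alpha> * (pi / 2))"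
    and p2: "(\<i> * of_int (- int k)) powr of_real \<alpha> = of_real (real k powr \<alpha>) * cis (\<alpha> * - (pi / 2))"
    unfolding e by (rule powr_polar[OF k]; use pi_ge_two in linarith)+
  have g: "(a - \<i> * b) / 2 * cis y + (a + \<i> * b) / 2 * cis (- y) = a * of_real (cos y) + b * of_real (sin y)" for y
    by (simp add: complex_eq_iff field_simps)
  have c: "cis (\<alpha> * (pi / 2)) * cis (real k * x) = cis (real k * x + \<alpha> * pi / 2)"
    "cis (\<alpha> * - (pi / 2)) * cis (- real k * x) = cis (- (real k * x + \<alpha> * pi / 2))"
    by (simp_all add: cis_mult algebra_simps)
  have "(\<i> * of_int (int k)) powr of_real \<alpha> * ((a - \<i> * b) / 2) * cis (of_int (int k) * x)
     + (\<i> * of_int (- int k)) powr of_real \<alpha> * ((a + \<i> * b) / 2) * cis (of_int (- int k) * x)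
     = of_real (real k powr \<alpha>) * (((a - \<i> * b) / 2) * (cis (\<alpha> * (pi / 2)) * cis (real k * x))
        + ((a + \<i> * b) / 2) * (cis (\<alpha> * - (pi / 2)) * cis (- real k * x)))"
    unfolding p1 p2 by (simp add: algebra_simps)
  also have "\<dots> = of_real (real k powr \<alpha>) * (a * of_real (cos (real k * x + \<alpha> * pi / 2)) + b * of_real (sin (real k * x + \<alpha> * pi / 2)))"
    unfolding c g ..
  finally show ?thesis .
qed

lemma wpoly_integrable: "integrable circM (wpoly a b \<rho> \<xi> N M)"
proof (rule integrable_circM_bounded)
  show "wpoly a b \<rho> \<xi> N M \<in> borel_measurable circM" by (intro borel_measurable_circM) measurable
  show "norm (wpoly a b \<rho> \<xi> N M x) \<le> (\<Sum>k=N..M. \<bar>\<rho> k\<bar> * (norm (a k) + norm (b k)))" for x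
    unfolding wpoly_def
    by (intro sum_norm_le) (auto simp: norm_mult intro!: mult_left_mono order_trans[OF norm_triangle_ineq] add_mono mult_left_le)
qed

lemma fourier_exp_wpoly:
  assumes T: "T = wpoly a b (\<lambda>_. 1) 0 1 N"
  shows "fourier_exp T (int k) = (if k \<in> {1..N} then (a k - \<i> * b k) / 2 else 0)"
    "fourier_exp T (- int k) = (if k \<in> {1..N} then (a k + \<i> * b k) / 2 else 0)"
proof -
  have Ti: "integrable circM T" unfolding T by (rule wpoly_integrable)
  have c: "(LINT x|circM. T x * of_real (cos (real k * x))) = (if k \<in> {1..N} then of_real pi * a k else 0)"
    using wpoly_coeff[of 1 a b "\<lambda>_. 1" 0 N k 0] unfolding T by simp
  have s: "(LINT x|circM. T x * of_real (sin (real k * x))) = (if k \<in> {1..N} then of_real pi * b k else 0)"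
    using wpoly_coeff[of 1 a b "\<lambda>_. 1" 0 N k "- (pi / 2)"] unfolding T by (simp add: cos_diff)
  have ci: "integrable circM (\<lambda>x. T x * of_real (cos (real k * x)))"
    using integrable_circM_cos[OF Ti, of k 0] by simp
  have si: "integrable circM (\<lambda>x. T x * of_real (sin (real k * x)))"
    using integrable_circM_cos[OF Ti, of k "- (pi/2)"] by (simp add: cos_diff)
  have "fourier_exp T (int k) = (LINT x|circM. T x * of_real (cos (real k * x)) - \<i> * (T x * of_real (sin (real k * x)))) / of_real (2 * pi)"
    unfolding fourier_exp_def set_integral_circM
    by (intro arg_cong2[where f = "(/)"] Bochner_Integration.integral_cong refl) (simp add: complex_eq_iff)
  also have "\<dots> = (if k \<in> {1..N} then (a k - \<i> * b k) / 2 else 0)"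
    using ci si c s by (auto simp: field_simps)
  finally show "fourier_exp T (int k) = (if k \<in> {1..N} then (a k - \<i> * b k) / 2 else 0)" .
  have "fourier_exp T (- int k) = (LINT x|circM. T x * of_real (cos (real k * x)) + \<i> * (T x * of_real (sin (real k * x)))) / of_real (2 * pi)"
    unfolding fourier_exp_def set_integral_circM
    by (intro arg_cong2[where f = "(/)"] Bochner_Integration.integral_cong refl) (simp add: complex_eq_iff)
  also have "\<dots> = (if k \<in> {1..N} then (a k + \<i> * b k) / 2 else 0)"
    using ci si c s by (auto simp: field_simps)
  finally show "fourier_exp T (- int k) = (if k \<in> {1..N} then (a k + \<i> * b k) / 2 else 0)" .
qed

lemma weyl_deriv_fourier_sum:
  assumes "fourier_cos f 0 = 0"
  shows "weyl_deriv \<alpha> (fourier_sum N f) x = wpoly (fourier_cos f) (fourier_sin f) (\<lambda>k. real k powr \<alpha>) (\<alpha> * pi / 2) 1 N x"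
proof -
  let ?a = "fourier_cos f" and ?b = "fourier_sin f"
  define T where "T = fourier_sum N f"
  have T: "T = wpoly ?a ?b (\<lambda>_. 1) 0 1 N" unfolding T_def using fourier_sum_eq_wpoly[of f, OF assms] by (intro ext) simp
  note fe = fourier_exp_wpoly[OF T]
  define G where "G m = (\<i> * of_int m) powr of_real \<alpha> * fourier_exp T m * cis (of_int m * x)" for m :: int
  define P where "P = int ` {1..N}"
  define Q where "Q = (\<lambda>k. - int k) ` {1..N}"
  have G0: "G m = 0" if "m \<notin> P \<union> Q" for m
  proof -
    consider k where "m = int k" | k where "m = - int k" by (metis int_cases2)
    then have "fourier_exp T m = 0"
    proof cases
      case 1
      then have "k \<notin> {1..N}" using that by (auto simp: P_def)
      then show ?thesis unfolding 1 fe(1) by (rule if_not_P)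
    next
      case 2
      then have "k \<notin> {1..N}" using that by (auto simp: Q_def)
      then show ?thesis unfolding 2 fe(2) by (rule if_not_P)
    qed
    then show ?thesis by (simp add: G_def)
  qed
  have "weyl_deriv \<alpha> T x = infsum G UNIV" by (simp add: weyl_deriv_def G_def[abs_def])
  also have "\<dots> = infsum G (P \<union> Q)" by (rule infsum_cong_neutral) (use G0 in auto)
  also have "\<dots> = sum G (P \<union> Q)" by (rule infsum_finite) (auto simp: P_def Q_def)
  also have "\<dots> = sum G P + sum G Q" by (rule sum.union_disjoint) (auto simp: P_def Q_def)
  also have "sum G P = (\<Sum>k=1..N. G (int k))" unfolding P_def by (subst sum.reindex) (auto simp: inj_on_def)
  also have "sum G Q = (\<Sum>k=1..N. G (- int k))" unfolding Q_def by (subst sum.reindex) (auto simp: inj_on_def)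
  also have "(\<Sum>k=1..N. G (int k)) + (\<Sum>k=1..N. G (- int k)) = (\<Sum>k=1..N. G (int k) + G (- int k))"
    by (simp add: sum.distrib)
  also have "\<dots> = wpoly ?a ?b (\<lambda>k. real k powr \<alpha>) (\<alpha> * pi / 2) 1 N x"
    unfolding wpoly_def
  proof (intro sum.cong refl)
    fix k assume k: "k \<in> {1..N}"
    then have "1 \<le> k" by simp
    from weyl_frequency[OF this, of \<alpha> "?a k" "?b k" x] k
    show "G (int k) + G (- int k) = of_real (real k powr \<alpha>) *
       (?a k * of_real (cos (real k * x + \<alpha> * pi / 2)) + ?b k * of_real (sin (real k * x + \<alpha> * pi / 2)))"
      by (simp add: G_def fe)
  qed
  finally show ?thesis by (simp add: T_def)
qed

lemma wpoly_powr_integrable: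
  assumes "0 \<le> p" shows "integrable circM (\<lambda>x. norm (wpoly a b \<rho> \<xi> N M x) powr p)"
proof (rule integrable_circM_bounded)
  show "(\<lambda>x. norm (wpoly a b \<rho> \<xi> N M x) powr p) \<in> borel_measurable circM" by (intro borel_measurable_circM) measurable
  have "norm (wpoly a b \<rho> \<xi> N M x) \<le> (\<Sum>k=N..M. \<bar>\<rho> k\<bar> * (norm (a k) + norm (b k)))" for x
    unfolding wpoly_def
    by (intro sum_norm_le) (auto simp: norm_mult intro!: mult_left_mono order_trans[OF norm_triangle_ineq] add_mono mult_left_le)
  then show "norm (norm (wpoly a b \<rho> \<xi> N M x) powr p) \<le> (\<Sum>k=N..M. \<bar>\<rho> k\<bar> * (norm (a k) + norm (b k))) powr p" for x
    using assms by (auto intro!: powr_mono2)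
qed

lemma wpoly_Lp: "0 \<le> p \<Longrightarrow> wpoly a b \<rho> \<xi> N M \<in> Lp p"
proof -
  have "wpoly a b \<rho> \<xi> N M (x + 2 * pi) = wpoly a b \<rho> \<xi> N M x" for x
    unfolding wpoly_def sin_eq_cos_shift cos_add_period ..
  moreover have "wpoly a b \<rho> \<xi> N M \<in> borel_measurable lebesgue" by (intro measurable_completion) simp
  ultimately show "0 \<le> p \<Longrightarrow> wpoly a b \<rho> \<xi> N M \<in> Lp p" by (simp add: Lp_iff wpoly_powr_integrable)
qed

lemma weyl_bounds:
  fixes p C \<alpha> :: real
  assumes p: "1 < p" and C: "0 \<le> C" and \<alpha>: "0 < \<alpha>"
  obtains K1 K2 where "K1 > 0" "K2 > 0"
    "\<And>f n. fourier_cos f 0 = 0 \<Longrightarrow> GM_with C (fourier_cos f) \<Longrightarrow> GM_with C (fourier_sin f) \<Longrightarrow>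
      (LINT x|circM. norm (weyl_deriv \<alpha> (fourier_sum (2 ^ n) f) x) powr p)
       \<le> K1 * (\<Sum>j=0..n. 2 powr (real j * (\<alpha> * p + p - 1)) * Ecoef p (fourier_cos f) (fourier_sin f) j)"
    "\<And>f n. fourier_cos f 0 = 0 \<Longrightarrow> GM_with C (fourier_cos f) \<Longrightarrow> GM_with C (fourier_sin f) \<Longrightarrow>
      (\<Sum>j=0..n. 2 powr (real j * (\<alpha> * p + p - 1)) * Ecoef p (fourier_cos f) (fourier_sin f) j)
       \<le> K2 * (LINT x|circM. norm (weyl_deriv \<alpha> (fourier_sum (2 ^ n) f) x) powr p)"
proof (rule wpoly_Lp_bound[OF p C], goal_cases)
  case (1 K)
  note K = 1(2) 1(3)
  have r0: "0 < 2 powr \<alpha>" by simp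
  show ?case
  proof (rule dual_lower_pair[OF p C r0], goal_cases)
    case (1 L)
    note L = 1
    show ?case
    proof (rule that[of "K * (2 powr \<alpha>) powr p" "L * (2 powr \<alpha>) powr p"])
      fix f n assume f0: "fourier_cos f 0 = 0" and GM: "GM_with C (fourier_cos f)" "GM_with C (fourier_sin f)"
      let ?a = "fourier_cos f" and ?b = "fourier_sin f"
      let ?D = "weyl_deriv \<alpha> (fourier_sum (2 ^ n) f)"
      have D: "?D = wpoly ?a ?b (\<lambda>k. real k powr \<alpha>) (\<alpha> * pi / 2) 1 (2 ^ n)"
        using weyl_deriv_fourier_sum[OF f0] by (intro ext) simp
      have e: "2 powr (real j * (p - 1)) * (c * 2 powr (real j * \<alpha>)) powr p = c powr p * 2 powr (real j * (\<alpha> * p + p - 1))"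
        if "0 < c" for c j
        using that by (simp add: powr_mult powr_powr powr_add[symmetric] algebra_simps)
      have "(LINT x|circM. norm (?D x) powr p) \<le> K * (\<Sum>j=0..n. 2 powr (real j * (p - 1)) *
          (2 powr \<alpha> * 2 powr (real j * \<alpha>)) powr p * (norm (?a (2 ^ j)) powr p + norm (?b (2 ^ j)) powr p))"
        unfolding D
      proof (intro K(2)[OF GM])
        fix j k :: nat assume "k < 2 ^ Suc j"
        then have "real k \<le> 2 ^ Suc j" by (metis less_imp_le of_nat_le_iff of_nat_numeral of_nat_power)
        then have "real k powr \<alpha> \<le> (2 ^ Suc j) powr \<alpha>" using \<alpha> by (intro powr_mono2) auto
        also have "(2 ^ Suc j) powr \<alpha> = 2 powr \<alpha> * 2 powr (real j * \<alpha>)"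
          by (simp add: powr_mult powr_realpow[symmetric] powr_powr)
        finally show "real k powr \<alpha> \<le> 2 powr \<alpha> * 2 powr (real j * \<alpha>)" .
      qed (use \<alpha> in \<open>auto intro!: powr_mono2\<close>)
      also have "\<dots> = K * (2 powr \<alpha>) powr p * (\<Sum>j=0..n. 2 powr (real j * (\<alpha> * p + p - 1)) * Ecoef p ?a ?b j)"
        unfolding e[OF r0] by (simp add: Ecoef_def sum_distrib_left mult_ac)
      finally show "(LINT x|circM. norm (?D x) powr p) \<le> K * (2 powr \<alpha>) powr p * (\<Sum>j=0..n. 2 powr (real j * (\<alpha> * p + p - 1)) * Ecoef p ?a ?b j)" .
      define X where "X = (LINT x|circM. norm (?D x) powr p)"
      have Dm: "?D \<in> borel_measurable circM" unfolding D by (intro borel_measurable_circM) simp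
      have Di: "integrable circM (\<lambda>x. norm (?D x) powr p)" unfolding D using p by (intro wpoly_powr_integrable) simp
      have c1: "(LINT x|circM. ?D x * of_real (cos (real k * x + \<alpha> * pi / 2))) = of_real pi * (of_real (real k powr \<alpha>) * ?a k)"
        if "k \<in> {1..2 ^ n}" for k
        unfolding D wpoly_coeff[OF order_refl] using that by simp
      have c2: "(LINT x|circM. ?D x * of_real (cos (real k * x + (\<alpha> * pi / 2 - pi / 2)))) = of_real pi * (of_real (real k powr \<alpha>) * ?b k)"
        if "k \<in> {1..2 ^ n}" for k
        unfolding D wpoly_coeff[OF order_refl] using that by simp
      have db: "dual_bound p X (\<alpha> * pi / 2) (\<lambda>k. of_real (real k powr \<alpha>) * ?a k) {1..2 ^ n}"
        "dual_bound p X (\<alpha> * pi / 2 - pi / 2) (\<lambda>k. of_real (real k powr \<alpha>) * ?b k) {1..2 ^ n}"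
        unfolding X_def using c1 c2 by (auto intro!: dual_boundI[OF p Dm Di order_refl] simp del: of_real_mult)
      \<comment> \<open>The value of the weight \<open>real k powr \<alpha>\<close> at half the
        right end of the block, hence a lower bound on \<open>dyblock j\<close>; it grows by the
        factor \<open>2 powr \<alpha>\<close> per block.\<close>
      define l where "l j = 2 powr (- \<alpha>) * 2 powr (real j * \<alpha>)" for j :: nat
      have X0: "0 \<le> X" unfolding X_def by (intro integral_nonneg_AE) auto
      have "(\<Sum>j=0..n. 2 powr (real j * (p - 1)) * l j powr p * Ecoef p ?a ?b j) \<le> L * (X + (if (0::nat) = 0 then 0 else 2 powr (real 0 * (p - 1)) * l 0 powr p * Ecoef p ?a ?b 0))"
      proof (rule L(2)[OF GM db X0])
        fix j :: nat assume j: "j \<le> n"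
        have le: "(2::nat) ^ j \<le> 2 ^ n" using j by simp
        show "dyblock j \<subseteq> {1..2 ^ n}" by (auto intro: order_trans[OF _ le])
      next
        show "l (Suc j) \<le> 2 powr \<alpha> * l j" for j by (simp add: l_def powr_add[symmetric] algebra_simps)
      next
        fix j k :: nat assume k: "k \<in> dyblock j"
        have "(2 ^ j / 2) powr \<alpha> \<le> real k powr \<alpha>"
          using \<alpha> dyblock_half[OF k] by (intro powr_mono2) auto
        also have "(2 ^ j / 2) powr \<alpha> = l j" by (simp add: l_def powr_divide powr_minus powr_realpow[symmetric] powr_powr field_simps)
        finally show "l j \<le> real k powr \<alpha>" .
      qed (auto simp: l_def)
      also have "\<dots> = L * X" by simp
      finally have "(\<Sum>j=0..n. 2 powr (real j * (p - 1)) * l j powr p * Ecoef p ?a ?b j) \<le> L * X" .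
      moreover have "2 powr (real j * (p - 1)) * l j powr p * Ecoef p ?a ?b j = (2 powr (- \<alpha>)) powr p * (2 powr (real j * (\<alpha> * p + p - 1)) * Ecoef p ?a ?b j)" for j
        unfolding l_def e[of "2 powr (- \<alpha>)", simplified] by (simp add: mult_ac powr_powr)
      ultimately have "(2 powr (- \<alpha>)) powr p * (\<Sum>j=0..n. 2 powr (real j * (\<alpha> * p + p - 1)) * Ecoef p ?a ?b j) \<le> L * X"
        by (simp only: sum_distrib_left)
      then have "(2 powr \<alpha>) powr p * ((2 powr (- \<alpha>)) powr p * (\<Sum>j=0..n. 2 powr (real j * (\<alpha> * p + p - 1)) * Ecoef p ?a ?b j)) \<le> (2 powr \<alpha>) powr p * (L * X)"
        by (intro mult_left_mono) auto
      moreover have "(2 powr \<alpha>) powr p * (2 powr (- \<alpha>)) powr p = 1" by (simp add: powr_powr powr_add[symmetric])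
      ultimately show "(\<Sum>j=0..n. 2 powr (real j * (\<alpha> * p + p - 1)) * Ecoef p ?a ?b j) \<le> L * (2 powr \<alpha>) powr p * X"
        by (simp only: mult.assoc[symmetric]) (simp add: mult_ac)
    qed (use K L in auto)
  qed
qed

section \<open>Testing fractional differences\<close>

lemma integral_shift_cos:
  fixes g :: "real \<Rightarrow> complex"
  assumes g: "integrable circM g" "\<And>x. g (x + 2 * pi) = g x"
  shows "(LINT x|circM. g (x + c) * of_real (cos (real k * x + \<zeta>))) = (LINT x|circM. g x * of_real (cos (real k * x + (\<zeta> - real k * c))))"
proof -
  define G where "G x = g x * complex_of_real (cos (real k * x + (\<zeta> - real k * c)))" for x
  have Gi: "integrable circM G" unfolding G_def by (rule integrable_circM_cos[OF g(1)])
  have Gp: "G (x + 2 * pi) = G x" for x unfolding G_def cos_add_period g(2) ..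
  have e: "real k * (x + c) + (\<zeta> - real k * c) = real k * x + \<zeta>" for x by (simp add: algebra_simps)
  show ?thesis using circM_shift(2)[of G c, OF Gp Gi] by (simp only: G_def e)
qed

lemma frac_diff_shift_coeff_sums:
  assumes \<alpha>: "0 < \<alpha>" and f: "f \<in> Lp 1"
  shows "(\<lambda>\<nu>. of_real pi * (fourier_cos f k * of_real (bcoef \<alpha> \<nu> * cos (\<zeta> - real k * c - real k * \<alpha> * h + real \<nu> * (real k * h)))
       - fourier_sin f k * of_real (bcoef \<alpha> \<nu> * sin (\<zeta> - real k * c - real k * \<alpha> * h + real \<nu> * (real k * h)))))
     sums (LINT x|circM. frac_diff \<alpha> h f (x + c) * of_real (cos (real k * x + \<zeta>)))"
proof -
  have fi: "integrable circM f" using f by (intro Lp_integrable) auto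
  have d: "frac_diff \<alpha> h f \<in> Lp 1" by (rule frac_diff_Lp(1)[OF \<alpha> order_refl f])
  have di: "integrable circM (frac_diff \<alpha> h f)" using d by (intro Lp_integrable) auto
  have dp: "frac_diff \<alpha> h f (x + 2 * pi) = frac_diff \<alpha> h f x" for x using d by (simp add: Lp_iff)
  show ?thesis
    unfolding integral_shift_cos[where g = "frac_diff \<alpha> h f", OF di dp]
    using frac_diff_coeff_sums[OF \<alpha> f, of k "\<zeta> - real k * c" h]
    unfolding fourier_coeff_shift[OF fi] by (simp add: algebra_simps)
qed

text \<open>The shift by \<open>- (\<alpha> * h / 2)\<close> undoes the translation contained in the
  difference and the test phase \<open>\<alpha> * pi / 2\<close> its constant phase.
  \<open>\<phi> = 0\<close> selects the cosine coefficient, \<open>\<phi> = pi / 2\<close> the sine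
  coefficient.\<close>

lemma frac_diff_low_coeff:
  assumes \<alpha>: "0 < \<alpha>" and f: "f \<in> Lp 1" and k: "0 < real k * h" "real k * h < 2 * pi"
  shows "(LINT x|circM. frac_diff \<alpha> h f (x + - (\<alpha> * h / 2)) * of_real (cos (real k * x + (\<alpha> * pi / 2 - \<phi>))))
     = of_real pi * (of_real ((2 * sin (real k * h / 2)) powr \<alpha>) * (fourier_cos f k * of_real (cos \<phi>) + fourier_sin f k * of_real (sin \<phi>)))"
proof -
  define \<eta> where "\<eta> = (\<alpha> * pi / 2 - \<phi>) - real k * - (\<alpha> * h / 2) - real k * \<alpha> * h"
  have e1: "\<eta> - \<alpha> * (pi - real k * h) / 2 = - \<phi>" by (simp add: \<eta>_def field_simps)
  have e2: "(\<eta> + - (pi/2)) - \<alpha> * (pi - real k * h) / 2 = - \<phi> - pi/2" using e1 by linarith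
  have c: "(\<lambda>\<nu>. bcoef \<alpha> \<nu> * cos (\<eta> + real \<nu> * (real k * h))) sums ((2 * sin (real k * h / 2)) powr \<alpha> * cos \<phi>)"
    using bcoef_cos_sums[OF \<alpha> k, of \<eta>] unfolding e1 by simp
  have "(\<lambda>\<nu>. bcoef \<alpha> \<nu> * cos ((\<eta> + - (pi/2)) + real \<nu> * (real k * h))) sums ((2 * sin (real k * h / 2)) powr \<alpha> * cos (- \<phi> - pi/2))"
    using bcoef_cos_sums[OF \<alpha> k, of "\<eta> + - (pi/2)"] unfolding e2 .
  moreover have "cos (\<eta> + - (pi/2) + t) = sin (\<eta> + t)" for t by (simp add: sin_add cos_add sin_diff cos_diff)
  moreover have "cos (- \<phi> - pi/2) = - sin \<phi>" by (simp add: cos_diff)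
  ultimately have s: "(\<lambda>\<nu>. bcoef \<alpha> \<nu> * sin (\<eta> + real \<nu> * (real k * h))) sums ((2 * sin (real k * h / 2)) powr \<alpha> * - sin \<phi>)"
    by simp
  have "(\<lambda>\<nu>. of_real pi * (fourier_cos f k * of_real (bcoef \<alpha> \<nu> * cos (\<eta> + real \<nu> * (real k * h)))
       - fourier_sin f k * of_real (bcoef \<alpha> \<nu> * sin (\<eta> + real \<nu> * (real k * h)))))
     sums (of_real pi * (fourier_cos f k * of_real ((2 * sin (real k * h / 2)) powr \<alpha> * cos \<phi>)
       - fourier_sin f k * of_real ((2 * sin (real k * h / 2)) powr \<alpha> * - sin \<phi>)))"
    by (intro sums_mult sums_diff sums_of_real c s)
  from sums_unique2[OF frac_diff_shift_coeff_sums[OF \<alpha> f, of k "\<alpha> * pi / 2 - \<phi>" "- (\<alpha> * h / 2)" h, folded \<eta>_def] this]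
  show ?thesis by (simp add: algebra_simps)
qed

lemma dual_bound_low:
  assumes p: "1 < p" and \<alpha>: "0 < \<alpha>" and f: "f \<in> Lp p" and h: "0 < h"
    and X: "(LINT x|circM. norm (frac_diff \<alpha> h f x) powr p) \<le> X"
  shows "dual_bound p X (\<alpha> * pi / 2) (\<lambda>k. of_real ((2 * sin (real k * h / 2)) powr \<alpha>) * fourier_cos f k) {k. 0 < real k * h \<and> real k * h < 2 * pi}"
    "dual_bound p X (\<alpha> * pi / 2 - pi / 2) (\<lambda>k. of_real ((2 * sin (real k * h / 2)) powr \<alpha>) * fourier_sin f k) {k. 0 < real k * h \<and> real k * h < 2 * pi}"
proof -
  have f1: "f \<in> Lp 1" using p f by (intro Lp_subset_L1) auto
  have d: "frac_diff \<alpha> h f \<in> Lp p" using frac_diff_Lp(1)[OF \<alpha> _ f] p by simp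
  let ?\<Phi> = "\<lambda>x. frac_diff \<alpha> h f (x + - (\<alpha> * h / 2))"
  have s: "?\<Phi> \<in> Lp p" by (rule Lp_shift(1)[OF d])
  have m: "?\<Phi> \<in> borel_measurable circM" "integrable circM (\<lambda>x. norm (?\<Phi> x) powr p)"
    using s unfolding Lp_iff by (blast intro: borel_measurable_circM')+
  have le: "(LINT x|circM. norm (?\<Phi> x) powr p) \<le> X" using X unfolding Lp_shift(2)[OF d] .
  show "dual_bound p X (\<alpha> * pi / 2) (\<lambda>k. of_real ((2 * sin (real k * h / 2)) powr \<alpha>) * fourier_cos f k) {k. 0 < real k * h \<and> real k * h < 2 * pi}"
    using frac_diff_low_coeff[OF \<alpha> f1, of _ h 0] by (intro dual_boundI[OF p m le]) auto
  show "dual_bound p X (\<alpha> * pi / 2 - pi / 2) (\<lambda>k. of_real ((2 * sin (real k * h / 2)) powr \<alpha>) * fourier_sin f k) {k. 0 < real k * h \<and> real k * h < 2 * pi}"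
    using frac_diff_low_coeff[OF \<alpha> f1, of _ h "pi / 2"] by (intro dual_boundI[OF p m le]) auto
qed

lemma dual_bound_mid:
  assumes "dual_bound p X \<xi> c S" "dual_bound p X \<xi> c' S"
  shows "dual_bound p X \<xi> (\<lambda>k. (c k + c' k) / 2) S"
  unfolding dual_bound_def
proof (intro allI impI)
  fix K \<gamma> and \<mu> :: real assume K: "finite K \<and> K \<subseteq> S \<and> 0 < \<mu>"
  have eq: "(\<Sum>k\<in>K. \<gamma> k * ((c k + c' k) / 2)) = ((\<Sum>k\<in>K. \<gamma> k * c k) + (\<Sum>k\<in>K. \<gamma> k * c' k)) / 2"
    by (simp add: sum_divide_distrib sum.distrib[symmetric] distrib_left add_divide_distrib)
  have "Re ((z + z') / 2) = (Re z + Re z') / 2" for z z' by simp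
  then have eq2: "Re (\<Sum>k\<in>K. \<gamma> k * ((c k + c' k) / 2)) = (Re (\<Sum>k\<in>K. \<gamma> k * c k) + Re (\<Sum>k\<in>K. \<gamma> k * c' k)) / 2"
    by (simp only: eq)
  show "Re (\<Sum>k\<in>K. \<gamma> k * ((c k + c' k) / 2)) \<le> \<mu> powr p * X + \<mu> powr (- (p / (p - 1))) *
       (LINT x|circM. norm (\<Sum>k\<in>K. \<gamma> k * of_real (cos (real k * x + \<xi>))) powr (p / (p - 1)))"
  proof -
    have mid: "(s + t) / 2 \<le> R" if "s \<le> R" "t \<le> R" for s t R :: real using that by simp
    show ?thesis unfolding eq2
      by (rule mid) (use assms[unfolded dual_bound_def, rule_format, OF K] in auto)
  qed
qed

text \<open>The right-hand side of \<open>dual_bound\<close> does not depend on the multiplier, so the bound survives averaging in \<open>h\<close>.\<close>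
lemma dual_bound_average:
  fixes d :: "nat \<Rightarrow> complex" and N Q :: "nat \<Rightarrow> real \<Rightarrow> real"
  assumes H: "0 < H" and db: "\<And>h. 0 \<le> h \<Longrightarrow> h \<le> H \<Longrightarrow> dual_bound p X \<xi> (\<lambda>k. of_real (N k h) * d k) S"
    and Q: "\<And>k h. k \<in> S \<Longrightarrow> (Q k has_real_derivative N k h) (at h)" "\<And>k. k \<in> S \<Longrightarrow> Q k 0 = 0"
  shows "dual_bound p X \<xi> (\<lambda>k. of_real (Q k H / H) * d k) S"
  unfolding dual_bound_def
proof (intro allI impI; elim conjE)
  fix K and \<gamma> :: "nat \<Rightarrow> complex" and \<mu> :: real assume K: "finite K" "K \<subseteq> S" "0 < \<mu>"
  define R where "R = \<mu> powr p * X + \<mu> powr (- (p / (p - 1))) *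
       (LINT x|circM. norm (\<Sum>k\<in>K. \<gamma> k * of_real (cos (real k * x + \<xi>))) powr (p / (p - 1)))"
  define e where "e k = Re (\<gamma> k * d k)" for k
  have re: "Re (\<Sum>k\<in>K. \<gamma> k * (of_real (r k) * d k)) = (\<Sum>k\<in>K. r k * e k)" for r
    unfolding Re_sum by (intro sum.cong refl) (simp add: e_def algebra_simps)
  have le: "(\<Sum>k\<in>K. N k h * e k) \<le> R" if "0 \<le> h" "h \<le> H" for h
    using db[OF that] K unfolding dual_bound_def re[symmetric] R_def by blast
  \<comment> \<open>The derivative of \<open>\<Psi>\<close> is the slack of the bound at step
    \<open>h\<close>, so \<open>\<Psi>\<close> increases from 0. This replaces integration of the
    inequality over \<open>h\<close>.\<close>
  define \<Psi> where "\<Psi> h = R * h - (\<Sum>k\<in>K. Q k h * e k)" for h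
  have "\<Psi> 0 \<le> \<Psi> H"
  proof (rule DERIV_nonneg_imp_nondecreasing[where f = \<Psi> and a = 0 and b = H])
    show "0 \<le> H" using H by simp
    fix h assume h: "0 \<le> h" "h \<le> H"
    have "(\<Psi> has_real_derivative (R * 1 - (\<Sum>k\<in>K. N k h * e k))) (at h)"
      unfolding \<Psi>_def using K Q(1) by (intro DERIV_diff DERIV_cmult DERIV_ident DERIV_sum DERIV_cmult_right) auto
    then show "\<exists>y. (\<Psi> has_real_derivative y) (at h) \<and> 0 \<le> y" using le[OF h] by auto
  qed
  moreover have "\<Psi> 0 = 0" using K Q(2) by (auto simp: \<Psi>_def intro!: sum.neutral)
  ultimately have "(\<Sum>k\<in>K. Q k H * e k) / H \<le> R" using H by (simp add: \<Psi>_def field_simps)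
  then show "Re (\<Sum>k\<in>K. \<gamma> k * (of_real (Q k H / H) * d k)) \<le> \<mu> powr p * X + \<mu> powr (- (p / (p - 1))) *
       (LINT x|circM. norm (\<Sum>k\<in>K. \<gamma> k * of_real (cos (real k * x + \<xi>))) powr (p / (p - 1)))"
    unfolding re R_def by (simp add: sum_divide_distrib)
qed

text \<open>The real multiplier of the difference at step \<open>u / k\<close>, shifted to start at \<open>x\<close> and symmetrised in the step. Its mean over
  \<open>\<bar>u\<bar> \<le> U\<close> tends to \<open>bcoef \<alpha> 0 = 1\<close>, which makes the high frequencies visible although each single difference may
  annihilate some of them.\<close>
definition bcos :: "real \<Rightarrow> real \<Rightarrow> real" where
  "bcos \<alpha> u = (\<Sum>\<nu>. bcoef \<alpha> \<nu> * cos (real \<nu> * u))"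

lemma bcoef_bounded_summable:
  assumes "0 < \<alpha>" "\<And>\<nu>. \<bar>c \<nu>\<bar> \<le> 1"
  shows "summable (\<lambda>\<nu>. bcoef \<alpha> \<nu> * c \<nu>)"
proof (rule summable_comparison_test'[OF summable_bcoef[OF assms(1)], of 0])
  show "norm (bcoef \<alpha> n * c n) \<le> \<bar>bcoef \<alpha> n\<bar>" for n
    using assms(2)[of n] by (simp add: abs_mult mult_left_le)
qed

text \<open>Termwise integration of the cosine series: the term \<open>\<nu> = 0\<close> contributes
  \<open>h\<close>, every other one at most \<open>1 / real k\<close> times its coefficient. High
  frequencies thus average out to 1.\<close>

lemma bcos_antiderivative:
  assumes \<alpha>: "0 < \<alpha>" and k: "1 \<le> k"
  obtains Q where "\<And>h. (Q has_real_derivative bcos \<alpha> (real k * h)) (at h)" "Q 0 = 0"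
    "\<And>h. \<bar>Q h - h\<bar> \<le> Bsum \<alpha> / real k"
proof -
  define q where "q \<nu> h = (if \<nu> = 0 then h else sin (real \<nu> * (real k * h)) / (real \<nu> * real k))" for \<nu> h
  have q': "(q \<nu> has_real_derivative cos (real \<nu> * (real k * h))) (at h)" for \<nu> h
    using k unfolding q_def by (cases "\<nu> = 0") (auto intro!: derivative_eq_intros)
  have ul: "uniform_limit UNIV (\<lambda>n h. \<Sum>\<nu><n. bcoef \<alpha> \<nu> * cos (real \<nu> * (real k * h))) (\<lambda>h. bcos \<alpha> (real k * h)) sequentially"
    unfolding bcos_def
    by (rule Weierstrass_m_test[OF _ summable_bcoef[OF \<alpha>]]) (simp add: abs_mult mult_left_le)
  have "\<exists>g. \<forall>h\<in>UNIV. (\<lambda>\<nu>. bcoef \<alpha> \<nu> * q \<nu> h) sums g h \<and> (g has_real_derivative bcos \<alpha> (real k * h)) (at h within UNIV)"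
  proof (rule has_field_derivative_series[OF convex_UNIV _ ul, where ?x0.0 = 0])
    have "q n 0 = 0" for n by (simp add: q_def)
    then show "summable (\<lambda>n. bcoef \<alpha> n * q n 0)" by simp
  qed (auto intro!: DERIV_cmult q')
  then obtain g where g: "\<And>h. (\<lambda>\<nu>. bcoef \<alpha> \<nu> * q \<nu> h) sums g h" "\<And>h. (g has_real_derivative bcos \<alpha> (real k * h)) (at h)"
    by auto
  show ?thesis
  proof (rule that[of g])
    show "(g has_real_derivative bcos \<alpha> (real k * h)) (at h)" for h by (rule g(2))
    have "q \<nu> 0 = 0" for \<nu> by (simp add: q_def)
    then have "(\<lambda>\<nu>. bcoef \<alpha> \<nu> * q \<nu> 0) sums 0" by simp
    then show "g 0 = 0" using g(1) sums_unique2 by blast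
    fix h
    have s: "(\<lambda>\<nu>. bcoef \<alpha> (Suc \<nu>) * q (Suc \<nu>) h) sums (g h - h)"
      using g(1)[of h] by (subst sums_Suc_iff) (simp add: q_def)
    have b: "norm (bcoef \<alpha> (Suc \<nu>) * q (Suc \<nu>) h) \<le> \<bar>bcoef \<alpha> (Suc \<nu>)\<bar> * (1 / real k)" for \<nu>
    proof -
      have "\<bar>q (Suc \<nu>) h\<bar> \<le> 1 / (real (Suc \<nu>) * real k)"
        unfolding q_def using k by (simp add: abs_mult divide_right_mono del: of_nat_Suc)
      also have "\<dots> \<le> 1 / (1 * real k)" using k by (intro divide_left_mono mult_right_mono) auto
      finally have "\<bar>q (Suc \<nu>) h\<bar> \<le> 1 / (1 * real k)" .
      from mult_left_mono[OF this abs_ge_zero[of "bcoef \<alpha> (Suc \<nu>)"]] show ?thesis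
        by (simp add: abs_mult del: of_nat_Suc)
    qed
    have S: "summable (\<lambda>\<nu>. \<bar>bcoef \<alpha> (Suc \<nu>)\<bar>)" using summable_Suc_iff[of "\<lambda>\<nu>. \<bar>bcoef \<alpha> \<nu>\<bar>"] summable_bcoef[OF \<alpha>] by blast
    have "\<bar>g h - h\<bar> \<le> (\<Sum>\<nu>. \<bar>bcoef \<alpha> (Suc \<nu>)\<bar> * (1 / real k))"
      using norm_suminf_le[OF b summable_mult2[OF S]] s by (simp add: sums_iff)
    also have "\<dots> = (\<Sum>\<nu>. \<bar>bcoef \<alpha> (Suc \<nu>)\<bar>) * (1 / real k)" by (rule suminf_mult2[OF S, symmetric])
    also have "\<dots> \<le> Bsum \<alpha> * (1 / real k)"
    proof (intro mult_right_mono)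
      show "(\<Sum>\<nu>. \<bar>bcoef \<alpha> (Suc \<nu>)\<bar>) \<le> Bsum \<alpha>"
        unfolding Bsum_def using suminf_split_head[OF summable_bcoef[OF \<alpha>]] by simp
    qed auto
    finally show "\<bar>g h - h\<bar> \<le> Bsum \<alpha> / real k" by simp
  qed
qed

text \<open>Shifting by \<open>- (\<alpha> * s)\<close> turns the difference into a combination of
  the \<open>f (x - real \<nu> * s)\<close>. Averaging \<open>s = h\<close> with
  \<open>s = - h\<close> cancels the odd part in \<open>h\<close> and leaves the real multiplier
  \<open>bcos\<close>.\<close>

lemma dual_bound_sym:
  assumes p: "1 < p" and \<alpha>: "0 < \<alpha>" and f: "f \<in> Lp p"
    and X: "(LINT x|circM. norm (frac_diff \<alpha> h f x) powr p) \<le> X" "(LINT x|circM. norm (frac_diff \<alpha> (-h) f x) powr p) \<le> X"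
  shows "dual_bound p X \<zeta> (\<lambda>k. of_real (bcos \<alpha> (real k * h)) * (fourier_cos f k * of_real (cos \<zeta>) - fourier_sin f k * of_real (sin \<zeta>))) UNIV"
proof -
  have f1: "f \<in> Lp 1" using p f by (intro Lp_subset_L1) auto
  define u where "u s k \<nu> = fourier_cos f k * of_real (bcoef \<alpha> \<nu> * cos (\<zeta> + real \<nu> * (real k * s)))
       - fourier_sin f k * of_real (bcoef \<alpha> \<nu> * sin (\<zeta> + real \<nu> * (real k * s)))" for s k \<nu>
  have us: "summable (u s k)" for s k
    unfolding u_def using \<alpha>
    by (intro summable_diff summable_mult summable_of_real bcoef_bounded_summable) auto
  have one: "dual_bound p X \<zeta> (\<lambda>k. suminf (u s k)) UNIV"
    if Xs: "(LINT x|circM. norm (frac_diff \<alpha> s f x) powr p) \<le> X" for s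
  proof -
    have d: "frac_diff \<alpha> s f \<in> Lp p" using frac_diff_Lp(1)[OF \<alpha> _ f] p by simp
    let ?\<Phi> = "\<lambda>x. frac_diff \<alpha> s f (x + - (\<alpha> * s))"
    have sh: "?\<Phi> \<in> Lp p" by (rule Lp_shift(1)[OF d])
    have m: "?\<Phi> \<in> borel_measurable circM" "integrable circM (\<lambda>x. norm (?\<Phi> x) powr p)"
      using sh unfolding Lp_iff by (blast intro: borel_measurable_circM')+
    have le: "(LINT x|circM. norm (?\<Phi> x) powr p) \<le> X" using Xs unfolding Lp_shift(2)[OF d] .
    show ?thesis
    proof (rule dual_boundI[OF p m le])
      fix k
      have "(\<lambda>\<nu>. of_real pi * u s k \<nu>) sums (LINT x|circM. ?\<Phi> x * of_real (cos (real k * x + \<zeta>)))"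
        using frac_diff_shift_coeff_sums[OF \<alpha> f1, of k \<zeta> "- (\<alpha> * s)" s] unfolding u_def by (simp add: algebra_simps)
      moreover have "(\<lambda>\<nu>. of_real pi * u s k \<nu>) sums (of_real pi * suminf (u s k))"
        by (intro sums_mult summable_sums us)
      ultimately show "(LINT x|circM. ?\<Phi> x * of_real (cos (real k * x + \<zeta>))) = of_real pi * suminf (u s k)"
        by (rule sums_unique2)
    qed
  qed
  have "(suminf (u h k) + suminf (u (-h) k)) / 2 = of_real (bcos \<alpha> (real k * h)) * (fourier_cos f k * of_real (cos \<zeta>) - fourier_sin f k * of_real (sin \<zeta>))" for k
  proof -
    have "u h k \<nu> + u (-h) k \<nu> = of_real (bcoef \<alpha> \<nu> * cos (real \<nu> * (real k * h))) * (2 * (fourier_cos f k * of_real (cos \<zeta>) - fourier_sin f k * of_real (sin \<zeta>)))" for \<nu>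
      unfolding u_def by (simp add: cos_add sin_add cos_diff sin_diff algebra_simps)
    moreover have "(\<lambda>\<nu>. of_real (bcoef \<alpha> \<nu> * cos (real \<nu> * (real k * h))) * (2 * (fourier_cos f k * of_real (cos \<zeta>) - fourier_sin f k * of_real (sin \<zeta>))))
       sums (of_real (bcos \<alpha> (real k * h)) * (2 * (fourier_cos f k * of_real (cos \<zeta>) - fourier_sin f k * of_real (sin \<zeta>))))"
      unfolding bcos_def using \<alpha> by (intro sums_mult2 sums_of_real summable_sums bcoef_bounded_summable) auto
    moreover have "(\<lambda>\<nu>. u h k \<nu> + u (-h) k \<nu>) sums (suminf (u h k) + suminf (u (-h) k))"
      by (intro sums_add summable_sums us)
    ultimately have "suminf (u h k) + suminf (u (-h) k) = of_real (bcos \<alpha> (real k * h)) * (2 * (fourier_cos f k * of_real (cos \<zeta>) - fourier_sin f k * of_real (sin \<zeta>)))"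
      using sums_unique2 by fastforce
    then show ?thesis by simp
  qed
  then show ?thesis using dual_bound_mid[OF one[OF X(1)] one[OF X(2)]] by simp
qed

lemma dual_bound_high:
  assumes p: "1 < p" and \<alpha>: "0 < \<alpha>" and f: "f \<in> Lp p" and H: "0 < H"
    and X: "\<And>h. \<bar>h\<bar> \<le> H \<Longrightarrow> (LINT x|circM. norm (frac_diff \<alpha> h f x) powr p) \<le> X"
  obtains \<rho> where "\<And>k. 2 * Bsum \<alpha> \<le> real k * H \<Longrightarrow> 1 / 2 \<le> \<rho> k"
    "dual_bound p X 0 (\<lambda>k. of_real (\<rho> k) * fourier_cos f k) {1..}"
    "dual_bound p X (- (pi / 2)) (\<lambda>k. of_real (\<rho> k) * fourier_sin f k) {1..}"
proof -
  have "\<exists>Q. (\<forall>h. (Q has_real_derivative bcos \<alpha> (real k * h)) (at h)) \<and> Q 0 = 0 \<and> (\<forall>h. \<bar>Q h - h\<bar> \<le> Bsum \<alpha> / real k)"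
    if "1 \<le> k" for k
    using bcos_antiderivative[OF \<alpha> that] by metis
  then obtain Q where Q: "\<And>k h. 1 \<le> k \<Longrightarrow> (Q k has_real_derivative bcos \<alpha> (real k * h)) (at h)"
    "\<And>k. 1 \<le> k \<Longrightarrow> Q k 0 = 0" "\<And>k h. 1 \<le> k \<Longrightarrow> \<bar>Q k h - h\<bar> \<le> Bsum \<alpha> / real k"
    by metis
  have db: "dual_bound p X \<zeta> (\<lambda>k. of_real (Q k H / H) * (fourier_cos f k * of_real (cos \<zeta>) - fourier_sin f k * of_real (sin \<zeta>))) {1..}" for \<zeta>
  proof (rule dual_bound_average[OF H])
    fix h assume "0 \<le> h" "h \<le> H"
    then have "dual_bound p X \<zeta> (\<lambda>k. of_real (bcos \<alpha> (real k * h)) * (fourier_cos f k * of_real (cos \<zeta>) - fourier_sin f k * of_real (sin \<zeta>))) UNIV"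
      by (intro dual_bound_sym p \<alpha> f X) auto
    then show "dual_bound p X \<zeta> (\<lambda>k. of_real (bcos \<alpha> (real k * h)) * (fourier_cos f k * of_real (cos \<zeta>) - fourier_sin f k * of_real (sin \<zeta>))) {1..}"
      unfolding dual_bound_def by blast
  qed (use Q in auto)
  show ?thesis
  proof (rule that[of "\<lambda>k. Q k H / H"])
    \<comment> \<open>The averaged multiplier differs from 1 by at most
      \<open>Bsum \<alpha> / (real k * H)\<close>, which is at most \<open>1 / 2\<close> under this
      threshold.\<close>
    fix k assume k: "2 * Bsum \<alpha> \<le> real k * H"
    have B: "1 \<le> Bsum \<alpha>" by (rule Bsum_ge_1[OF \<alpha>])
    then have k1: "1 \<le> k" using k H by (cases k) auto
    have "H - Bsum \<alpha> / real k \<le> Q k H" using Q(3)[OF k1, of H] by linarith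
    moreover have "Bsum \<alpha> / real k \<le> H / 2" using k k1 by (simp add: field_simps)
    ultimately have "H / 2 \<le> Q k H" by linarith
    then show "1 / 2 \<le> Q k H / H" using H by (simp add: field_simps)
  next
    show "dual_bound p X 0 (\<lambda>k. of_real (Q k H / H) * fourier_cos f k) {1..}" using db[of 0] by simp
    show "dual_bound p X (- (pi / 2)) (\<lambda>k. of_real (Q k H / H) * fourier_sin f k) {1..}" using db[of "- (pi / 2)"] by simp
  qed
qed

section \<open>The modulus of smoothness\<close>

lemma Lp_norm_powr: "0 < p \<Longrightarrow> Lp_norm p f powr p = (LINT x|circM. norm (f x) powr p)"
  by (simp add: Lp_norm_def set_integral_circM powr_powr integral_nonneg_AE)

lemma modulus_ge:
  assumes \<alpha>: "0 < \<alpha>" and p: "1 \<le> p" and f: "f \<in> Lp p" and h: "\<bar>h\<bar> \<le> \<delta>"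
  shows "(LINT x|circM. norm (frac_diff \<alpha> h f x) powr p) \<le> modulus p \<alpha> f \<delta> powr p" "0 \<le> modulus p \<alpha> f \<delta>"
proof -
  have "bdd_above ((\<lambda>h. Lp_norm p (frac_diff \<alpha> h f)) ` {h. \<bar>h\<bar> \<le> \<delta>})"
  proof (rule bdd_aboveI2)
    fix h
    show "Lp_norm p (frac_diff \<alpha> h f) \<le> (Bsum \<alpha> powr p * (LINT x|circM. norm (f x) powr p)) powr (1 / p)"
      using frac_diff_Lp(2)[OF \<alpha> p f, of h] p
      by (auto simp: Lp_norm_def set_integral_circM intro!: powr_mono2 integral_nonneg_AE)
  qed
  then have le: "Lp_norm p (frac_diff \<alpha> h f) \<le> modulus p \<alpha> f \<delta>"
    unfolding modulus_def using h by (intro cSUP_upper) auto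
  have n0: "0 \<le> Lp_norm p (frac_diff \<alpha> h f)" by (simp add: Lp_norm_def)
  have "Lp_norm p (frac_diff \<alpha> h f) powr p \<le> modulus p \<alpha> f \<delta> powr p"
    using le p n0 by (intro powr_mono2) auto
  then show "(LINT x|circM. norm (frac_diff \<alpha> h f x) powr p) \<le> modulus p \<alpha> f \<delta> powr p"
    using p by (simp add: Lp_norm_powr)
  show "0 \<le> modulus p \<alpha> f \<delta>" using le n0 by simp
qed

lemma modulus_le:
  assumes p: "1 \<le> p" and \<delta>: "0 \<le> \<delta>"
    and Y: "\<And>h. \<bar>h\<bar> \<le> \<delta> \<Longrightarrow> (LINT x|circM. norm (frac_diff \<alpha> h f x) powr p) \<le> Y"
  shows "modulus p \<alpha> f \<delta> \<le> Y powr (1 / p)"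
  unfolding modulus_def
proof (rule cSUP_least)
  show "{h. \<bar>h\<bar> \<le> \<delta>} \<noteq> {}" using \<delta> by (auto intro!: exI[of _ 0])
  fix h assume "h \<in> {h. \<bar>h\<bar> \<le> \<delta>}"
  then show "Lp_norm p (frac_diff \<alpha> h f) \<le> Y powr (1 / p)"
    using Y[of h] p by (auto simp: Lp_norm_def set_integral_circM intro!: powr_mono2 integral_nonneg_AE)
qed

definition high_term :: "real \<Rightarrow> (real \<Rightarrow> complex) \<Rightarrow> nat \<Rightarrow> real" where
  "high_term p f j = 2 powr (real j * (p - 1)) * Ecoef p (fourier_cos f) (fourier_sin f) j"

text \<open>Comparable to \<open>dyadic_term p \<alpha> f n\<close>, by
  \<open>weyl_bounds\<close>.\<close>

definition low_sum :: "real \<Rightarrow> real \<Rightarrow> (real \<Rightarrow> complex) \<Rightarrow> nat \<Rightarrow> real" where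
  "low_sum p \<alpha> f n = 2 powr (- (real n * (\<alpha> * p))) *
     (\<Sum>j=0..n. 2 powr (real j * (\<alpha> * p + p - 1)) * Ecoef p (fourier_cos f) (fourier_sin f) j)"

lemma high_term_nonneg: "0 \<le> high_term p f j"
  by (simp add: high_term_def Ecoef_nonneg)

lemma low_sum_Suc: "low_sum p \<alpha> f (Suc n) = 2 powr (- (\<alpha> * p)) * low_sum p \<alpha> f n + high_term p f (Suc n)"
proof -
  have e1: "2 powr (- (real (Suc n) * (\<alpha> * p))) = 2 powr (- (\<alpha> * p)) * 2 powr (- (real n * (\<alpha> * p)))"
    by (simp add: powr_add[symmetric] algebra_simps)
  have e2: "2 powr (- (real (Suc n) * (\<alpha> * p))) * 2 powr (real (Suc n) * (\<alpha> * p + p - 1)) = 2 powr (real (Suc n) * (p - 1))"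
    unfolding powr_add[symmetric] by (rule arg_cong[where f = "\<lambda>z. 2 powr z"]) (simp add: algebra_simps)
  have "low_sum p \<alpha> f (Suc n) = 2 powr (- (real (Suc n) * (\<alpha> * p))) *
      (\<Sum>j=0..n. 2 powr (real j * (\<alpha> * p + p - 1)) * Ecoef p (fourier_cos f) (fourier_sin f) j)
    + (2 powr (- (real (Suc n) * (\<alpha> * p))) * 2 powr (real (Suc n) * (\<alpha> * p + p - 1))) * Ecoef p (fourier_cos f) (fourier_sin f) (Suc n)"
    unfolding low_sum_def by (simp only: sum.atLeast0_atMost_Suc distrib_left mult.assoc)
  then show ?thesis unfolding e2 unfolding e1 low_sum_def high_term_def by (simp only: mult.assoc)
qed

lemma low_sum_nonneg: "0 \<le> low_sum p \<alpha> f n"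
  by (auto simp: low_sum_def Ecoef_nonneg intro!: mult_nonneg_nonneg sum_nonneg)

lemma high_term_le_low_sum: "high_term p f n \<le> low_sum p \<alpha> f n"
proof (cases n)
  case 0
  then show ?thesis by (simp add: high_term_def low_sum_def)
next
  case (Suc m)
  then show ?thesis using low_sum_nonneg[of p \<alpha> f m] by (simp add: low_sum_Suc)
qed

text \<open>\<open>low_sum_Suc\<close> telescopes, so no double sum has to be exchanged.\<close>
lemma low_sum_summed:
  assumes "n \<le> m"
  shows "(1 - 2 powr (- (\<alpha> * p))) * (\<Sum>k=n..m. low_sum p \<alpha> f k) \<le> low_sum p \<alpha> f n + (\<Sum>j=Suc n..m. high_term p f j)"
proof -
  let ?s = "2 powr (- (\<alpha> * p))"
  have "(1 - ?s) * (\<Sum>k=n..m. low_sum p \<alpha> f k) + ?s * low_sum p \<alpha> f m = low_sum p \<alpha> f n + (\<Sum>j=Suc n..m. high_term p f j)"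
    using assms
  proof (induction m rule: dec_induct)
    case base
    then show ?case by (simp add: algebra_simps)
  next
    case (step m)
    have e: "(1 - s) * (A + L) + s * L = (1 - s) * A + L" for s A L :: real by (simp add: algebra_simps)
    have "(\<Sum>k=n..Suc m. low_sum p \<alpha> f k) = (\<Sum>k=n..m. low_sum p \<alpha> f k) + low_sum p \<alpha> f (Suc m)"
      "(\<Sum>j=Suc n..Suc m. high_term p f j) = (\<Sum>j=Suc n..m. high_term p f j) + high_term p f (Suc m)"
      using step.hyps by simp_all
    then show ?case using step.IH low_sum_Suc[of p \<alpha> f m] by (simp only: e)
  qed
  moreover have "0 \<le> ?s * low_sum p \<alpha> f m" by (simp add: low_sum_nonneg)
  ultimately show ?thesis by linarith
qed

section \<open>Upper bound for the modulus\<close>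

text \<open>Split \<open>f\<close> at frequency \<open>2 ^ n\<close>. Since
  \<open>2 ^ n * \<bar>h\<bar> \<le> 1\<close>, the multiplier of the difference is increasing on
  the polynomial part and \<open>wpoly_Lp_bound\<close> applies; for the tail the boundedness of the
  difference operator suffices.\<close>

lemma modulus_upper_bound:
  fixes p C \<alpha> :: real
  assumes p: "1 < p" and C: "0 \<le> C" and \<alpha>: "0 < \<alpha>"
  obtains K where "K > 0"
    "\<And>f n h Z. f \<in> Lp p \<Longrightarrow> fourier_cos f 0 = 0 \<Longrightarrow> GM_with C (fourier_cos f) \<Longrightarrow> GM_with C (fourier_sin f) \<Longrightarrow>
       (\<And>m. (\<Sum>j=n..m. high_term p f j) \<le> Z) \<Longrightarrow> \<bar>h\<bar> \<le> 2 powr (- real n) \<Longrightarrow>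
       (LINT x|circM. norm (frac_diff \<alpha> h f x) powr p) \<le> K * (low_sum p \<alpha> f n + Z)"
proof (rule fourier_tail_Lp[OF p C], goal_cases)
  case (1 K1)
  note K1 = 1(2) 1(3) and that = 1(1)
  show ?case
  proof (rule wpoly_Lp_bound[OF p C], goal_cases)
    case (1 K2)
    note K2 = 1
    define A where "A = K2 * (2 powr \<alpha>) powr p"
    define B where "B = Bsum \<alpha> powr p * K1"
    have A: "A > 0" using K2 by (simp add: A_def)
    have B: "B > 0" using K1 Bsum_ge_1[OF \<alpha>] by (simp add: B_def)
    show ?case
    proof (rule that[of "2 powr p * (A + B)"])
      show "0 < 2 powr p * (A + B)" using A B by simp
      fix f n h Z
      assume f: "f \<in> Lp p" "fourier_cos f 0 = 0" and GM: "GM_with C (fourier_cos f)" "GM_with C (fourier_sin f)"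
        and Z: "\<And>m. (\<Sum>j=n..m. high_term p f j) \<le> Z" and h: "\<bar>h\<bar> \<le> 2 powr (- real n)"
      let ?a = "fourier_cos f" and ?b = "fourier_sin f"
      define S where "S = fourier_sum (2 ^ n) f"
      have Sw: "S = wpoly ?a ?b (\<lambda>_. 1) 0 1 (2 ^ n)" unfolding S_def using fourier_sum_eq_wpoly[of f, OF f(2)] by (intro ext) simp
      have SL: "S \<in> Lp p" unfolding Sw using p by (intro wpoly_Lp) simp
      define r where "r x = f x - S x" for x
      have rL: "r \<in> Lp p"
        unfolding Lp_iff
      proof (intro conjI allI)
        show "r (x + 2 * pi) = r x" for x using f SL by (simp add: r_def Lp_iff)
        show rm: "r \<in> borel_measurable lebesgue" unfolding r_def using f SL by (intro borel_measurable_diff) (auto simp: Lp_iff)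
        show "integrable circM (\<lambda>x. norm (r x) powr p)"
        proof (rule Bochner_Integration.integrable_bound)
          show "integrable circM (\<lambda>x. 2 powr p * (norm (f x) powr p + norm (S x) powr p))"
            using f SL by (intro integrable_mult_right Bochner_Integration.integrable_add) (auto simp: Lp_iff)
          show "(\<lambda>x. norm (r x) powr p) \<in> borel_measurable circM"
            using borel_measurable_circM'[OF rm] by measurable
          have "norm (r x) powr p \<le> 2 powr p * (norm (f x) powr p + norm (S x) powr p)" for x
          proof -
            have "norm (r x) powr p \<le> (norm (f x) + norm (S x)) powr p"
              unfolding r_def using p by (intro powr_mono2 norm_triangle_ineq4) auto
            also have "\<dots> \<le> 2 powr p * (norm (f x) powr p + norm (S x) powr p)" using p by (intro add_powr_le) auto
            finally show ?thesis .
          qed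
          then show "AE x in circM. norm (norm (r x) powr p) \<le> norm (2 powr p * (norm (f x) powr p + norm (S x) powr p))"
            by (intro AE_I2) (auto intro: order_trans[OF _ abs_ge_self])
        qed
      qed
      have Z0: "0 \<le> Z" using order_trans[OF sum_nonneg Z[of n]] high_term_nonneg by blast
      have rb: "(LINT x|circM. norm (frac_diff \<alpha> h r x) powr p) \<le> B * Z"
      proof -
        have "(LINT x|circM. norm (r x) powr p) \<le> K1 * Z"
          unfolding r_def S_def using Z by (intro K1(2)[OF f GM]) (simp add: high_term_def)
        then have "Bsum \<alpha> powr p * (LINT x|circM. norm (r x) powr p) \<le> Bsum \<alpha> powr p * (K1 * Z)"
          by (intro mult_left_mono) auto
        then show ?thesis using frac_diff_Lp(2)[OF \<alpha> _ rL, of h] p by (simp add: B_def mult.assoc)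
      qed
      have Sd: "summable (\<lambda>\<nu>. of_real (bcoef \<alpha> \<nu>) * S (x + (\<alpha> - real \<nu>) * h)) \<and>
          (LINT x|circM. norm (frac_diff \<alpha> h S x) powr p) \<le> A * low_sum p \<alpha> f n" for x
      \<comment> \<open>The multiplier formula needs \<open>h \<noteq> 0\<close>. For
        \<open>h = 0\<close> the difference vanishes because the coefficients sum to 0.\<close>
      proof (cases "h = 0")
        case True
        have "(\<lambda>\<nu>. of_real (bcoef \<alpha> \<nu>) * S (x + (\<alpha> - real \<nu>) * h)) sums (of_real 0 * S x)" for x
          using True bcoef_suminf_0[OF \<alpha>] by (auto intro!: sums_mult2 sums_of_real simp del: of_real_0)
        then show ?thesis using A p low_sum_nonneg[of p \<alpha> f n] by (auto simp: sums_iff frac_diff_bcoef)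
      next
        case False
        have hn: "real (2 ^ n) * \<bar>h\<bar> \<le> 1"
        proof -
          have "real (2 ^ n) * \<bar>h\<bar> \<le> 2 powr real n * 2 powr (- real n)"
            using h by (intro mult_mono) (auto simp: powr_realpow)
          then show ?thesis by (simp add: powr_add[symmetric])
        qed
        then have hn': "real (2 ^ n) * \<bar>h\<bar> < 2 * pi" using pi_ge_two by linarith
        note sm = frac_diff_wpoly_sums[OF \<alpha> False hn', of ?a ?b, folded Sw]
        define W where "W = wpoly ?a ?b (\<lambda>k. (2 * sin (real k * \<bar>h\<bar> / 2)) powr \<alpha>) (sgn h * \<alpha> * pi / 2) 1 (2 ^ n)"
        have fd: "frac_diff \<alpha> h S x = W (x + \<alpha> * h / 2)" for x
          using sm by (simp add: frac_diff_bcoef sums_iff W_def)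
        have WL: "W \<in> Lp p" unfolding W_def using p by (intro wpoly_Lp) simp
        have kh: "0 \<le> real k * \<bar>h\<bar> / 2" "real k * \<bar>h\<bar> / 2 \<le> 1 / 2" if "k \<le> 2 ^ n" for k
        proof -
          have "real k * \<bar>h\<bar> \<le> real (2 ^ n) * \<bar>h\<bar>" using that by (intro mult_right_mono of_nat_mono) auto
          then show "real k * \<bar>h\<bar> / 2 \<le> 1 / 2" using hn by simp
        qed simp
        have sin_nn: "0 \<le> sin (real k * \<bar>h\<bar> / 2)" if "k \<le> 2 ^ n" for k
          using kh[OF that] pi_ge_two by (intro sin_ge_zero) auto
        have "(LINT x|circM. norm (frac_diff \<alpha> h S x) powr p) = (LINT x|circM. norm (W x) powr p)"
          unfolding fd by (rule Lp_shift(2)[OF WL])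
        also have "\<dots> \<le> K2 * (\<Sum>j=0..n. 2 powr (real j * (p - 1)) * (2 powr \<alpha> * 2 powr (- (real n * \<alpha>)) * 2 powr (real j * \<alpha>)) powr p *
            (norm (?a (2 ^ j)) powr p + norm (?b (2 ^ j)) powr p))"
          unfolding W_def
        proof (rule K2(2)[OF GM])
          fix k :: nat assume k: "1 \<le> k" "k < 2 ^ n"
          have "- (pi / 2) \<le> real k * \<bar>h\<bar> / 2"
            using kh(1)[of k] k pi_ge_two by linarith
          moreover have "real (Suc k) * \<bar>h\<bar> / 2 \<le> pi / 2"
            using kh(2)[of "Suc k"] k pi_ge_two by linarith
          ultimately have "sin (real k * \<bar>h\<bar> / 2) \<le> sin (real (Suc k) * \<bar>h\<bar> / 2)"
            by (intro sin_monotone_2pi_le) (auto intro!: divide_right_mono mult_right_mono)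
          then show "(2 * sin (real k * \<bar>h\<bar> / 2)) powr \<alpha> \<le> (2 * sin (real (Suc k) * \<bar>h\<bar> / 2)) powr \<alpha>"
            using sin_nn[of k] k \<alpha> by (intro powr_mono2) auto
        next
          fix j k :: nat assume k: "1 \<le> k" "k \<le> 2 ^ n" "2 ^ j \<le> k" "k < 2 ^ Suc j"
          have "2 * sin (real k * \<bar>h\<bar> / 2) \<le> real k * \<bar>h\<bar>"
            using sin_x_le_x[OF kh(1)[OF k(2)]] by simp
          also have "\<dots> \<le> real (2 ^ Suc j) * 2 powr (- real n)"
            using k h by (intro mult_mono of_nat_mono) auto
          finally have "(2 * sin (real k * \<bar>h\<bar> / 2)) powr \<alpha> \<le> (real (2 ^ Suc j) * 2 powr (- real n)) powr \<alpha>"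
            using sin_nn[OF k(2)] \<alpha> by (intro powr_mono2) auto
          also have "\<dots> = 2 powr \<alpha> * 2 powr (- (real n * \<alpha>)) * 2 powr (real j * \<alpha>)"
            by (simp add: powr_mult powr_realpow[symmetric] powr_powr)
          finally show "(2 * sin (real k * \<bar>h\<bar> / 2)) powr \<alpha> \<le> 2 powr \<alpha> * 2 powr (- (real n * \<alpha>)) * 2 powr (real j * \<alpha>)" .
        qed auto
        also have "\<dots> = A * low_sum p \<alpha> f n"
        proof -
          have "2 powr (real j * (p - 1)) * (2 powr \<alpha> * 2 powr (- (real n * \<alpha>)) * 2 powr (real j * \<alpha>)) powr p
             = (2 powr \<alpha>) powr p * (2 powr (- (real n * (\<alpha> * p))) * 2 powr (real j * (\<alpha> * p + p - 1)))" for j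
            by (simp add: powr_mult powr_powr powr_add[symmetric] algebra_simps)
          then show ?thesis by (simp add: A_def low_sum_def Ecoef_def sum_distrib_left mult_ac)
        qed
        finally show ?thesis using sm by (simp add: sums_iff)
      qed
      have Si: "integrable circM (\<lambda>x. norm (frac_diff \<alpha> h S x) powr p)"
        using frac_diff_Lp(1)[OF \<alpha> _ SL, of h] p by (simp add: Lp_iff)
      have ri: "integrable circM (\<lambda>x. norm (frac_diff \<alpha> h r x) powr p)"
        using frac_diff_Lp(1)[OF \<alpha> _ rL, of h] p by (simp add: Lp_iff)
      have fi: "integrable circM (\<lambda>x. norm (frac_diff \<alpha> h f x) powr p)"
        using frac_diff_Lp(1)[OF \<alpha> _ f(1), of h] p by (simp add: Lp_iff)
      have r1: "r \<in> Lp 1" using p rL by (intro Lp_subset_L1) auto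
      \<comment> \<open>Additivity of the difference needs both series to converge, which for the
        tail holds only almost everywhere.\<close>
      have "AE x in circM. norm (frac_diff \<alpha> h f x) powr p \<le> 2 powr p * (norm (frac_diff \<alpha> h S x) powr p + norm (frac_diff \<alpha> h r x) powr p)"
        using frac_diff_summable_AE[OF \<alpha> r1, of h]
      proof eventually_elim
        case (elim x)
        have "(\<lambda>\<nu>. of_real (bcoef \<alpha> \<nu>) * S (x + (\<alpha> - real \<nu>) * h) + of_real (bcoef \<alpha> \<nu>) * r (x + (\<alpha> - real \<nu>) * h))
          sums (frac_diff \<alpha> h S x + frac_diff \<alpha> h r x)"
          unfolding frac_diff_bcoef using Sd elim by (intro sums_add summable_sums) (auto intro: summable_norm_cancel)
        then have eq: "frac_diff \<alpha> h f x = frac_diff \<alpha> h S x + frac_diff \<alpha> h r x"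
          unfolding frac_diff_bcoef[of \<alpha> h f] by (simp add: r_def algebra_simps sums_iff)
        have "norm (frac_diff \<alpha> h f x) powr p \<le> (norm (frac_diff \<alpha> h S x) + norm (frac_diff \<alpha> h r x)) powr p"
          unfolding eq using p by (intro powr_mono2 norm_triangle_ineq) auto
        also have "\<dots> \<le> 2 powr p * (norm (frac_diff \<alpha> h S x) powr p + norm (frac_diff \<alpha> h r x) powr p)"
          using p by (intro add_powr_le) auto
        finally show ?case .
      qed
      then have "(LINT x|circM. norm (frac_diff \<alpha> h f x) powr p)
         \<le> (LINT x|circM. 2 powr p * (norm (frac_diff \<alpha> h S x) powr p + norm (frac_diff \<alpha> h r x) powr p))"
        using fi Si ri by (intro integral_mono_AE) auto
      also have "\<dots> = 2 powr p * ((LINT x|circM. norm (frac_diff \<alpha> h S x) powr p) + (LINT x|circM. norm (frac_diff \<alpha> h r x) powr p))"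
        using Si ri by simp
      also have "\<dots> \<le> 2 powr p * (A * low_sum p \<alpha> f n + B * Z)"
        using Sd rb by (intro mult_left_mono add_mono) auto
      also have "\<dots> \<le> 2 powr p * ((A + B) * (low_sum p \<alpha> f n + Z))"
        using A B Z0 low_sum_nonneg[of p \<alpha> f n] by (intro mult_left_mono) (auto simp: algebra_simps)
      finally show "(LINT x|circM. norm (frac_diff \<alpha> h f x) powr p) \<le> 2 powr p * (A + B) * (low_sum p \<alpha> f n + Z)"
        by (simp add: mult.assoc)
    qed
  qed
qed

section \<open>Lower bound for the modulus\<close>

lemma Ecoef_Suc_le:
  assumes "0 \<le> p" "0 \<le> C" "GM_with C a" "GM_with C b"
  shows "Ecoef p a b (Suc j) \<le> (1 + C) powr p * Ecoef p a b j"
proof -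
  have "norm (d (2 ^ Suc j)) powr p \<le> (1 + C) powr p * norm (d (2 ^ j)) powr p" if "GM_with C d" for d
  proof -
    have "norm (d (2 ^ Suc j)) powr p \<le> ((1 + C) * norm (d (2 ^ j))) powr p"
      using assms GM_with_norm_le[OF that, of "2 ^ j" "2 ^ Suc j"] by (intro powr_mono2) auto
    then show ?thesis using assms by (simp add: powr_mult)
  qed
  from this[OF assms(3)] this[OF assms(4)] show ?thesis by (simp add: Ecoef_def distrib_left)
qed

lemma modulus_lower_low:
  fixes p C \<alpha> :: real
  assumes p: "1 < p" and C: "0 \<le> C" and \<alpha>: "0 < \<alpha>"
  obtains K where "K > 0"
    "\<And>f n X. f \<in> Lp p \<Longrightarrow> GM_with C (fourier_cos f) \<Longrightarrow> GM_with C (fourier_sin f) \<Longrightarrow>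
       (LINT x|circM. norm (frac_diff \<alpha> (2 powr (- real n)) f x) powr p) \<le> X \<Longrightarrow> low_sum p \<alpha> f n \<le> K * X"
proof -
  have r0: "0 < 2 powr \<alpha>" by simp
  show ?thesis
  proof (rule dual_lower_pair[OF p C r0], goal_cases)
    case (1 L)
    note L = 1
    show ?case
    proof (rule that[of "(2 powr (2 * \<alpha>)) powr p * L"])
      show "0 < (2 powr (2 * \<alpha>)) powr p * L" using L by simp
      fix f n X
      assume f: "f \<in> Lp p" and GM: "GM_with C (fourier_cos f)" "GM_with C (fourier_sin f)"
        and X: "(LINT x|circM. norm (frac_diff \<alpha> (2 powr (- real n)) f x) powr p) \<le> X"
      let ?E = "Ecoef p (fourier_cos f) (fourier_sin f)"
      define h where "h = 2 powr (- real n)"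
      have h: "0 < h" "2 ^ n * h = 1" by (simp_all add: h_def powr_minus powr_realpow)
      have X0: "0 \<le> X" by (rule order_trans[OF _ X]) (auto intro: integral_nonneg_AE)
      have kh: "real k * h \<le> 1" if "k \<le> 2 ^ n" for k
      proof -
        have "real k * h \<le> real (2 ^ n) * h" using that h by (intro mult_right_mono of_nat_mono) auto
        then show ?thesis using h by simp
      qed
      have blk: "0 < k \<and> k \<le> 2 ^ n" if "j \<le> n" "k \<in> dyblock j" for j k
      proof -
        have "(2::nat) ^ j \<le> 2 ^ n" using that(1) by simp
        then show ?thesis using that(2) by (auto intro: order_trans)
      qed
      \<comment> \<open>This is \<open>(2 ^ j / 4 * h) powr \<alpha>\<close>: one factor
        \<open>1 / 2\<close> is the half angle \<open>real k * h / 2\<close>, the other the start of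
        the block at \<open>2 ^ j / 2\<close>. Jordan's inequality with \<open>pi < 4\<close> makes
        \<open>2 * sin\<close> of the half angle at least the half angle.\<close>
      define l where "l j = 2 powr (- (2 * \<alpha>)) * 2 powr (- (real n * \<alpha>)) * 2 powr (real j * \<alpha>)" for j :: nat
      have "(\<Sum>j=0..n. 2 powr (real j * (p - 1)) * l j powr p * ?E j)
          \<le> L * (X + (if (0::nat) = 0 then 0 else 2 powr (real 0 * (p - 1)) * l 0 powr p * ?E 0))"
      proof (rule L(2)[OF GM dual_bound_low[OF p \<alpha> f h(1) X[folded h_def]] X0])
        fix j :: nat assume j: "j \<le> n"
        show "dyblock j \<subseteq> {k. 0 < real k * h \<and> real k * h < 2 * pi}"
        proof
          fix k assume "k \<in> dyblock j"
          then have k: "0 < k" "k \<le> 2 ^ n" using blk[OF j] by auto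
          have "real k * h < 2 * pi" using kh[OF k(2)] pi_ge_two by linarith
          then show "k \<in> {k. 0 < real k * h \<and> real k * h < 2 * pi}" using k h by simp
        qed
        fix k assume k: "k \<in> dyblock j"
        let ?t = "real k * h / 2"
        have "2 * ?t / pi \<le> sin ?t"
          using kh[of k] blk[OF j k] h pi_ge_two by (intro jordan_sin_ge) auto
        moreover have "?t \<le> 2 * (2 * ?t / pi)"
        proof -
          have "?t * pi \<le> ?t * 4" using h pi_less_4 by (intro mult_left_mono) auto
          then show ?thesis by (simp add: pos_le_divide_eq mult_ac)
        qed
        ultimately have "?t \<le> 2 * sin ?t" by linarith
        moreover have "2 ^ j / 4 * h \<le> ?t" using dyblock_half[OF k] h by simp
        ultimately have "2 ^ j / 4 * h \<le> 2 * sin ?t" by (rule order_trans[rotated])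
        then have "(2 ^ j / 4 * h) powr \<alpha> \<le> (2 * sin ?t) powr \<alpha>"
          using h \<alpha> by (intro powr_mono2) auto
        moreover have "(2 ^ j / 4 * h) powr \<alpha> = l j"
        proof -
          have "2 ^ j / 4 * h = 2 powr (real j - 2 - real n)"
          proof -
            have "2 powr (real j - 2 - real n) = 2 ^ j / 4 / 2 ^ n"
              by (simp add: powr_diff powr_realpow)
            moreover have "h = 1 / 2 ^ n" using h(2) by (simp add: eq_divide_eq mult.commute)
            ultimately show ?thesis by simp
          qed
          then show ?thesis by (simp add: l_def powr_powr powr_add[symmetric] algebra_simps)
        qed
        ultimately show "l j \<le> (2 * sin ?t) powr \<alpha>" by simp
      next
        show "l (Suc j) \<le> 2 powr \<alpha> * l j" for j by (simp add: l_def powr_add[symmetric] algebra_simps)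
      qed (auto simp: l_def)
      then have "(\<Sum>j=0..n. 2 powr (real j * (p - 1)) * l j powr p * ?E j) \<le> L * X" by simp
      moreover have "2 powr (real j * (p - 1)) * l j powr p = (2 powr (- (2 * \<alpha>))) powr p * (2 powr (- (real n * (\<alpha> * p))) * 2 powr (real j * (\<alpha> * p + p - 1)))" for j
        by (simp add: l_def powr_mult powr_powr powr_add[symmetric] algebra_simps)
      ultimately have "(2 powr (- (2 * \<alpha>))) powr p * low_sum p \<alpha> f n \<le> L * X"
        by (simp add: low_sum_def sum_distrib_left mult.assoc)
      then have "(2 powr (2 * \<alpha>)) powr p * ((2 powr (- (2 * \<alpha>))) powr p * low_sum p \<alpha> f n) \<le> (2 powr (2 * \<alpha>)) powr p * (L * X)"
        by (intro mult_left_mono) auto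
      moreover have "(2 powr (2 * \<alpha>)) powr p * (2 powr (- (2 * \<alpha>))) powr p = 1" by (simp add: powr_powr powr_add[symmetric])
      ultimately show "low_sum p \<alpha> f n \<le> (2 powr (2 * \<alpha>)) powr p * L * X"
        by (simp only: mult.assoc[symmetric] mult_1_left)
    qed
  qed
qed

lemma modulus_lower_bound:
  fixes p C \<alpha> :: real
  assumes p: "1 < p" and C: "0 \<le> C" and \<alpha>: "0 < \<alpha>"
  obtains K where "K > 0"
    "\<And>f n m X. f \<in> Lp p \<Longrightarrow> GM_with C (fourier_cos f) \<Longrightarrow> GM_with C (fourier_sin f) \<Longrightarrow>
       (\<And>h. \<bar>h\<bar> \<le> 2 powr (- real n) \<Longrightarrow> (LINT x|circM. norm (frac_diff \<alpha> h f x) powr p) \<le> X) \<Longrightarrow>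
       low_sum p \<alpha> f n + (\<Sum>j=Suc n..m. high_term p f j) \<le> K * X"
proof (rule modulus_lower_low[OF p C \<alpha>], goal_cases)
  case (1 K1)
  note K1 = 1(2) 1(3) and that = 1(1)
  show ?case
  proof (rule dual_lower_pair[OF p C zero_less_one], goal_cases)
    case (1 L)
    note L = 1
    \<comment> \<open>From block \<open>n + J\<close> on,
      \<open>real k * H \<ge> 2 ^ J / 2 > 2 * Bsum \<alpha>\<close>, so the averaged multiplier is
      at least \<open>1 / 2\<close>. \<open>J\<close> depends on \<open>\<alpha>\<close>
      only.\<close>
    obtain J :: nat where J: "4 * Bsum \<alpha> < 2 ^ J" using real_arch_pow[of 2 "4 * Bsum \<alpha>"] by auto
    \<comment> \<open>Growth of \<open>high_term\<close> from one block to the next. Starting from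
      block \<open>n\<close>, where \<open>low_sum\<close> bounds it, this bridges the
      \<open>J\<close> blocks up to \<open>u\<close>, and also settles the boundary term at
      \<open>u\<close>.\<close>
    define M where "M = 2 powr (p - 1) * (1 + C) powr p"
    have M: "1 \<le> M"
    proof -
      have "1 * 1 \<le> M" unfolding M_def using p C by (intro mult_mono ge_one_powr_ge_zero) auto
      then show ?thesis by simp
    qed
    define MM where "MM = M ^ J * K1"
    have MM: "MM > 0" using M K1 by (simp add: MM_def)
    define K where "K = K1 + (real J * MM + 2 powr p * L * (1 + MM))"
    have K: "K > 0" using K1 MM L unfolding K_def by (intro add_pos_nonneg add_nonneg_nonneg mult_nonneg_nonneg) auto
    show ?case
    proof (rule that[OF K])
      fix f n m X
      assume f: "f \<in> Lp p" and GM: "GM_with C (fourier_cos f)" "GM_with C (fourier_sin f)"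
        and X: "\<And>h. \<bar>h\<bar> \<le> 2 powr (- real n) \<Longrightarrow> (LINT x|circM. norm (frac_diff \<alpha> h f x) powr p) \<le> X"
      let ?E = "Ecoef p (fourier_cos f) (fourier_sin f)"
      define H where "H = 2 powr (- real n)"
      have H: "0 < H" "2 ^ n * H = 1" by (simp_all add: H_def powr_minus powr_realpow)
      have X0: "0 \<le> X" by (rule order_trans[OF _ X[of 0]]) (auto intro: integral_nonneg_AE)
      have low: "low_sum p \<alpha> f n \<le> K1 * X" by (rule K1(2)[OF f GM X]) simp
      have t0: "high_term p f n \<le> K1 * X" using high_term_le_low_sum low by (rule order_trans)
      have tS: "high_term p f (Suc j) \<le> M * high_term p f j" for j
      proof -
        have "high_term p f (Suc j) \<le> 2 powr (real (Suc j) * (p - 1)) * ((1 + C) powr p * ?E j)"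
          unfolding high_term_def using p C GM by (intro mult_left_mono Ecoef_Suc_le) auto
        also have "real (Suc j) * (p - 1) = (p - 1) + real j * (p - 1)" by (simp add: algebra_simps)
        finally show ?thesis by (simp add: M_def high_term_def powr_add mult_ac)
      qed
      have tn: "high_term p f (n + i) \<le> M ^ i * (K1 * X)" for i
      proof (induction i)
        case (Suc i)
        have "high_term p f (n + Suc i) \<le> M * high_term p f (n + i)" using tS[of "n + i"] by simp
        also have "\<dots> \<le> M * (M ^ i * (K1 * X))" using Suc M by (intro mult_left_mono) auto
        finally show ?case by (simp add: mult_ac)
      qed (use t0 in simp)
      have tm: "high_term p f j \<le> MM * X" if "n \<le> j" "j \<le> n + J" for j
      proof -
        have "high_term p f j \<le> M ^ (j - n) * (K1 * X)" using tn[of "j - n"] that by simp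
        also have "\<dots> \<le> M ^ J * (K1 * X)" using M that X0 K1 by (intro mult_right_mono power_increasing) auto
        finally show ?thesis by (simp add: MM_def mult_ac)
      qed
      define u where "u = n + J"
      have hX: "\<And>h. \<bar>h\<bar> \<le> H \<Longrightarrow> (LINT x|circM. norm (frac_diff \<alpha> h f x) powr p) \<le> X" using X by (simp add: H_def)
      obtain \<rho> where \<rho>: "\<And>k. 2 * Bsum \<alpha> \<le> real k * H \<Longrightarrow> 1 / 2 \<le> \<rho> k"
        and db: "dual_bound p X 0 (\<lambda>k. of_real (\<rho> k) * fourier_cos f k) {1..}"
          "dual_bound p X (- (pi / 2)) (\<lambda>k. of_real (\<rho> k) * fourier_sin f k) {1..}"
        using dual_bound_high[OF p \<alpha> f H(1) hX] by blast
      have "(\<Sum>j=u..m. 2 powr (real j * (p - 1)) * (1 / 2) powr p * ?E j)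
         \<le> L * (X + (if u = 0 then 0 else 2 powr (real u * (p - 1)) * (1 / 2) powr p * ?E u))"
      proof (rule L(2)[OF GM db X0])
        fix j :: nat assume j: "u \<le> j"
        show "dyblock j \<subseteq> {1..}" by auto
        fix k assume k: "k \<in> dyblock j"
        have "(2::real) ^ (n + J) \<le> 2 ^ j" using j by (intro power_increasing) (auto simp: u_def)
        then have "2 ^ n * 2 ^ J / 2 \<le> real k" using dyblock_half[OF k] by (simp add: power_add)
        then have "2 ^ n * 2 ^ J / 2 * H \<le> real k * H" using H by (intro mult_right_mono) auto
        moreover have "2 ^ n * 2 ^ J / 2 * H = (2 ^ n * H) * (2 ^ J / 2)" by simp
        ultimately have "2 * Bsum \<alpha> \<le> real k * H" using J unfolding H(2) by linarith
        then show "1 / 2 \<le> \<rho> k" by (rule \<rho>)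
      qed auto
      also have "\<dots> \<le> L * (X + MM * X)"
      proof -
        have "(1 / 2 :: real) powr p \<le> 1" using p by (simp add: powr_le1)
        then have "2 powr (real u * (p - 1)) * (1 / 2) powr p * ?E u \<le> 2 powr (real u * (p - 1)) * 1 * ?E u"
          by (intro mult_right_mono mult_left_mono Ecoef_nonneg) auto
        also have "\<dots> \<le> MM * X" using tm[of u] by (simp add: high_term_def u_def)
        finally show ?thesis using L(1) MM X0 by (intro mult_left_mono add_left_mono) auto
      qed
      finally have hi0: "(\<Sum>j=u..m. 2 powr (real j * (p - 1)) * (1 / 2) powr p * ?E j) \<le> L * (X + MM * X)" .
      have hi: "(\<Sum>j=u..m. high_term p f j) \<le> 2 powr p * (L * (X + MM * X))"
      proof -
        have "(\<Sum>j=u..m. high_term p f j) = 2 powr p * (\<Sum>j=u..m. 2 powr (real j * (p - 1)) * (1 / 2) powr p * ?E j)"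
          unfolding sum_distrib_left high_term_def by (intro sum.cong refl) (simp add: powr_divide)
        then show ?thesis using hi0 by simp
      qed
      have "(\<Sum>j=Suc n..m. high_term p f j) \<le> (\<Sum>j\<in>{Suc n..<u} \<union> {u..m}. high_term p f j)"
        by (intro sum_mono2) (auto simp: high_term_nonneg)
      also have "\<dots> = (\<Sum>j=Suc n..<u. high_term p f j) + (\<Sum>j=u..m. high_term p f j)"
        by (rule sum.union_disjoint) auto
      also have "(\<Sum>j=Suc n..<u. high_term p f j) \<le> real (card {Suc n..<u}) * (MM * X)"
        by (rule sum_bounded_above) (auto simp: u_def intro: tm)
      also have "\<dots> \<le> real J * (MM * X)"
        using MM X0 by (intro mult_right_mono) (auto simp: u_def)
      finally have "low_sum p \<alpha> f n + (\<Sum>j=Suc n..m. high_term p f j) \<le> K1 * X + (real J * (MM * X) + 2 powr p * (L * (X + MM * X)))"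
        using low hi by linarith
      also have "\<dots> = K * X" by (simp add: K_def algebra_simps)
      finally show "low_sum p \<alpha> f n + (\<Sum>j=Suc n..m. high_term p f j) \<le> K * X" .
    qed
  qed
qed

theorem theorem9p2:
  fixes p \<alpha> C :: real
  assumes "1 < p" and "0 < \<alpha>"
  shows "\<exists>A>0. \<exists>B>0. \<forall>f \<in> Lp p \<inter> GM_hat.
           GM_with C (fourier_cos f) \<longrightarrow> GM_with C (fourier_sin f) \<longrightarrow>
           (\<forall>n::nat.
              dyadic_term p \<alpha> f summable_on {n..} \<and>
              A * (\<Sum>\<^sub>\<infinity>k\<in>{n..}. dyadic_term p \<alpha> f k) powr (1 / p)
                \<le> modulus p \<alpha> f (2 powr (- real n)) \<and>
              modulus p \<alpha> f (2 powr (- real n))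
                \<le> B * (\<Sum>\<^sub>\<infinity>k\<in>{n..}. dyadic_term p \<alpha> f k) powr (1 / p))"
proof -
  note p = assms(1) and \<alpha> = assms(2)
  \<comment> \<open>\<open>C\<close> may be negative, while the estimates assume a non-negative
    constant.\<close>
  define C' where "C' = max C 0"
  have C: "0 \<le> C'" "C \<le> C'" by (auto simp: C'_def)
  obtain K1 K2 where K12: "K1 > 0" "K2 > 0"
    and W1: "\<And>f n. fourier_cos f 0 = 0 \<Longrightarrow> GM_with C' (fourier_cos f) \<Longrightarrow> GM_with C' (fourier_sin f) \<Longrightarrow>
      (LINT x|circM. norm (weyl_deriv \<alpha> (fourier_sum (2 ^ n) f) x) powr p)
       \<le> K1 * (\<Sum>j=0..n. 2 powr (real j * (\<alpha> * p + p - 1)) * Ecoef p (fourier_cos f) (fourier_sin f) j)"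
    and W2: "\<And>f n. fourier_cos f 0 = 0 \<Longrightarrow> GM_with C' (fourier_cos f) \<Longrightarrow> GM_with C' (fourier_sin f) \<Longrightarrow>
      (\<Sum>j=0..n. 2 powr (real j * (\<alpha> * p + p - 1)) * Ecoef p (fourier_cos f) (fourier_sin f) j)
       \<le> K2 * (LINT x|circM. norm (weyl_deriv \<alpha> (fourier_sum (2 ^ n) f) x) powr p)"
    using weyl_bounds[OF p C(1) \<alpha>] by blast
  obtain Ku where Ku: "Ku > 0"
    "\<And>f n h Z. f \<in> Lp p \<Longrightarrow> fourier_cos f 0 = 0 \<Longrightarrow> GM_with C' (fourier_cos f) \<Longrightarrow> GM_with C' (fourier_sin f) \<Longrightarrow>
       (\<And>m. (\<Sum>j=n..m. high_term p f j) \<le> Z) \<Longrightarrow> \<bar>h\<bar> \<le> 2 powr (- real n) \<Longrightarrow>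
       (LINT x|circM. norm (frac_diff \<alpha> h f x) powr p) \<le> Ku * (low_sum p \<alpha> f n + Z)"
    using modulus_upper_bound[OF p C(1) \<alpha>] by blast
  obtain Kl where Kl: "Kl > 0"
    "\<And>f n m X. f \<in> Lp p \<Longrightarrow> GM_with C' (fourier_cos f) \<Longrightarrow> GM_with C' (fourier_sin f) \<Longrightarrow>
       (\<And>h. \<bar>h\<bar> \<le> 2 powr (- real n) \<Longrightarrow> (LINT x|circM. norm (frac_diff \<alpha> h f x) powr p) \<le> X) \<Longrightarrow>
       low_sum p \<alpha> f n + (\<Sum>j=Suc n..m. high_term p f j) \<le> Kl * X"
    using modulus_lower_bound[OF p C(1) \<alpha>] by blast
  define s where "s = 1 - 2 powr (- (\<alpha> * p))"
  have s: "s > 0" using p \<alpha> by (simp add: s_def powr_less_one)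
  define KA where "KA = K1 * (Kl / s)"
  have KA: "KA > 0" using K12 Kl s by (simp add: KA_def)
  define KB where "KB = 2 * Ku * K2"
  have KB: "KB > 0" using K12 Ku by (simp add: KB_def)
  show ?thesis
  proof (intro exI conjI ballI impI allI)
    show "0 < 1 / KA powr (1 / p)" "0 < KB powr (1 / p)" using KA KB by simp_all
    fix f and n :: nat
    assume fin: "f \<in> Lp p \<inter> GM_hat" and GM0: "GM_with C (fourier_cos f)" "GM_with C (fourier_sin f)"
    have f: "f \<in> Lp p" and f0: "fourier_cos f 0 = 0" using fin by (auto simp: GM_hat_def)
    have GM: "GM_with C' (fourier_cos f)" "GM_with C' (fourier_sin f)" using GM0 C(2) by (auto intro: GM_with_mono)
    let ?D = "dyadic_term p \<alpha> f"
    have D: "?D k = 2 powr (- (real k * (\<alpha> * p))) * (LINT x|circM. norm (weyl_deriv \<alpha> (fourier_sum (2 ^ k) f) x) powr p)" for k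
      using p by (simp add: dyadic_term_def Lp_norm_powr mult_ac)
    have D0: "0 \<le> ?D k" for k by (simp add: dyadic_term_def)
    have D1: "?D k \<le> K1 * low_sum p \<alpha> f k" for k
      using mult_left_mono[OF W1[OF f0 GM, of k], of "2 powr (- (real k * (\<alpha> * p)))"]
      unfolding D low_sum_def by (simp add: mult_ac)
    have D2: "low_sum p \<alpha> f k \<le> K2 * ?D k" for k
      using mult_left_mono[OF W2[OF f0 GM, of k], of "2 powr (- (real k * (\<alpha> * p)))"]
      unfolding D low_sum_def by (simp add: mult_ac)
    define \<omega> where "\<omega> = modulus p \<alpha> f (2 powr (- real n))"
    have \<omega>0: "0 \<le> \<omega>" unfolding \<omega>_def using p \<alpha> f by (intro modulus_ge(2)[of \<alpha> p f 0]) auto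
    have \<omega>: "(LINT x|circM. norm (frac_diff \<alpha> h f x) powr p) \<le> \<omega> powr p" if "\<bar>h\<bar> \<le> 2 powr (- real n)" for h
      unfolding \<omega>_def using p \<alpha> f that by (intro modulus_ge(1)) auto
    \<comment> \<open>Summability of the dyadic terms is part of the claim, so arbitrary finite sums
      are bounded before any infinite sum is formed.\<close>
    have fs: "sum ?D F \<le> KA * \<omega> powr p" if F: "finite F" "F \<subseteq> {n..}" for F
    proof -
      define m where "m = Max (insert n F)"
      have nm: "n \<le> m" and Fm: "F \<subseteq> {n..m}" using F by (auto simp: m_def)
      have "sum ?D F \<le> (\<Sum>k=n..m. ?D k)" using Fm D0 by (intro sum_mono2) auto
      also have "\<dots> \<le> K1 * (\<Sum>k=n..m. low_sum p \<alpha> f k)" unfolding sum_distrib_left by (intro sum_mono D1)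
      also have "\<dots> \<le> K1 * (Kl * \<omega> powr p / s)"
      proof (intro mult_left_mono)
        have "s * (\<Sum>k=n..m. low_sum p \<alpha> f k) \<le> Kl * \<omega> powr p"
          unfolding s_def by (rule order_trans[OF low_sum_summed[OF nm] Kl(2)[OF f GM \<omega>]])
        then show "(\<Sum>k=n..m. low_sum p \<alpha> f k) \<le> Kl * \<omega> powr p / s" using s by (simp add: pos_le_divide_eq mult.commute)
      qed (use K12 in auto)
      finally show ?thesis by (simp add: KA_def)
    qed
    have "bdd_above (sum ?D ` {F. F \<subseteq> {n..} \<and> finite F})" using fs by (intro bdd_aboveI2) auto
    then show summ: "?D summable_on {n..}" using D0 by (intro nonneg_bdd_above_summable_on) auto
    define \<Sigma> where "\<Sigma> = (\<Sum>\<^sub>\<infinity>k\<in>{n..}. ?D k)"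
    have \<Sigma>0: "0 \<le> \<Sigma>" unfolding \<Sigma>_def by (intro infsum_nonneg D0)
    have "\<Sigma> \<le> KA * \<omega> powr p" unfolding \<Sigma>_def by (intro infsum_le_finite_sums summ fs)
    then have "\<Sigma> powr (1 / p) \<le> (KA * \<omega> powr p) powr (1 / p)" using \<Sigma>0 p by (intro powr_mono2) auto
    also have "\<dots> = KA powr (1 / p) * \<omega>" using KA \<omega>0 p by (simp add: powr_mult powr_powr)
    finally have "1 / KA powr (1 / p) * \<Sigma> powr (1 / p) \<le> \<omega>" using KA by (simp add: field_simps)
    then show "1 / KA powr (1 / p) * (\<Sum>\<^sub>\<infinity>k\<in>{n..}. ?D k) powr (1 / p) \<le> modulus p \<alpha> f (2 powr (- real n))"
      by (simp only: \<Sigma>_def \<omega>_def)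
    have part: "sum ?D F \<le> \<Sigma>" if "finite F" "F \<subseteq> {n..}" for F
      unfolding \<Sigma>_def using that summ D0 by (intro finite_sum_le_infsum) auto
    have Z: "(\<Sum>j=n..m. high_term p f j) \<le> K2 * \<Sigma>" for m
    proof -
      have "(\<Sum>j=n..m. high_term p f j) \<le> (\<Sum>j=n..m. K2 * ?D j)"
        by (intro sum_mono order_trans[OF high_term_le_low_sum D2])
      also have "\<dots> = K2 * (\<Sum>j=n..m. ?D j)" by (simp add: sum_distrib_left)
      also have "\<dots> \<le> K2 * \<Sigma>" using K12 by (intro mult_left_mono part) auto
      finally show ?thesis .
    qed
    have lz: "low_sum p \<alpha> f n \<le> K2 * \<Sigma>"
    proof -
      have "?D n \<le> \<Sigma>" using part[of "{n}"] by simp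
      then have "K2 * ?D n \<le> K2 * \<Sigma>" using K12 by (intro mult_left_mono) auto
      then show ?thesis using D2[of n] by linarith
    qed
    have "modulus p \<alpha> f (2 powr (- real n)) \<le> (KB * \<Sigma>) powr (1 / p)"
    proof (rule modulus_le)
      fix h assume h: "\<bar>h\<bar> \<le> 2 powr (- real n)"
      have "(LINT x|circM. norm (frac_diff \<alpha> h f x) powr p) \<le> Ku * (low_sum p \<alpha> f n + K2 * \<Sigma>)"
        by (rule Ku(2)[OF f f0 GM Z h])
      also have "\<dots> \<le> Ku * (K2 * \<Sigma> + K2 * \<Sigma>)" using lz Ku(1) by (intro mult_left_mono) auto
      finally show "(LINT x|circM. norm (frac_diff \<alpha> h f x) powr p) \<le> KB * \<Sigma>" by (simp add: KB_def algebra_simps)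
    qed (use p in auto)
    also have "\<dots> = KB powr (1 / p) * \<Sigma> powr (1 / p)" using KB \<Sigma>0 by (simp add: powr_mult)
    finally show "modulus p \<alpha> f (2 powr (- real n)) \<le> KB powr (1 / p) * (\<Sum>\<^sub>\<infinity>k\<in>{n..}. ?D k) powr (1 / p)"
      by (simp only: \<Sigma>_def)
  qed
qed

end
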